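(* Let $U$ be a bounded connected open set in $\mathbb{R}^n$ with connected $C^\infty$ boundary. Suppose $f,g\in C^k(\mathbb{R}^n;\mathbb{R}^+)$. Then there exists a $C^k$ diffeomorphism $\varphi:\mathbb{R}^n\to\mathbb{R}^n$ such that $$\det(d\varphi)\, f\circ\varphi=\left(\frac{\int_U f}{\int_U g}\right) g$$ in a neighborhood of $\overline{U}$, and $\varphi|_{\partial U}=\mathrm{Id}$.
   Context: $\mathbb{R}^+=(0,\infty)$, and $C^k(\mathbb{R}^n;\mathbb{R}^+)$ is the set of $k$ times continuously differentiable functions $\mathbb{R}^n\to\mathbb{R}^+$, where the integer $k$ is the order of differentiability (no further restriction on $k$ is stated). Integrals are with respect to Lebesgue measure, and $d\varphi$ is the derivative of $\varphi$. *)

theory Defs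
  imports "HOL-Analysis.Analysis"
begin

text \<open>
  \<open>C_on k S f\<close>: the function is of class \<open>C\<^sup>k\<close> on \<open>S\<close>. Derivatives are two-sided, so this is
  only meant for open \<open>S\<close>. In finite dimension, the derivative is of class \<open>C\<^sup>k\<close> as an
  operator-valued map iff each directional derivative is, which avoids changing the codomain
  in the recursion.
\<close>

primrec C_on :: "nat \<Rightarrow> 'a::euclidean_space set \<Rightarrow> ('a \<Rightarrow> 'b::euclidean_space) \<Rightarrow> bool" where
  "C_on 0 S f \<longleftrightarrow> continuous_on S f"
| "C_on (Suc k) S f \<longleftrightarrow>
     (\<forall>x\<in>S. f differentiable (at x)) \<and>
     (\<forall>v. C_on k S (\<lambda>x. frechet_derivative f (at x) v))"

definition C_diffeomorphism ::
    "nat \<Rightarrow> 'a::euclidean_space set \<Rightarrow> 'b::euclidean_space set \<Rightarrow> ('a \<Rightarrow> 'b) \<Rightarrow> bool" where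
  "C_diffeomorphism k S T f \<longleftrightarrow>
     open S \<and> open T \<and> (\<exists>g. homeomorphism S T f g \<and> C_on k S f \<and> C_on k T g)"

text \<open>
  An open set has smooth boundary if near each boundary point a \<open>C\<^sup>\<infinity>\<close> diffeomorphism straightens
  the set to a half-space (so the set lies locally on one side of its boundary). The inverse in
  \<open>C_diffeomorphism\<close> is determined on the target, hence the quantifier over all \<open>k\<close> does express
  that the chart and its inverse are \<open>C\<^sup>\<infinity>\<close>.
\<close>

definition smooth_boundary :: "'a::euclidean_space set \<Rightarrow> bool" where
  "smooth_boundary U \<longleftrightarrow>
     (\<forall>p\<in>frontier U. \<exists>W D \<Phi>. \<exists>b\<in>Basis.
        p \<in> W \<and> (\<forall>k. C_diffeomorphism k W D (\<Phi> :: 'a \<Rightarrow> 'a)) \<and>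
        \<Phi> ` (W \<inter> U) = {y \<in> D. 0 < y \<bullet> b} \<and>
        \<Phi> ` (W \<inter> frontier U) = {y \<in> D. y \<bullet> b = 0})"

end

(*
  Moser's theorem without a flow. Given a positive density f and a compactly supported m vanishing
  on the boundary of U, let F be a primitive of f in a coordinate direction e. Moving each point
  along its e-line to where F takes the value of F + m gives a C^k diffeomorphism that fixes the
  boundary of U and pulls f back to f + d_e m; only one-dimensional monotonicity is needed, and no
  derivative is lost. Composing such maps with small steps (so that all intermediate densities stay
  positive) realises every finite sum of such terms d_e m. It remains to write c g - f, with c the
  quotient of the integrals, as such a sum near the closure of U. Near the boundary one integrates
  along a coordinate direction transversal to it, starting at the boundary. The remainder has compact
  support in U and integral zero; integrating out one coordinate at a time in boxes, and using
  connectedness of U, it is a sum of functions with vanishing line integrals.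
*)

theory Submission
  imports Defs
begin

section \<open>Calculus of C_on\<close>

text \<open>What has to be kept is the order k. A line primitive gains a derivative only in its own
  direction, so \<open>m\<close> is merely C^k, and only its derivative along e is known to be C^k
  again. The map is therefore defined implicitly by F(\<phi> x) = F x + m x with \<phi> x - x
  parallel to e, where every ingredient is C^k; its Jacobian is the quotient of the e-derivative of
  F + m at x by f(\<phi> x). At the boundary the change of density is prescribed, so
  \<open>m\<close> can be made to vanish on the frontier but not near it. Invariance of U then has
  to come from monotonicity along e-lines. The integral condition enters once: every term with m = 0
  on the frontier has integral 0 over U. Hence the boundary terms do not change the integral of the
  remainder, and the single coefficient left by the interior reduction must be 0. Away from the
  closure of U nothing is prescribed; there f is enlarged so that the corrected density is positive
  on the whole space.\<close>

lemma C_on_imp_continuous_on: "C_on k S f \<Longrightarrow> continuous_on S f"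
  by (cases k) (auto simp: continuous_at_imp_continuous_on differentiable_imp_continuous_within)

lemma C_on_subset: "C_on k S f \<Longrightarrow> T \<subseteq> S \<Longrightarrow> C_on k T f"
  by (induction k arbitrary: f) (auto intro: continuous_on_subset)

lemma C_on_SucD: "C_on (Suc k) S f \<Longrightarrow> C_on k S f"
proof (induction k arbitrary: f)
  case 0 then show ?case using C_on_imp_continuous_on[of "Suc 0" S f] by simp
next
  case (Suc k) then show ?case by simp
qed

lemma C_on_mono: "C_on k S f \<Longrightarrow> j \<le> k \<Longrightarrow> C_on j S f"
  by (induction k) (auto simp: le_Suc_eq dest: C_on_SucD simp del: C_on.simps)

lemma C_on_cong:
  assumes "open S" "\<And>x. x \<in> S \<Longrightarrow> f x = g x"
  shows "C_on k S f \<longleftrightarrow> C_on k S g"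
proof -
  have imp: "C_on k S g" if "C_on k S f" "\<And>x. x \<in> S \<Longrightarrow> f x = g x" for f g
    using that
  proof (induction k arbitrary: f g)
    case 0 then show ?case using continuous_on_cong by force
  next
    case (Suc k)
    have d: "f differentiable at x" if "x \<in> S" for x using Suc.prems that by auto
    have e: "frechet_derivative f (at x) = frechet_derivative g (at x)" if "x \<in> S" for x
      using frechet_derivative_transform_within_open[OF d assms(1)] Suc.prems that by blast
    have "g differentiable at x" if "x \<in> S" for x
      using d[OF that] has_derivative_transform_within_open[OF _ assms(1) that, of f _ UNIV g] Suc.prems(2)
      unfolding differentiable_def by blast
    moreover have "C_on k S (\<lambda>x. frechet_derivative g (at x) v)" for v
      by (rule Suc.IH[of "\<lambda>x. frechet_derivative f (at x) v"]) (use Suc.prems e in auto)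
    ultimately show ?case by simp
  qed
  show ?thesis using imp[of f g] imp[of g f] assms by auto
qed

lemma C_on_SucI:
  assumes "open S" "\<And>x. x \<in> S \<Longrightarrow> (f has_derivative f' x) (at x)"
    and "\<And>v. C_on k S (\<lambda>x. f' x v)"
  shows "C_on (Suc k) S f"
proof -
  have "frechet_derivative f (at x) = f' x" if "x \<in> S" for x
    using frechet_derivative_at[OF assms(2)[OF that]] by simp
  then have "C_on k S (\<lambda>x. frechet_derivative f (at x) v)" for v
    using C_on_cong[OF assms(1), of "\<lambda>x. frechet_derivative f (at x) v" "\<lambda>x. f' x v"] assms(3) by simp
  then show ?thesis using assms(2) by (auto simp: differentiable_def)
qed

lemma C_on_derivative:
  assumes "C_on (Suc k) S f" "x \<in> S"
  shows "(f has_derivative frechet_derivative f (at x)) (at x)"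
  using assms frechet_derivative_works by auto

lemma C_on_differentiable: "C_on k S f \<Longrightarrow> 1 \<le> k \<Longrightarrow> x \<in> S \<Longrightarrow> f differentiable (at x)"
  by (cases k) auto

lemma C_on_const [simp]: "C_on k S (\<lambda>x. c)"
  by (induction k arbitrary: c) auto

lemma C_on_bounded_linear:
  assumes "bounded_linear f" shows "C_on k S f"
proof (cases k)
  case 0 then show ?thesis using assms by (simp add: linear_continuous_on)
next
  case (Suc j)
  have "(f has_derivative f) (at x)" for x
    using assms bounded_linear_imp_has_derivative by blast
  then have "C_on (Suc j) UNIV f" by (intro C_on_SucI[where f'="\<lambda>_. f"]) auto
  then show ?thesis using Suc C_on_subset by blast
qed

lemma C_on_id [simp]: "C_on k S (\<lambda>x. x)"
  by (rule C_on_bounded_linear) (rule bounded_linear_ident)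

lemma C_on_bounded_linear_compose:
  assumes "open S" "bounded_linear L" "C_on k S f"
  shows "C_on k S (\<lambda>x. L (f x))"
  using assms(3)
proof (induction k arbitrary: f)
  case 0 then show ?case using assms(2) by (simp add: bounded_linear.continuous_on)
next
  case (Suc k)
  show ?case
  proof (rule C_on_SucI[OF assms(1)])
    show "((\<lambda>x. L (f x)) has_derivative (\<lambda>v. L (frechet_derivative f (at x) v))) (at x)" if "x \<in> S" for x
      using bounded_linear.has_derivative[OF assms(2)] C_on_derivative[OF Suc.prems that] by blast
  qed (use Suc in auto)
qed

lemma C_on_add:
  assumes "open S" "C_on k S f" "C_on k S g"
  shows "C_on k S (\<lambda>x. f x + g x)"
  using assms(2,3)
proof (induction k arbitrary: f g)
  case 0 then show ?case by (simp add: continuous_on_add)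
next
  case (Suc k)
  show ?case
  proof (rule C_on_SucI[OF assms(1)])
    fix x assume "x \<in> S"
    note C_on_derivative[OF Suc.prems(1) this] C_on_derivative[OF Suc.prems(2) this]
    then show "((\<lambda>x. f x + g x) has_derivative
        (\<lambda>v. frechet_derivative f (at x) v + frechet_derivative g (at x) v)) (at x)"
      by (rule has_derivative_add)
  qed (use Suc in auto)
qed

lemma C_on_uminus: "open S \<Longrightarrow> C_on k S f \<Longrightarrow> C_on k S (\<lambda>x. - f x)"
  using C_on_bounded_linear_compose[OF _ bounded_linear_minus[OF bounded_linear_ident]] by blast

lemma C_on_diff: "open S \<Longrightarrow> C_on k S f \<Longrightarrow> C_on k S g \<Longrightarrow> C_on k S (\<lambda>x. f x - g x)"
  using C_on_add[of S k f "\<lambda>x. - g x"] C_on_uminus by auto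

lemma C_on_scaleR:
  fixes f :: "'a::euclidean_space \<Rightarrow> real" and g :: "'a \<Rightarrow> 'b::euclidean_space"
  assumes "open S" "C_on k S f" "C_on k S g"
  shows "C_on k S (\<lambda>x. f x *\<^sub>R g x)"
  using assms(2,3)
proof (induction k arbitrary: f g)
  case 0 then show ?case by (simp add: continuous_on_scaleR)
next
  case (Suc k)
  show ?case
  proof (rule C_on_SucI[OF assms(1)])
    fix x assume "x \<in> S"
    note C_on_derivative[OF Suc.prems(1) this] C_on_derivative[OF Suc.prems(2) this]
    then show "((\<lambda>x. f x *\<^sub>R g x) has_derivative
        (\<lambda>v. f x *\<^sub>R frechet_derivative g (at x) v + frechet_derivative f (at x) v *\<^sub>R g x)) (at x)"
      by (rule has_derivative_scaleR)
  next
    fix v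
    have "C_on k S f" "C_on k S g" using Suc.prems C_on_SucD by blast+
    then show "C_on k S (\<lambda>x. f x *\<^sub>R frechet_derivative g (at x) v + frechet_derivative f (at x) v *\<^sub>R g x)"
      using Suc by (intro C_on_add[OF assms(1)] Suc.IH) auto
  qed
qed

lemma C_on_mult:
  fixes f g :: "'a::euclidean_space \<Rightarrow> real"
  shows "open S \<Longrightarrow> C_on k S f \<Longrightarrow> C_on k S g \<Longrightarrow> C_on k S (\<lambda>x. f x * g x)"
  using C_on_scaleR[of S k f g] by simp

lemma C_on_sum:
  assumes "open S" "\<And>i. i \<in> I \<Longrightarrow> C_on k S (f i)"
  shows "C_on k S (\<lambda>x. \<Sum>i\<in>I. f i x)"
  using assms(2)
  by (induction I rule: infinite_finite_induct) (auto intro: C_on_add[OF assms(1)])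

lemma C_on_prod:
  fixes f :: "'i \<Rightarrow> 'a::euclidean_space \<Rightarrow> real"
  assumes "open S" "\<And>i. i \<in> I \<Longrightarrow> C_on k S (f i)"
  shows "C_on k S (\<lambda>x. \<Prod>i\<in>I. f i x)"
  using assms(2)
  by (induction I rule: infinite_finite_induct) (auto intro: C_on_mult[OF assms(1)])

lemma C_on_compose:
  fixes f :: "'a::euclidean_space \<Rightarrow> 'b::euclidean_space" and g :: "'b \<Rightarrow> 'c::euclidean_space"
  assumes "open S" "open T" "C_on k T g" "C_on k S f" "f ` S \<subseteq> T"
  shows "C_on k S (\<lambda>x. g (f x))"
  using assms(3-5)
proof (induction k arbitrary: g)
  case 0 then show ?case by (auto intro: continuous_on_compose2)
next
  case (Suc k)
  show ?case
  proof (rule C_on_SucI[OF assms(1)])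
    fix x assume x: "x \<in> S"
    have f: "(f has_derivative frechet_derivative f (at x)) (at x)"
      using C_on_derivative[OF Suc.prems(2) x] .
    have g: "(g has_derivative frechet_derivative g (at (f x))) (at (f x))"
      using C_on_derivative[OF Suc.prems(1)] Suc.prems(3) x by blast
    have "((\<lambda>x. g (f x)) has_derivative (\<lambda>v. frechet_derivative g (at (f x)) (frechet_derivative f (at x) v))) (at x)"
      using has_derivative_compose[OF f g] .
    \<comment> \<open>The inner direction varies with x, whereas the induction hypothesis covers
      derivatives of g in a fixed direction only. Expanding in the basis leaves fixed directions
      with C^k coefficients.\<close>
    also have "(\<lambda>v. frechet_derivative g (at (f x)) (frechet_derivative f (at x) v)) = (\<lambda>v. \<Sum>b\<in>Basis.
        (frechet_derivative f (at x) v \<bullet> b) *\<^sub>R frechet_derivative g (at (f x)) b)"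
    proof
      fix v
      define w where "w = frechet_derivative f (at x) v"
      have lin: "linear (frechet_derivative g (at (f x)))" using g has_derivative_linear by blast
      have "frechet_derivative g (at (f x)) w = frechet_derivative g (at (f x)) (\<Sum>b\<in>Basis. (w \<bullet> b) *\<^sub>R b)"
        by (simp only: euclidean_representation)
      also have "\<dots> = (\<Sum>b\<in>Basis. (w \<bullet> b) *\<^sub>R frechet_derivative g (at (f x)) b)"
        by (simp add: linear_sum[OF lin] linear_cmul[OF lin])
      finally show "frechet_derivative g (at (f x)) (frechet_derivative f (at x) v) = (\<Sum>b\<in>Basis.
          (frechet_derivative f (at x) v \<bullet> b) *\<^sub>R frechet_derivative g (at (f x)) b)"
        unfolding w_def .
    qed
    finally show "((\<lambda>x. g (f x)) has_derivative (\<lambda>v. \<Sum>b\<in>Basis.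
        (frechet_derivative f (at x) v \<bullet> b) *\<^sub>R frechet_derivative g (at (f x)) b)) (at x)"
      .
  next
    fix v
    have "C_on k S f" using Suc.prems C_on_SucD by blast
    moreover have "C_on k T (\<lambda>y. frechet_derivative g (at y) b)" for b using Suc.prems by simp
    ultimately have "C_on k S (\<lambda>x. frechet_derivative g (at (f x)) b)" for b
      using Suc.IH[of "\<lambda>y. frechet_derivative g (at y) b"] Suc.prems(3) by blast
    moreover have "C_on k S (\<lambda>x. frechet_derivative f (at x) v \<bullet> b)" for b
      using Suc.prems by (intro C_on_bounded_linear_compose[OF assms(1) bounded_linear_inner_left]) auto
    ultimately show "C_on k S (\<lambda>x. \<Sum>b\<in>Basis. (frechet_derivative f (at x) v \<bullet> b) *\<^sub>R frechet_derivative g (at (f x)) b)"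
      by (intro C_on_sum[OF assms(1)] C_on_scaleR[OF assms(1)]) auto
  qed
qed

lemma C_on_inverse_real: "C_on k {x. x \<noteq> 0} (inverse :: real \<Rightarrow> real)"
proof (induction k)
  case 0 then show ?case by (auto intro!: continuous_intros)
next
  case (Suc k)
  have o: "open {x. x \<noteq> (0::real)}" by (simp add: open_Collect_neq)
  show ?case
  proof (rule C_on_SucI[OF o])
    show "(inverse has_derivative (\<lambda>v. - (inverse x * v * inverse x))) (at x)" if "x \<in> {x. x \<noteq> 0}" for x :: real
      using that has_derivative_inverse' by blast
    show "C_on k {x. x \<noteq> 0} (\<lambda>x::real. - (inverse x * v * inverse x))" for v
      using Suc by (intro C_on_uminus C_on_mult o) auto
  qed
qed

lemma C_on_divide:
  fixes f g :: "'a::euclidean_space \<Rightarrow> real"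
  assumes "open S" "C_on k S f" "C_on k S g" "\<And>x. x \<in> S \<Longrightarrow> g x \<noteq> 0"
  shows "C_on k S (\<lambda>x. f x / g x)"
proof -
  have o: "open {x. x \<noteq> (0::real)}" by (simp add: open_Collect_neq)
  have "C_on k S (\<lambda>x. inverse (g x))"
    by (rule C_on_compose[OF assms(1) o C_on_inverse_real assms(3)]) (use assms(4) in auto)
  then show ?thesis unfolding divide_inverse using C_on_mult assms by blast
qed

text \<open>The gluing device for functions defined by cases: it suffices to be C^k on two open sets
  that cover the space, typically a chart and the complement of a support.\<close>

lemma C_on_Un:
  assumes "open S" "open T" "C_on k S f" "C_on k T f"
  shows "C_on k (S \<union> T) f"
  using assms(3,4)
proof (induction k arbitrary: f)
  case 0 then show ?case using continuous_on_open_Un[OF assms(1,2)] by simp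
next
  case (Suc k)
  from Suc.prems have "C_on k (S \<union> T) (\<lambda>x. frechet_derivative f (at x) v)" for v
    by (intro Suc.IH) simp_all
  with Suc.prems show ?case by auto
qed

lemma C_on_inner:
  assumes "open S" "C_on k S f"
  shows "C_on k S (\<lambda>x. f x \<bullet> b)"
  using C_on_bounded_linear_compose[OF assms(1) bounded_linear_inner_left assms(2)] .

lemma C_on_inner_self:
  assumes "open S" "C_on k S f"
  shows "C_on k S (\<lambda>x. f x \<bullet> f x)"
proof -
  have "C_on k S (\<lambda>x. \<Sum>b\<in>Basis. (f x \<bullet> b) * (f x \<bullet> b))"
    by (intro C_on_sum C_on_mult C_on_inner assms)
  moreover have "(\<Sum>b\<in>Basis. (f x \<bullet> b) * (f x \<bullet> b)) = f x \<bullet> f x" for x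
    by (rule euclidean_inner[symmetric])
  ultimately show ?thesis by (simp only:)
qed

section \<open>Straightening a function along a coordinate direction\<close>

text \<open>Differentiation under the integral sign reproduces the shape of the statement: the
  derivative in direction v is the integral of the derivative of f in direction (v, 0), so induction
  on k applies.\<close>

lemma C_on_integral_param:
  fixes f :: "'a::euclidean_space \<times> real \<Rightarrow> real"
  assumes "C_on k UNIV f"
  shows "C_on k UNIV (\<lambda>x. integral (cbox a b) (\<lambda>t. f (x, t)))"
  using assms
proof (induction k arbitrary: f)
  case 0
  have "continuous_on (UNIV \<times> cbox a b) (\<lambda>(x, t). f (x, t))"
    using 0 continuous_on_subset by auto
  from integral_continuous_on_param[OF this] show ?case by simp
next
  case (Suc k)
  define D where "D = (\<lambda>x t v. frechet_derivative f (at (x, t)) (v, 0))"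
  have df: "(f has_derivative frechet_derivative f (at z)) (at z)" for z
    using C_on_derivative[OF Suc.prems] by simp
  have dx: "((\<lambda>x. f (x, t)) has_derivative D x t) (at x)" for x t
  proof -
    have "((\<lambda>x. (x, t)) has_derivative (\<lambda>v. (v, 0))) (at x)"
      by (auto intro!: derivative_eq_intros)
    from has_derivative_compose[OF this df] show ?thesis unfolding D_def .
  qed
  have bl: "bounded_linear (D x t)" for x t using dx has_derivative_bounded_linear by blast
  have blD: "blinfun_apply (Blinfun (D x t)) v = frechet_derivative f (at (x, t)) (v, 0)" for x t v
    by (simp only: bounded_linear_Blinfun_apply[OF bl]) (simp only: D_def)
  have contf: "continuous_on UNIV f" using Suc.prems C_on_imp_continuous_on by blast
  have CD: "C_on k UNIV (\<lambda>z. frechet_derivative f (at z) (v, 0))" for v using Suc.prems by simp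
  \<comment> \<open>\<open>leibniz_rule\<close> wants continuity in the operator norm; in finite
    dimension this follows from continuity on each basis vector.\<close>
  have contD: "continuous_on (UNIV \<times> cbox a b) (\<lambda>(x, t). Blinfun (D x t))"
  proof (rule continuous_on_blinfun_componentwise)
    fix i :: 'a assume "i \<in> Basis"
    have "continuous_on (UNIV \<times> cbox a b) (\<lambda>z. frechet_derivative f (at z) (i, 0))"
      using C_on_imp_continuous_on[OF CD] continuous_on_subset by blast
    then show "continuous_on (UNIV \<times> cbox a b) (\<lambda>z. blinfun_apply (case z of (x, t) \<Rightarrow> Blinfun (D x t)) i)"
      by (simp only: split_beta blD prod.collapse)
  qed
  have contDx: "continuous_on (cbox a b) (\<lambda>t. Blinfun (D x t))" for x
  proof -
    have "continuous_on (cbox a b) (\<lambda>t. (case (x, t) of (x, t) \<Rightarrow> Blinfun (D x t)))"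
      by (rule continuous_on_compose2[OF contD]) (auto intro!: continuous_intros)
    then show ?thesis by (simp only: prod.case)
  qed
  have int: "(\<lambda>t. f (x, t)) integrable_on cbox a b" for x
    by (intro integrable_continuous continuous_on_compose2[OF contf]) (auto intro!: continuous_intros)
  have main: "((\<lambda>x. integral (cbox a b) (\<lambda>t. f (x, t))) has_derivative
      blinfun_apply (integral (cbox a b) (\<lambda>t. Blinfun (D x t)))) (at x)" for x
    by (rule leibniz_rule[where f="\<lambda>x t. f (x, t)" and fx="\<lambda>x t. Blinfun (D x t)" and U=UNIV])
      (simp_all only: bounded_linear_Blinfun_apply[OF bl] dx int contD UNIV_I convex_UNIV)
  have eq: "blinfun_apply (integral (cbox a b) (\<lambda>t. Blinfun (D x t))) v =
      integral (cbox a b) (\<lambda>t. frechet_derivative f (at (x, t)) (v, 0))" for x v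
  proof -
    have "integral (cbox a b) ((\<lambda>B. blinfun_apply B v) \<circ> (\<lambda>t. Blinfun (D x t))) =
        blinfun_apply (integral (cbox a b) (\<lambda>t. Blinfun (D x t))) v"
      by (rule integral_linear[OF integrable_continuous[OF contDx] blinfun.bounded_linear_left])
    then show ?thesis by (simp only: o_def blD)
  qed
  show ?case
    by (rule C_on_SucI[where f'="\<lambda>x. blinfun_apply (integral (cbox a b) (\<lambda>t. Blinfun (D x t)))", OF open_UNIV main])
      (simp only: eq, rule Suc.IH, rule CD)
qed

text \<open>
  This is \<open>\<integral>\<^sub>0\<^bsup>x \<bullet> e\<^esup> f (x + (s - x \<bullet> e) *\<^sub>R e) ds\<close>, rescaled to constant limits so that one may
  differentiate under the integral sign in all directions.
\<close>
definition line_primitive :: "'a::euclidean_space \<Rightarrow> ('a \<Rightarrow> real) \<Rightarrow> 'a \<Rightarrow> real" where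
  "line_primitive e f x = (x \<bullet> e) * integral {0..1} (\<lambda>t. f (x + (t * (x \<bullet> e) - x \<bullet> e) *\<^sub>R e))"

lemma C_on_line_primitive:
  assumes "C_on k UNIV f"
  shows "C_on k UNIV (line_primitive e f)"
proof -
  have b: "bounded_linear (\<lambda>z. fst z \<bullet> e)" for e :: 'a
    by (rule bounded_linear_compose[OF bounded_linear_inner_left bounded_linear_fst])
  have "C_on k UNIV (\<lambda>z::'a\<times>real. fst z + (snd z * (fst z \<bullet> e) - fst z \<bullet> e) *\<^sub>R e)"
    by (intro C_on_add C_on_scaleR C_on_diff C_on_mult C_on_bounded_linear C_on_const open_UNIV
        bounded_linear_fst bounded_linear_snd b)
  from C_on_compose[OF open_UNIV open_UNIV assms this subset_UNIV]
  have "C_on k UNIV (\<lambda>x. integral (cbox 0 1) (\<lambda>t. f (x + (t * (x \<bullet> e) - x \<bullet> e) *\<^sub>R e)))"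
    using C_on_integral_param[of k "\<lambda>z. f (fst z + (snd z * (fst z \<bullet> e) - fst z \<bullet> e) *\<^sub>R e)" 0 1]
    by (simp only: fst_conv snd_conv)
  then show ?thesis unfolding line_primitive_def[abs_def]
    by (intro C_on_mult[OF open_UNIV C_on_bounded_linear[OF bounded_linear_inner_left]]) (simp only: cbox_interval)
qed

lemma line_primitive_has_derivative_line:
  assumes "continuous_on UNIV f" "norm e = 1"
  shows "((\<lambda>s. line_primitive e f (x + s *\<^sub>R e)) has_real_derivative f (x + s *\<^sub>R e)) (at s)"
proof -
  \<comment> \<open>\<open>x0\<close> is the point of the line with e-coordinate 0, so
    \<open>p\<close> is f along the line as a function of the e-coordinate, and the primitive starts
    at 0.\<close>
  define x0 where "x0 = x - (x \<bullet> e) *\<^sub>R e"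
  define p where "p = (\<lambda>\<tau>. f (x0 + \<tau> *\<^sub>R e))"
  have ee: "e \<bullet> e = 1" using assms(2) by (simp add: dot_square_norm)
  have p: "continuous_on A p" for A unfolding p_def
    by (intro continuous_on_compose2[OF assms(1)] continuous_intros) auto
  \<comment> \<open>Antiderivatives are taken on compact intervals. \<open>R\<close> makes [-R, R]
    contain 0 and, with margin 1, the coordinate in question; the margin makes that point interior
    and allows the ball of parameters of radius 1 used at the end.\<close>
  define R where "R = \<bar>x \<bullet> e + s\<bar> + 1"
  obtain P where P: "\<And>\<tau>. \<tau> \<in> {-R..R} \<Longrightarrow> (P has_vector_derivative p \<tau>) (at \<tau> within {-R..R})"
    using antiderivative_continuous[OF p] by blast
  have line: "line_primitive e f (x + s *\<^sub>R e) = P (x \<bullet> e + s) - P 0" if "\<bar>x \<bullet> e + s\<bar> \<le> R" for s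
  proof -
    define \<sigma> where "\<sigma> = x \<bullet> e + s"
    have sub: "(\<lambda>t. t * \<sigma>) ` {0..1} \<subseteq> {-R..R}"
    proof clarsimp
      fix t :: real assume t: "0 \<le> t" "t \<le> 1"
      have "\<bar>t * \<sigma>\<bar> \<le> 1 * \<bar>\<sigma>\<bar>" unfolding abs_mult using t by (intro mult_right_mono) auto
      then have "\<bar>t * \<sigma>\<bar> \<le> R" using that unfolding \<sigma>_def by simp
      then show "- R \<le> t * \<sigma> \<and> t * \<sigma> \<le> R" by (simp add: abs_le_iff)
    qed
    have "((\<lambda>t. P (t * \<sigma>)) has_vector_derivative \<sigma> *\<^sub>R p (t * \<sigma>)) (at t within {0..1})" if "t \<in> {0..1}" for t
    proof -
      have 1: "((\<lambda>t. t * \<sigma>) has_vector_derivative \<sigma>) (at t within {0..1})"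
        by (auto intro!: derivative_eq_intros simp: has_real_derivative_iff_has_vector_derivative[symmetric])
      have 2: "(P has_vector_derivative p (t * \<sigma>)) (at (t * \<sigma>) within (\<lambda>t. t * \<sigma>) ` {0..1})"
        using P sub that has_vector_derivative_within_subset by blast
      show ?thesis using vector_diff_chain_within[OF 1 2] by (simp add: o_def)
    qed
    then have "((\<lambda>t. \<sigma> *\<^sub>R p (t * \<sigma>)) has_integral (P (1 * \<sigma>) - P (0 * \<sigma>))) {0..1}"
      by (intro fundamental_theorem_of_calculus) auto
    then have "integral {0..1} (\<lambda>t. \<sigma> *\<^sub>R p (t * \<sigma>)) = P (1 * \<sigma>) - P (0 * \<sigma>)"
      by (rule integral_unique)
    then have "\<sigma> * integral {0..1} (\<lambda>t. p (t * \<sigma>)) = P \<sigma> - P 0" by simp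
    moreover have "line_primitive e f (x + s *\<^sub>R e) = \<sigma> * integral {0..1} (\<lambda>t. p (t * \<sigma>))"
      unfolding line_primitive_def p_def x0_def \<sigma>_def
      by (simp add: inner_add_left ee algebra_simps)
    ultimately show ?thesis by (simp add: \<sigma>_def)
  qed
  have "(P has_vector_derivative p (x \<bullet> e + s)) (at (x \<bullet> e + s))"
  proof -
    have "x \<bullet> e + s \<in> interior {-R..R}" unfolding R_def by auto
    moreover have "x \<bullet> e + s \<in> {-R..R}" unfolding R_def by auto
    ultimately show ?thesis using P[of "x \<bullet> e + s"] at_within_interior[of "x \<bullet> e + s" "{-R..R}"] by simp
  qed
  then have "(P has_real_derivative p (x \<bullet> e + s)) (at (x \<bullet> e + s))"
    by (simp add: has_real_derivative_iff_has_vector_derivative)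
  then have "((\<lambda>s. P (x \<bullet> e + s) - P 0) has_real_derivative p (x \<bullet> e + s)) (at s)"
    by (auto intro!: derivative_eq_intros DERIV_chain2[where f=P])
  moreover have eq: "p (x \<bullet> e + s) = f (x + s *\<^sub>R e)" by (simp add: p_def x0_def algebra_simps)
  moreover have ev: "\<forall>\<^sub>F u in nhds s. P (x \<bullet> e + u) - P 0 = line_primitive e f (x + u *\<^sub>R e)"
    by (rule eventually_nhds_in_open[THEN eventually_mono, of "ball s 1"])
      (auto simp: R_def dist_real_def line)
  ultimately show ?thesis using DERIV_cong_ev[OF refl ev eq] by blast
qed

lemma has_derivative_along_line:
  assumes "(F has_derivative F') (at (x + s *\<^sub>R e))"
  shows "((\<lambda>t. F (x + t *\<^sub>R e)) has_real_derivative F' e) (at s)"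
proof -
  have "((\<lambda>t. x + t *\<^sub>R e) has_derivative (\<lambda>t. t *\<^sub>R e)) (at s)"
    by (auto intro!: derivative_eq_intros)
  from has_derivative_compose[OF this assms]
  have "((\<lambda>t. F (x + t *\<^sub>R e)) has_derivative (\<lambda>t. F' (t *\<^sub>R e))) (at s)" .
  moreover have "F' (t *\<^sub>R e) = F' e * t" for t
    using linear_cmul[OF has_derivative_linear[OF assms]] by (simp add: mult.commute)
  ultimately show ?thesis unfolding has_field_derivative_def by simp
qed

lemma frechet_derivative_along_line:
  fixes F :: "'a::euclidean_space \<Rightarrow> real"
  assumes "F differentiable (at x)" "((\<lambda>t. F (x + t *\<^sub>R e)) has_real_derivative d) (at 0)"
  shows "frechet_derivative F (at x) e = d"
proof -
  have "(F has_derivative frechet_derivative F (at x)) (at (x + 0 *\<^sub>R e))"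
    using assms(1) frechet_derivative_works by auto
  from has_derivative_along_line[OF this] assms(2) show ?thesis by (rule DERIV_unique)
qed

lemma frechet_derivative_line_primitive:
  assumes "C_on k UNIV f" "1 \<le> k" "norm e = 1"
  shows "frechet_derivative (line_primitive e f) (at x) e = f x"
  using frechet_derivative_along_line[of "line_primitive e f" x e "f x"]
    line_primitive_has_derivative_line[OF C_on_imp_continuous_on[OF assms(1)] assms(3), of x 0]
    C_on_differentiable[OF C_on_line_primitive[OF assms(1)] assms(2)] by simp

lemma strict_increasing_along_line:
  fixes F :: "'a::euclidean_space \<Rightarrow> real"
  assumes "convex S" "\<And>x. x \<in> S \<Longrightarrow> F differentiable (at x)"
    and "\<And>x. x \<in> S \<Longrightarrow> 0 < frechet_derivative F (at x) e"
    and "x \<in> S" "x + s *\<^sub>R e \<in> S" "0 < s"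
  shows "F x < F (x + s *\<^sub>R e)"
proof -
  have "x + t *\<^sub>R e \<in> S" if "0 \<le> t" "t \<le> s" for t
  proof -
    have "(1 - t / s) *\<^sub>R x + (t / s) *\<^sub>R (x + s *\<^sub>R e) \<in> S"
      using assms that by (intro convexD) auto
    moreover have "(1 - t / s) *\<^sub>R x + (t / s) *\<^sub>R (x + s *\<^sub>R e) = x + t *\<^sub>R e"
      using assms(6) by (simp add: algebra_simps)
    ultimately show ?thesis by simp
  qed
  then have "\<exists>y. ((\<lambda>t. F (x + t *\<^sub>R e)) has_real_derivative y) (at t) \<and> 0 < y" if "0 \<le> t" "t \<le> s" for t
    using that assms(2,3) has_derivative_along_line[of F _ x t e] frechet_derivative_works by blast
  then have "(\<lambda>t. F (x + t *\<^sub>R e)) 0 < (\<lambda>t. F (x + t *\<^sub>R e)) s"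
    by (rule DERIV_pos_imp_increasing[OF assms(6)])
  then show ?thesis by simp
qed

text \<open>For a unit vector e the e-coordinate of x is replaced by F x and the others are kept: F
  becomes a coordinate function.\<close>

definition straighten :: "'a::euclidean_space \<Rightarrow> ('a \<Rightarrow> real) \<Rightarrow> 'a \<Rightarrow> 'a" where
  "straighten e F x = x + (F x - x \<bullet> e) *\<^sub>R e"

text \<open>Injectivity is monotonicity of F along e-lines, where convexity of S enters; openness of
  the image is invariance of domain; the derivative of the inverse is explicit, and its smoothness
  follows by bootstrapping.\<close>

lemma straighten_inverse:
  fixes F :: "'a::euclidean_space \<Rightarrow> real"
  assumes S: "open S" "convex S" and F: "C_on k S F" "1 \<le> k" and e: "e \<in> Basis"
    and pos: "\<And>x. x \<in> S \<Longrightarrow> 0 < frechet_derivative F (at x) e"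
  shows "inj_on (straighten e F) S" "open (straighten e F ` S)"
    "C_on k (straighten e F ` S) (inv_into S (straighten e F))"
proof -
  have ee: "e \<bullet> e = 1" using e by simp
  have dF: "F differentiable (at x)" if "x \<in> S" for x using C_on_differentiable[OF F that] .
  show inj: "inj_on (straighten e F) S"
  proof (rule inj_onI)
    fix x y assume xy: "x \<in> S" "y \<in> S" "straighten e F x = straighten e F y"
    define s where "s = (F x - x \<bullet> e) - (F y - y \<bullet> e)"
    have y: "y = x + s *\<^sub>R e" using xy(3) unfolding straighten_def s_def by (simp add: algebra_simps)
    have "straighten e F x \<bullet> e = F x" for x by (simp add: straighten_def inner_add_left ee)
    then have "F x = F y" using xy(3) by metis
    moreover have "F x < F y" if "s > 0"
      using strict_increasing_along_line[OF S(2) dF pos xy(1), of s] xy(2) that y by simp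
    moreover have "F y < F x" if "s < 0"
      using strict_increasing_along_line[OF S(2) dF pos xy(2), of "-s"] xy(1) that y by simp
    ultimately have "s = 0" by fastforce
    then show "x = y" using y by simp
  qed
  have C: "C_on k S (straighten e F)" unfolding straighten_def[abs_def]
    by (intro C_on_add C_on_scaleR C_on_diff C_on_inner C_on_const C_on_id S F)
  then have cont: "continuous_on S (straighten e F)" using C_on_imp_continuous_on by blast
  show op: "open (straighten e F ` S)" using invariance_of_domain[OF cont S(1) inj] .
  let ?I = "inv_into S (straighten e F)" and ?T = "straighten e F ` S"
  have contI: "continuous_on ?T ?I"
    by (rule continuous_on_inverse_open[OF S(1) cont]) (auto simp: inj)
  have I_in: "?I y \<in> S" if "y \<in> ?T" for y using that by (rule inv_into_into)
  \<comment> \<open>Solves v + (F' v - v \<bullet> e) e = w. Here v = w + c e, and comparing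
    e-components gives F' v = w \<bullet> e, which determines c.\<close>
  define D where "D = (\<lambda>y w. w + ((w \<bullet> e - frechet_derivative F (at (?I y)) w) / frechet_derivative F (at (?I y)) e) *\<^sub>R e)"
  have der: "(?I has_derivative D y) (at y)" if y: "y \<in> ?T" for y
  proof (rule has_derivative_inverse_basic[OF _ _ _ _ op y])
    let ?x = "?I y"
    have F': "(F has_derivative frechet_derivative F (at ?x)) (at ?x)"
      using dF[OF I_in[OF y]] frechet_derivative_works by blast
    show "(straighten e F has_derivative (\<lambda>v. v + (frechet_derivative F (at ?x) v - v \<bullet> e) *\<^sub>R e)) (at ?x)"
    proof -
      have "((\<lambda>x. x + (F x - x \<bullet> e) *\<^sub>R e) has_derivative
          (\<lambda>v. v + (frechet_derivative F (at ?x) v - v \<bullet> e) *\<^sub>R e)) (at ?x)"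
        by (auto intro!: derivative_eq_intros F')
      then show ?thesis by (simp only: straighten_def[abs_def])
    qed
    note lin = has_derivative_linear[OF F']
    have bl: "bounded_linear (frechet_derivative F (at ?x))" using F' has_derivative_bounded_linear by blast
    show "bounded_linear (D y)" unfolding D_def
      by (rule bounded_linear_add[OF bounded_linear_ident bounded_linear_compose[OF bounded_linear_scaleR_left
          bounded_linear_compose[OF bounded_linear_divide bounded_linear_sub[OF bounded_linear_inner_left bl]]]])
    show "D y \<circ> (\<lambda>v. v + (frechet_derivative F (at ?x) v - v \<bullet> e) *\<^sub>R e) = id"
    proof
      fix v
      define F' where "F' = frechet_derivative F (at ?x)"
      have "F' e \<noteq> 0" using pos[OF I_in[OF y]] by (simp add: F'_def)
      moreover have "F' (v + c *\<^sub>R e) = F' v + c * F' e" for c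
        using linear_add[OF lin] linear_cmul[OF lin] by (simp add: F'_def)
      ultimately show "(D y \<circ> (\<lambda>v. v + (frechet_derivative F (at ?x) v - v \<bullet> e) *\<^sub>R e)) v = id v"
        unfolding D_def F'_def[symmetric]
        by (simp add: inner_add_left ee) (simp add: algebra_simps)
    qed
    show "continuous (at y) ?I" using contI op y continuous_on_eq_continuous_at by blast
    show "straighten e F (?I z) = z" if "z \<in> ?T" for z using that by (rule f_inv_into_f)
  qed
  \<comment> \<open>If the inverse is C^j with j < k, then \<open>D\<close>, built from it and from
    the C^(k-1) derivatives of F, is C^j, so the inverse is C^(j+1).\<close>
  have "j \<le> k \<Longrightarrow> C_on j ?T ?I" for j
  proof (induction j)
    case 0 then show ?case using contI by simp
  next
    case (Suc j)
    obtain k' where k': "k = Suc k'" using Suc.prems by (cases k) auto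
    have dF': "C_on j ?T (\<lambda>y. frechet_derivative F (at (?I y)) w)" for w
    proof (rule C_on_compose[OF op S(1)])
      have "C_on k' S (\<lambda>x. frechet_derivative F (at x) w)" using F(1) k' by simp
      then show "C_on j S (\<lambda>x. frechet_derivative F (at x) w)" using C_on_mono Suc.prems k' by fastforce
      show "C_on j ?T ?I" using Suc by simp
      show "?I ` ?T \<subseteq> S" using I_in by blast
    qed
    show ?case
    proof (rule C_on_SucI[OF op der])
      show "C_on j ?T (\<lambda>y. D y v)" for v unfolding D_def
        using pos[OF I_in] by (intro C_on_add C_on_scaleR C_on_divide C_on_diff C_on_const op dF') force
    qed
  qed
  then show "C_on k ?T ?I" by simp
qed

section \<open>Transport of densities along coordinate lines\<close>

text \<open>The matrix of \<open>L\<close> is the identity with one row, that of e, replaced by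
  \<open>r\<close>; by Cramer's lemma its determinant is the diagonal entry of that row.\<close>

lemma det_rank_one_update:
  fixes L :: "real^'n \<Rightarrow> real^'n"
  assumes e: "e \<in> Basis" and L: "\<And>v. L v = v + w v *\<^sub>R e"
  shows "det (matrix L) = L e \<bullet> e"
proof -
  obtain k where k: "e = axis k 1" using e by (auto simp: Basis_vec_def)
  define r where "r = (\<chi> b. L (axis b 1) $ k)"
  have row: "row i (mat 1 :: real^'n^'n) = axis i 1" for i
    by (vector row_def mat_def axis_def)
  have "(\<Sum>i\<in>UNIV. r $ i *s row i (mat 1 :: real^'n^'n)) = r"
    unfolding row by (rule basis_expansion)
  moreover have "matrix L = (\<chi> a. if a = k then r else row a (mat 1))"
    unfolding row by (simp add: vec_eq_iff matrix_def r_def L k) (auto simp: axis_def)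
  ultimately have "det (matrix L) = r $ k * det (mat 1 :: real^'n^'n)"
    using cramer_lemma_transpose[where x=r and A="mat 1" and k=k] by (simp only:)
  then show ?thesis by (simp add: r_def k inner_axis)
qed

text \<open>The pullback of the density f under \<phi> is g. All conditions are imposed on the whole
  space so that such maps compose. Invariance of U is recorded because in the end \<phi> has to map
  the closure of U into itself, where the density is known.\<close>

definition transports :: "nat \<Rightarrow> (real^'n) set \<Rightarrow> (real^'n \<Rightarrow> real) \<Rightarrow> (real^'n \<Rightarrow> real) \<Rightarrow> bool" where
  "transports k U f g \<longleftrightarrow> (\<exists>\<phi> \<psi>. C_on k UNIV \<phi> \<and> C_on k UNIV \<psi> \<and>
     (\<forall>x. \<psi> (\<phi> x) = x) \<and> (\<forall>x. \<phi> (\<psi> x) = x) \<and>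
     (\<forall>x\<in>frontier U. \<phi> x = x) \<and> (\<forall>x. \<phi> x \<in> U \<longleftrightarrow> x \<in> U) \<and>
     (\<forall>x. det (matrix (frechet_derivative \<phi> (at x))) * f (\<phi> x) = g x))"

lemma transports_refl: "transports k U f f"
  unfolding transports_def
  by (intro exI[of _ "\<lambda>x. x"]) (simp add: matrix_id[unfolded id_def])

lemma transports_trans:
  assumes "transports k U f g" "transports k U g h" "1 \<le> k"
  shows "transports k U f h"
proof -
  obtain \<phi>1 \<psi>1 where 1: "C_on k UNIV \<phi>1" "C_on k UNIV \<psi>1" "\<And>x. \<psi>1 (\<phi>1 x) = x" "\<And>x. \<phi>1 (\<psi>1 x) = x"
    "\<And>x. x\<in>frontier U \<Longrightarrow> \<phi>1 x = x" "\<And>x. \<phi>1 x \<in> U \<longleftrightarrow> x \<in> U"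
    "\<And>x. det (matrix (frechet_derivative \<phi>1 (at x))) * f (\<phi>1 x) = g x"
    using assms(1) unfolding transports_def by metis
  obtain \<phi>2 \<psi>2 where 2: "C_on k UNIV \<phi>2" "C_on k UNIV \<psi>2" "\<And>x. \<psi>2 (\<phi>2 x) = x" "\<And>x. \<phi>2 (\<psi>2 x) = x"
    "\<And>x. x\<in>frontier U \<Longrightarrow> \<phi>2 x = x" "\<And>x. \<phi>2 x \<in> U \<longleftrightarrow> x \<in> U"
    "\<And>x. det (matrix (frechet_derivative \<phi>2 (at x))) * g (\<phi>2 x) = h x"
    using assms(2) unfolding transports_def by metis
  have det: "det (matrix (frechet_derivative (\<lambda>x. \<phi>1 (\<phi>2 x)) (at x))) =
      det (matrix (frechet_derivative \<phi>1 (at (\<phi>2 x)))) * det (matrix (frechet_derivative \<phi>2 (at x)))" for x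
  proof -
    have d: "\<phi>2 differentiable at x" "\<phi>1 differentiable at (\<phi>2 x)"
      using C_on_differentiable 1(1) 2(1) assms(3) by blast+
    have "frechet_derivative (\<lambda>x. \<phi>1 (\<phi>2 x)) (at x) = frechet_derivative \<phi>1 (at (\<phi>2 x)) \<circ> frechet_derivative \<phi>2 (at x)"
      using frechet_derivative_compose[OF d] by (simp only: comp_def)
    then show ?thesis
      using matrix_compose[OF linear_frechet_derivative[OF d(1)] linear_frechet_derivative[OF d(2)]]
      by (simp only: det_mul)
  qed
  show ?thesis unfolding transports_def
  proof (rule exI[of _ "\<lambda>x. \<phi>1 (\<phi>2 x)"], rule exI[of _ "\<lambda>x. \<psi>2 (\<psi>1 x)"], intro conjI allI ballI)
    fix x
    show "det (matrix (frechet_derivative (\<lambda>x. \<phi>1 (\<phi>2 x)) (at x))) * f (\<phi>1 (\<phi>2 x)) = h x"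
      unfolding det 2(7)[of x, symmetric] 1(7)[of "\<phi>2 x", symmetric] by simp
  qed (use 1 2 in \<open>auto intro: C_on_compose[OF open_UNIV open_UNIV]\<close>)
qed

text \<open>Smoothness of h is required separately, since \<open>m\<close> comes from line
  primitives and is itself only C^k. It vanishes on the frontier but not necessarily near it, so
  that h can be prescribed there.\<close>

definition directional :: "nat \<Rightarrow> 'a::euclidean_space set \<Rightarrow> ('a \<Rightarrow> real) \<Rightarrow> bool" where
  "directional k U h \<longleftrightarrow> C_on k UNIV h \<and> (\<exists>e\<in>Basis. \<exists>m. C_on k UNIV m \<and> bounded {x. m x \<noteq> 0} \<and>
     (\<forall>x\<in>frontier U. m x = 0) \<and> (\<forall>x. frechet_derivative m (at x) e = h x))"

text \<open>Intermediate value theorem on the e-line through x: far out F and G agree, so the values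
  of F at two distant points bracket G x, and F takes the value G x in between.\<close>

lemma straighten_range_subset:
  fixes F G :: "'a::euclidean_space \<Rightarrow> real"
  assumes "bounded {x. F x \<noteq> G x}" "norm e = 1" "continuous_on UNIV F"
    and mono: "\<And>x s. 0 < s \<Longrightarrow> G x < G (x + s *\<^sub>R e)"
  shows "range (straighten e G) \<subseteq> range (straighten e F)"
proof clarify
  fix x :: 'a
  obtain B where B: "\<And>x. F x \<noteq> G x \<Longrightarrow> norm x \<le> B" using assms(1) unfolding bounded_iff by blast
  \<comment> \<open>Chosen so that the points at parameters -T and T have norm at least |B| + 1,
    outside the set where F and G differ.\<close>
  define T where "T = \<bar>B\<bar> + norm x + 1"
  have T: "T > 0" unfolding T_def using norm_ge_zero[of x] by linarith
  have eq: "F (x + t *\<^sub>R e) = G (x + t *\<^sub>R e)" if "\<bar>t\<bar> = T" for t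
  proof (rule ccontr)
    assume "\<not> ?thesis"
    then have "norm (x + t *\<^sub>R e) \<le> B" using B by blast
    moreover have "norm (t *\<^sub>R e) \<le> norm (x + t *\<^sub>R e) + norm x"
      using norm_triangle_ineq4[of "x + t *\<^sub>R e" x] by simp
    ultimately show False using that assms(2) T_def by simp
  qed
  have "G (x + (-T) *\<^sub>R e) < G x" using mono[of T "x + (-T) *\<^sub>R e"] T by simp
  moreover have "G x < G (x + T *\<^sub>R e)" using mono[of T x] T by simp
  moreover have "continuous_on {-T..T} (\<lambda>t. F (x + t *\<^sub>R e))"
    by (intro continuous_on_compose2[OF assms(3)] continuous_intros) auto
  ultimately have "\<exists>t. -T \<le> t \<and> t \<le> T \<and> F (x + t *\<^sub>R e) = G x"
    using IVT'[of "\<lambda>t. F (x + t *\<^sub>R e)" "-T" "G x" T] eq[of T] eq[of "-T"] T by auto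
  then obtain t where t: "F (x + t *\<^sub>R e) = G x" by blast
  have "e \<bullet> e = 1" using assms(2) by (simp add: dot_square_norm)
  then have "straighten e G x = straighten e F (x + t *\<^sub>R e)"
    unfolding straighten_def by (simp add: t inner_add_left algebra_simps)
  then show "straighten e G x \<in> range (straighten e F)" by blast
qed

text \<open>The map slides x along e to the point with F(\<phi> x) = G x. Differentiating this along
  e shows that f(\<phi> x) times the e-entry of the derivative is f x + h x, and that entry is the
  determinant because all other coordinates are fixed.\<close>

lemma transports_directional:
  fixes f h :: "real^'n \<Rightarrow> real"
  assumes k: "1 \<le> k" and f: "C_on k UNIV f" "\<And>x. 0 < f x"
    and h: "directional k U h" and fh: "\<And>x. 0 < f x + h x"
  shows "transports k U f (\<lambda>x. f x + h x)"
proof -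
  obtain e m where e: "e \<in> Basis" and m: "C_on k UNIV m" "bounded {x. m x \<noteq> 0}"
      "\<And>x. x \<in> frontier U \<Longrightarrow> m x = 0" "\<And>x. frechet_derivative m (at x) e = h x"
    using h unfolding directional_def by metis
  have e1: "norm e = 1" and ee: "e \<bullet> e = 1" using e by simp_all
  define F where "F = line_primitive e f"
  define G where "G = (\<lambda>x. F x + m x)"
  have CF: "C_on k UNIV F" unfolding F_def by (rule C_on_line_primitive[OF f(1)])
  have CG: "C_on k UNIV G" unfolding G_def by (rule C_on_add[OF open_UNIV CF m(1)])
  have dF: "F differentiable (at x)" and dG: "G differentiable (at x)" and dm: "m differentiable (at x)" for x
    using C_on_differentiable[OF _ k] CF CG m(1) by blast+
  have F': "frechet_derivative F (at x) e = f x" for x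
    unfolding F_def by (rule frechet_derivative_line_primitive[OF f(1) k e1])
  have G': "frechet_derivative G (at x) e = f x + h x" for x
  proof -
    have "(G has_derivative (\<lambda>v. frechet_derivative F (at x) v + frechet_derivative m (at x) v)) (at x)"
      unfolding G_def using dF dm frechet_derivative_works has_derivative_add by blast
    from fun_cong[OF frechet_derivative_at[OF this], of e] show ?thesis
      by (simp only: F' m(4))
  qed
  have posF: "0 < frechet_derivative F (at x) e" and posG: "0 < frechet_derivative G (at x) e" for x
    using F' G' f(2) fh by simp_all
  have monoF: "F x < F (x + s *\<^sub>R e)" and monoG: "G x < G (x + s *\<^sub>R e)" if "0 < s" for x s
    using strict_increasing_along_line[OF convex_UNIV] dF dG posF posG that by blast+
  note SF = straighten_inverse[OF open_UNIV convex_UNIV CF k e posF]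
  note SG = straighten_inverse[OF open_UNIV convex_UNIV CG k e posG]
  have "{x. F x \<noteq> G x} = {x. m x \<noteq> 0}" "{x. G x \<noteq> F x} = {x. m x \<noteq> 0}" unfolding G_def by auto
  then have range: "range (straighten e F) = range (straighten e G)"
    using straighten_range_subset[of F G e] straighten_range_subset[of G F e] m(2) e1 monoF monoG
      C_on_imp_continuous_on CF CG by (metis subset_antisym)
  define \<phi> where "\<phi> = (\<lambda>x. inv (straighten e F) (straighten e G x))"
  define \<psi> where "\<psi> = (\<lambda>x. inv (straighten e G) (straighten e F x))"
  have \<phi>: "straighten e F (\<phi> x) = straighten e G x" for x
    unfolding \<phi>_def using range by (intro f_inv_into_f) auto
  have \<psi>: "straighten e G (\<psi> x) = straighten e F x" for x
    unfolding \<psi>_def using range by (intro f_inv_into_f) auto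
  have CsF: "C_on k UNIV (straighten e F)" and CsG: "C_on k UNIV (straighten e G)"
    unfolding straighten_def[abs_def]
    by (intro C_on_add C_on_scaleR C_on_diff C_on_inner C_on_const C_on_id open_UNIV CF CG)+
  have C\<phi>: "C_on k UNIV \<phi>" unfolding \<phi>_def
    by (rule C_on_compose[OF open_UNIV SF(2,3) CsG]) (simp add: range)
  have C\<psi>: "C_on k UNIV \<psi>" unfolding \<psi>_def
    by (rule C_on_compose[OF open_UNIV SG(2,3) CsF]) (simp add: range)
  have \<psi>\<phi>: "\<psi> (\<phi> x) = x" for x using injD[OF SG(1)] \<phi> \<psi> by metis
  have \<phi>\<psi>: "\<phi> (\<psi> x) = x" for x using injD[OF SF(1)] \<phi> \<psi> by metis
  have se: "straighten e H x \<bullet> e = H x" for H x by (simp add: straighten_def inner_add_left ee)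
  have F\<phi>: "F (\<phi> x) = G x" for x using \<phi> se by metis
  have \<phi>_eq: "\<phi> x = x + (\<phi> x \<bullet> e - x \<bullet> e) *\<^sub>R e" for x
    using \<phi>[of x] F\<phi>[of x] unfolding straighten_def by (simp add: algebra_simps)
  have fix_fr: "\<phi> x = x" if "x \<in> frontier U" for x
  proof -
    have "straighten e F (\<phi> x) = straighten e F x"
      using \<phi>[of x] m(3)[OF that] by (simp add: straighten_def G_def)
    then show ?thesis using injD[OF SF(1)] by blast
  qed
  have inU: "\<phi> x \<in> U \<longleftrightarrow> x \<in> U" for x
  proof (rule ccontr)
    assume neq: "\<not> ?thesis"
    have "closed_segment x (\<phi> x) \<inter> frontier U \<noteq> {}"
      using neq by (intro connected_Int_frontier) auto
    then obtain z where z: "z \<in> closed_segment x (\<phi> x)" "z \<in> frontier U" by blast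
    define u where "u = \<phi> x \<bullet> e - x \<bullet> e"
    have \<phi>x: "\<phi> x = x + u *\<^sub>R e" using \<phi>_eq u_def by simp
    from z(1) obtain t where t: "0 \<le> t" "t \<le> 1" "z = (1 - t) *\<^sub>R x + t *\<^sub>R \<phi> x"
      by (auto simp: in_segment)
    have zt: "z = x + (t * u) *\<^sub>R e" using t(3) \<phi>x by (simp add: algebra_simps)
    have Fz: "F z = G z" using m(3)[OF z(2)] by (simp add: G_def)
    \<comment> \<open>z is a fixed point, so z = x would give \<phi> x = x, and z = \<phi> x would
      give the same by injectivity. Both contradict that exactly one of x and \<phi> x lies in
      U.\<close>
    have "z \<noteq> x" "z \<noteq> \<phi> x" using neq fix_fr[OF z(2)] injD[OF SF(1)] \<psi>\<phi> by metis+
    then have "t * u \<noteq> 0" "t \<noteq> 1" using zt \<phi>x by auto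
    then have tu: "0 < t" "t < 1" "u \<noteq> 0" using t by auto
    have z': "\<phi> x = z + ((1 - t) * u) *\<^sub>R e" using zt \<phi>x by (simp add: algebra_simps)
    show False
    \<comment> \<open>\<open>F = G\<close> at the boundary point \<open>z\<close>, so both increasing functions cross it in the same order.\<close>
    proof (cases "u > 0")
      case True
      have "G x < G z" using monoG[of "t * u" x] tu True zt by simp
      moreover have "F z < F (\<phi> x)" using monoF[of "(1 - t) * u" z] tu True z' by simp
      ultimately show False using Fz F\<phi>[of x] by simp
    next
      case False
      have "x = z + (- (t * u)) *\<^sub>R e" using zt by simp
      then have "G z < G x" using monoG[of "- (t * u)" z] tu False by (simp add: mult_pos_neg)
      moreover have "z = \<phi> x + (- ((1 - t) * u)) *\<^sub>R e" using z' by simp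
      then have "F (\<phi> x) < F z" using monoF[of "- ((1 - t) * u)" "\<phi> x"] tu False by (simp add: mult_pos_neg)
      ultimately show False using Fz F\<phi>[of x] by simp
    qed
  qed
  have det: "det (matrix (frechet_derivative \<phi> (at x))) * f (\<phi> x) = f x + h x" for x
  proof -
    let ?L = "frechet_derivative \<phi> (at x)"
    have d\<phi>: "(\<phi> has_derivative ?L) (at x)"
      using C_on_differentiable[OF C\<phi> k] frechet_derivative_works by blast
    have "((\<lambda>x. x + (\<phi> x \<bullet> e - x \<bullet> e) *\<^sub>R e) has_derivative (\<lambda>v. v + (?L v \<bullet> e - v \<bullet> e) *\<^sub>R e)) (at x)"
      by (auto intro!: derivative_eq_intros d\<phi>)
    moreover have "(\<lambda>x. x + (\<phi> x \<bullet> e - x \<bullet> e) *\<^sub>R e) = \<phi>"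
      by (rule ext, rule \<phi>_eq[symmetric])
    ultimately have "(\<phi> has_derivative (\<lambda>v. v + (?L v \<bullet> e - v \<bullet> e) *\<^sub>R e)) (at x)"
      by (simp only:)
    then have L: "?L = (\<lambda>v. v + (?L v \<bullet> e - v \<bullet> e) *\<^sub>R e)"
      by (rule has_derivative_unique[OF d\<phi>])
    \<comment> \<open>Only the e-coordinate is moved, so e is an eigenvector; this turns the chain
      rule for F after \<phi>, in direction e, into a product of two numbers.\<close>
    have Le: "?L e = (?L e \<bullet> e) *\<^sub>R e"
      by (rule trans[OF fun_cong[OF L, of e]]) (simp add: ee scaleR_diff_left)
    have det: "det (matrix ?L) = ?L e \<bullet> e"
      by (rule det_rank_one_update[OF e fun_cong[OF L]])
    have dF': "(F has_derivative frechet_derivative F (at (\<phi> x))) (at (\<phi> x))"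
      using dF frechet_derivative_works by blast
    have "(G has_derivative (\<lambda>v. frechet_derivative F (at (\<phi> x)) (?L v))) (at x)"
      using has_derivative_compose[OF d\<phi> dF'] by (simp only: F\<phi>)
    then have "frechet_derivative G (at x) e = frechet_derivative F (at (\<phi> x)) (?L e)"
      by (rule fun_cong[OF frechet_derivative_at[symmetric]])
    also have "\<dots> = frechet_derivative F (at (\<phi> x)) ((?L e \<bullet> e) *\<^sub>R e)"
      by (rule arg_cong[OF Le])
    also have "\<dots> = (?L e \<bullet> e) * f (\<phi> x)"
      by (simp only: linear_cmul[OF has_derivative_linear[OF dF']] F' real_scaleR_def)
    finally show ?thesis using G' det by simp
  qed
  show ?thesis unfolding transports_def
    using C\<phi> C\<psi> \<psi>\<phi> \<phi>\<psi> fix_fr inU det by blast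
qed

section \<open>Sums of directional terms and their realisation in small steps\<close>

lemma directional_scale:
  assumes "directional k U h" "1 \<le> k"
  shows "directional k U (\<lambda>x. c * h x)"
proof -
  obtain e m where e: "e \<in> Basis" and m: "C_on k UNIV m" "bounded {x. m x \<noteq> 0}"
      "\<And>x. x \<in> frontier U \<Longrightarrow> m x = 0" "\<And>x. frechet_derivative m (at x) e = h x" and h: "C_on k UNIV h"
    using assms(1) unfolding directional_def by metis
  have "((\<lambda>x. c * m x) has_derivative (\<lambda>v. c * frechet_derivative m (at x) v)) (at x)" for x
    using C_on_differentiable[OF m(1) assms(2)] frechet_derivative_works has_derivative_mult_right by blast
  from fun_cong[OF frechet_derivative_at[OF this], of _ e]
  have "frechet_derivative (\<lambda>x. c * m x) (at x) e = c * h x" for x by (simp add: m(4))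
  moreover have "bounded {x. c * m x \<noteq> 0}" by (rule bounded_subset[OF m(2)]) auto
  ultimately show ?thesis unfolding directional_def
    using e m h by (auto intro!: C_on_mult bexI[of _ e] exI[of _ "\<lambda>x. c * m x"])
qed

lemma directional_support:
  assumes "directional k U h"
  obtains K where "compact K" "\<And>x. x \<notin> K \<Longrightarrow> h x = 0"
proof -
  obtain e m where m: "bounded {x. m x \<noteq> 0}" "\<And>x. frechet_derivative m (at x) e = h x"
    using assms unfolding directional_def by metis
  show ?thesis
  proof
    show "compact (closure {x. m x \<noteq> 0})" using m(1) by (simp add: compact_closure)
    fix x assume x: "x \<notin> closure {x. m x \<noteq> 0}"
    have "((\<lambda>x. 0) has_derivative (\<lambda>v. 0)) (at x)" by simp
    then have "(m has_derivative (\<lambda>v. 0)) (at x)"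
    proof (rule has_derivative_transform_within_open)
      show "open (- closure {x. m x \<noteq> 0})" by (rule open_Compl[OF closed_closure])
      show "0 = m y" if "y \<in> - closure {x. m x \<noteq> 0}" for y
        using that closure_subset[of "{x. m x \<noteq> 0}"] by auto
    qed (use x in simp)
    from fun_cong[OF frechet_derivative_at[OF this]] show "h x = 0" by (simp only: m(2)[of x, symmetric])
  qed
qed

lemma compact_support_bounded:
  fixes h :: "'a::euclidean_space \<Rightarrow> real"
  assumes "continuous_on UNIV h" "compact K" "\<And>x. x \<notin> K \<Longrightarrow> h x = 0"
  obtains C where "0 \<le> C" "\<And>x. \<bar>h x\<bar> \<le> C"
proof -
  have "compact (h ` K)" using assms continuous_on_subset compact_continuous_image by blast
  then obtain C where C: "\<And>x. x \<in> K \<Longrightarrow> \<bar>h x\<bar> \<le> C"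
    using compact_imp_bounded[of "h ` K"] unfolding bounded_iff by auto
  show ?thesis
  proof
    show "\<bar>h x\<bar> \<le> max 0 C" for x using C[of x] assms(3)[of x] by (cases "x \<in> K") auto
  qed simp
qed

text \<open>Generated by adding one term at a time, so that an induction can compose one transport
  per term.\<close>

inductive directional_sum :: "nat \<Rightarrow> 'a::euclidean_space set \<Rightarrow> ('a \<Rightarrow> real) \<Rightarrow> bool" for k U where
  directional_sum_zero: "directional_sum k U (\<lambda>x. 0)"
| directional_sum_add_directional:
    "directional_sum k U h \<Longrightarrow> directional k U h' \<Longrightarrow> directional_sum k U (\<lambda>x. h x + h' x)"

lemma directional_imp_sum: "directional k U h \<Longrightarrow> directional_sum k U h"
  using directional_sum_add_directional[OF directional_sum_zero] by simp

lemma directional_sum_scale: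
  assumes "directional_sum k U h" "1 \<le> k"
  shows "directional_sum k U (\<lambda>x. c * h x)"
  using assms(1)
proof induction
  case directional_sum_zero then show ?case by (simp add: directional_sum.directional_sum_zero)
next
  case (directional_sum_add_directional h h')
  then show ?case
    using directional_sum.directional_sum_add_directional[OF _ directional_scale[OF _ assms(2)]]
    by (simp add: distrib_left)
qed

lemma directional_sum_add:
  assumes "directional_sum k U h1" "directional_sum k U h2"
  shows "directional_sum k U (\<lambda>x. h1 x + h2 x)"
  using assms(2)
proof induction
  case directional_sum_zero then show ?case using assms(1) by simp
next
  case (directional_sum_add_directional h h')
  then show ?case
    using directional_sum.directional_sum_add_directional[of k U "\<lambda>x. h1 x + h x" h'] by (simp add: add.assoc)
qed

lemma directional_sum_sum:
  assumes "\<And>i. i \<in> I \<Longrightarrow> directional_sum k U (h i)"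
  shows "directional_sum k U (\<lambda>x. \<Sum>i\<in>I. h i x)"
  using assms
  by (induction I rule: infinite_finite_induct) (auto intro: directional_sum_zero directional_sum_add)

lemma directional_sum_C_on: "directional_sum k U h \<Longrightarrow> C_on k UNIV h"
  by (induction rule: directional_sum.induct) (auto intro: C_on_add simp: directional_def)

text \<open>
  The bound \<open>\<epsilon> * C < f\<close> keeps all partial sums positive; it holds once the step \<open>\<epsilon>\<close> is small.
\<close>
lemma transports_small:
  fixes h :: "real^'n \<Rightarrow> real"
  assumes "directional_sum k U h" and k: "1 \<le> k"
  shows "\<exists>K C. compact K \<and> 0 \<le> C \<and> (\<forall>x. x \<notin> K \<longrightarrow> h x = 0) \<and> (\<forall>x. \<bar>h x\<bar> \<le> C) \<and>
    (\<forall>\<epsilon> f. 0 \<le> \<epsilon> \<longrightarrow> C_on k UNIV f \<longrightarrow> (\<forall>x. 0 < f x) \<longrightarrow> (\<forall>x\<in>K. \<epsilon> * C < f x) \<longrightarrow>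
       transports k U f (\<lambda>x. f x + \<epsilon> * h x))"
  using assms(1)
proof induction
  case directional_sum_zero
  show ?case by (rule exI[of _ "{}"], rule exI[of _ 0]) (simp add: transports_refl)
next
  case (directional_sum_add_directional h h')
  obtain K C where KC: "compact K \<and> 0 \<le> C \<and> (\<forall>x. x \<notin> K \<longrightarrow> h x = 0) \<and> (\<forall>x. \<bar>h x\<bar> \<le> C) \<and>
    (\<forall>\<epsilon> f. 0 \<le> \<epsilon> \<longrightarrow> C_on k UNIV f \<longrightarrow> (\<forall>x. 0 < f x) \<longrightarrow> (\<forall>x\<in>K. \<epsilon> * C < f x) \<longrightarrow>
       transports k U f (\<lambda>x. f x + \<epsilon> * h x))"
    using directional_sum_add_directional.IH by (elim exE)
  then have K: "compact K" "0 \<le> C" "\<And>x. x \<notin> K \<Longrightarrow> h x = 0" "\<And>x. \<bar>h x\<bar> \<le> C" by simp_all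
  have IH: "transports k U f (\<lambda>x. f x + \<epsilon> * h x)"
    if "0 \<le> \<epsilon>" "C_on k UNIV f" "\<And>x. 0 < f x" "\<And>x. x \<in> K \<Longrightarrow> \<epsilon> * C < f x" for \<epsilon> f
    using KC that by blast
  obtain K' where K': "compact K'" "\<And>x. x \<notin> K' \<Longrightarrow> h' x = 0"
    using directional_support directional_sum_add_directional.hyps(2) by blast
  have Ch': "C_on k UNIV h'" using directional_sum_add_directional.hyps(2) unfolding directional_def by blast
  obtain C' where C': "0 \<le> C'" "\<And>x. \<bar>h' x\<bar> \<le> C'"
    using compact_support_bounded[OF C_on_imp_continuous_on[OF Ch'] K'] by blast
  have Ch: "C_on k UNIV h" using directional_sum_add_directional.hyps(1) directional_sum_C_on by blast
  show ?case
  proof (rule exI[of _ "K \<union> K'"], rule exI[of _ "C + C'"], intro conjI allI impI)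
    show "compact (K \<union> K')" using K(1) K'(1) by (rule compact_Un)
    show "0 \<le> C + C'" using K(2) C'(1) by simp
    show "h x + h' x = 0" if "x \<notin> K \<union> K'" for x using K(3) K'(2) that by simp
    show "\<bar>h x + h' x\<bar> \<le> C + C'" for x using K(4)[of x] C'(2)[of x] by linarith
    fix \<epsilon> :: real and f :: "real^'n \<Rightarrow> real"
    assume e: "0 \<le> \<epsilon>" and f: "C_on k UNIV f" "\<forall>x. 0 < f x" "\<forall>x\<in>K \<union> K'. \<epsilon> * (C + C') < f x"
    have b: "\<epsilon> * \<bar>h x\<bar> \<le> \<epsilon> * C" "\<epsilon> * \<bar>h' x\<bar> \<le> \<epsilon> * C'" for x
      using K(4) C'(2) e by (auto intro: mult_left_mono)
    have pos: "0 \<le> \<epsilon> * C" "0 \<le> \<epsilon> * C'" using e K(2) C'(1) by simp_all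
    have ab: "- (\<epsilon> * \<bar>a\<bar>) \<le> \<epsilon> * a" for a using e mult_left_mono[of "-\<bar>a\<bar>" a \<epsilon>] by simp
    have f1: "0 < f x + \<epsilon> * h x" for x
    proof (cases "x \<in> K")
      case True
      then have "\<epsilon> * C + \<epsilon> * C' < f x" using f(3) by (simp add: distrib_left)
      then show ?thesis using b(1)[of x] pos ab[of "h x"] by linarith
    qed (use K(3) f(2) in simp)
    have f2: "0 < (f x + \<epsilon> * h x) + \<epsilon> * h' x" for x
    proof (cases "x \<in> K \<union> K'")
      case True
      then have "\<epsilon> * C + \<epsilon> * C' < f x" using f(3) by (auto simp: distrib_left)
      then show ?thesis using b[of x] ab[of "h x"] ab[of "h' x"] by linarith
    qed (use K(3) K'(2) f(2) in simp)
    have Cf1: "C_on k UNIV (\<lambda>x. f x + \<epsilon> * h x)"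
      by (intro C_on_add C_on_mult C_on_const open_UNIV f(1) Ch)
    have "transports k U f (\<lambda>x. f x + \<epsilon> * h x)"
    proof (rule IH[OF e f(1)])
      show "0 < f x" for x using f(2) by simp
      show "\<epsilon> * C < f x" if "x \<in> K" for x
      proof -
        have "\<epsilon> * C + \<epsilon> * C' < f x" using f(3) that by (simp add: distrib_left)
        then show ?thesis using pos by linarith
      qed
    qed
    moreover have "transports k U (\<lambda>x. f x + \<epsilon> * h x) (\<lambda>x. (f x + \<epsilon> * h x) + \<epsilon> * h' x)"
      by (rule transports_directional[OF k Cf1 f1 directional_scale[OF directional_sum_add_directional.hyps(2) k] f2])
    ultimately have "transports k U f (\<lambda>x. (f x + \<epsilon> * h x) + \<epsilon> * h' x)" by (rule transports_trans[OF _ _ k])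
    then show "transports k U f (\<lambda>x. f x + \<epsilon> * (h x + h' x))" by (simp add: distrib_left add.assoc)
  qed
qed

text \<open>Each density f + t h with t in [0, 1] is a convex mixture of f and f + h, so a positive
  lower bound \<open>c\<close> on K for both ends holds for all t. Then \<open>M\<close> equal steps
  with C / M < c all satisfy the bound required of a small step.\<close>

lemma transports_directional_sum:
  fixes f h :: "real^'n \<Rightarrow> real"
  assumes k: "1 \<le> k" and h: "directional_sum k U h" and f: "C_on k UNIV f" "\<And>x. 0 < f x"
    and fh: "\<And>x. 0 < f x + h x"
  shows "transports k U f (\<lambda>x. f x + h x)"
proof -
  obtain K C where KC: "compact K \<and> 0 \<le> C \<and> (\<forall>x. x \<notin> K \<longrightarrow> h x = 0) \<and> (\<forall>x. \<bar>h x\<bar> \<le> C) \<and>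
    (\<forall>\<epsilon> f. 0 \<le> \<epsilon> \<longrightarrow> C_on k UNIV f \<longrightarrow> (\<forall>x. 0 < f x) \<longrightarrow> (\<forall>x\<in>K. \<epsilon> * C < f x) \<longrightarrow>
       transports k U f (\<lambda>x. f x + \<epsilon> * h x))"
    using transports_small[OF h k] by (elim exE)
  then have K: "compact K" "0 \<le> C" "\<And>x. x \<notin> K \<Longrightarrow> h x = 0" "\<And>x. \<bar>h x\<bar> \<le> C" by simp_all
  have small: "transports k U f (\<lambda>x. f x + \<epsilon> * h x)"
    if "0 \<le> \<epsilon>" "C_on k UNIV f" "\<And>x. 0 < f x" "\<And>x. x \<in> K \<Longrightarrow> \<epsilon> * C < f x" for \<epsilon> f
    using KC that by blast
  have Ch: "C_on k UNIV h" by (rule directional_sum_C_on[OF h])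
  obtain c where c: "0 < c" "\<And>x. x \<in> K \<Longrightarrow> c \<le> f x" "\<And>x. x \<in> K \<Longrightarrow> c \<le> f x + h x"
  proof (cases "K = {}")
    case True then show ?thesis using that[of 1] by simp
  next
    case False
    have "continuous_on K (\<lambda>x. min (f x) (f x + h x))"
      using C_on_imp_continuous_on[OF f(1)] C_on_imp_continuous_on[OF Ch]
      by (intro continuous_intros) (auto intro: continuous_on_subset)
    from continuous_attains_inf[OF K(1) False this] obtain x0 where x0: "x0 \<in> K"
      "\<And>x. x \<in> K \<Longrightarrow> min (f x0) (f x0 + h x0) \<le> min (f x) (f x + h x)" by blast
    show ?thesis
    proof (rule that)
      show "0 < min (f x0) (f x0 + h x0)" using f(2) fh by simp
      show "min (f x0) (f x0 + h x0) \<le> f x" "min (f x0) (f x0 + h x0) \<le> f x + h x" if "x \<in> K" for x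
        using x0(2)[OF that] by linarith+
    qed
  qed
  obtain M :: nat where M: "C / c < real M" using reals_Archimedean2 by blast
  have M0: "0 < real M" using M K(2) c(1) by (smt (verit) divide_nonneg_pos)
  have MC: "1 / real M * C < c" using M M0 c(1) by (simp add: field_simps)
  have lower: "c \<le> f x + t * h x" if "x \<in> K" "0 \<le> t" "t \<le> 1" for x t
  proof -
    have "(1 - t) * c + t * c \<le> (1 - t) * f x + t * (f x + h x)"
      using c(2,3)[OF that(1)] that(2,3) by (intro add_mono mult_left_mono) auto
    then show ?thesis by (simp add: algebra_simps)
  qed
  have pos: "0 < f x + t * h x" if "0 \<le> t" "t \<le> 1" for x t
    using lower[of x t] that c(1) f(2)[of x] K(3)[of x] by (cases "x \<in> K") auto
  have "q \<le> M \<Longrightarrow> transports k U f (\<lambda>x. f x + (real q / real M) * h x)" for q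
  proof (induction q)
    case 0 then show ?case by (simp add: transports_refl)
  next
    case (Suc q)
    have q: "0 \<le> real q / real M" "real q / real M \<le> 1" using Suc.prems M0 by simp_all
    have "transports k U (\<lambda>x. f x + (real q / real M) * h x) (\<lambda>x. (f x + (real q / real M) * h x) + 1 / real M * h x)"
    proof (rule small)
      show "C_on k UNIV (\<lambda>x. f x + (real q / real M) * h x)"
        by (intro C_on_add C_on_mult C_on_const open_UNIV f(1) Ch)
      show "0 < f x + (real q / real M) * h x" for x by (rule pos[OF q])
      show "1 / real M * C < f x + (real q / real M) * h x" if "x \<in> K" for x
        using lower[OF that q] MC by linarith
    qed simp
    moreover have "(f x + (real q / real M) * h x) + 1 / real M * h x = f x + real (Suc q) / real M * h x" for x
      by (simp add: add_divide_distrib distrib_right)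
    ultimately have "transports k U (\<lambda>x. f x + (real q / real M) * h x) (\<lambda>x. f x + real (Suc q) / real M * h x)"
      by (simp only:)
    then show ?case using Suc transports_trans[OF _ _ k] by simp
  qed
  from this[of M] show ?thesis using M0 by simp
qed

section \<open>Boundary charts and integrals of directional derivatives\<close>

text \<open>The form in which smoothness of the boundary is used: a local defining function that
  increases along a coordinate direction. Convexity of S serves monotonicity along e-lines.\<close>

definition boundary_chart :: "'a::euclidean_space set \<Rightarrow> 'a \<Rightarrow> 'a set \<Rightarrow> ('a \<Rightarrow> real) \<Rightarrow> 'a \<Rightarrow> bool" where
  "boundary_chart U p S F e \<longleftrightarrow> open S \<and> convex S \<and> p \<in> S \<and> (\<forall>k. C_on k S F) \<and> e \<in> Basis \<and>
     (\<forall>x\<in>S. x \<in> frontier U \<longleftrightarrow> F x = 0) \<and> (\<forall>x\<in>S. 0 < frechet_derivative F (at x) e)"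

text \<open>The straightened coordinate \<rho> is the defining function. Some partial derivative at
  p is nonzero, as otherwise y \<bullet> b, which is \<rho> composed with the inverse chart, would
  have derivative 0. After a choice of sign, positivity persists on a small ball.\<close>

lemma smooth_boundary_chart:
  fixes U :: "'a::euclidean_space set"
  assumes "smooth_boundary U" "p \<in> frontier U"
  obtains S F e where "boundary_chart U p S F e"
proof -
  obtain W D and \<Phi> :: "'a \<Rightarrow> 'a" and b where b: "b \<in> Basis" and p: "p \<in> W"
    and diff: "\<And>k. C_diffeomorphism k W D \<Phi>"
    and fr: "\<Phi> ` (W \<inter> frontier U) = {y \<in> D. y \<bullet> b = 0}"
    using assms unfolding smooth_boundary_def by blast
  have oW: "open W" and oD: "open D" using diff[of 0] unfolding C_diffeomorphism_def by auto
  have C\<Phi>: "C_on k W \<Phi>" for k using diff[of k] unfolding C_diffeomorphism_def by blast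
  obtain g where g: "homeomorphism W D \<Phi> g" and Cg: "C_on 1 D g"
    using diff[of 1] unfolding C_diffeomorphism_def by blast
  have gW: "\<And>x. x \<in> W \<Longrightarrow> g (\<Phi> x) = x" and gD: "\<And>y. y \<in> D \<Longrightarrow> \<Phi> (g y) = y"
    and WD: "\<And>x. x \<in> W \<Longrightarrow> \<Phi> x \<in> D"
    using g unfolding homeomorphism_def by auto
  define \<rho> where "\<rho> = (\<lambda>x. \<Phi> x \<bullet> b)"
  have C\<rho>: "C_on k W \<rho>" for k unfolding \<rho>_def using C_on_inner[OF oW C\<Phi>] .
  have zero: "x \<in> frontier U \<longleftrightarrow> \<rho> x = 0" if x: "x \<in> W" for x
  proof
    assume "x \<in> frontier U"
    then have "\<Phi> x \<in> {y \<in> D. y \<bullet> b = 0}" unfolding fr[symmetric] using x by blast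
    then show "\<rho> x = 0" by (simp add: \<rho>_def)
  next
    assume "\<rho> x = 0"
    then have "\<Phi> x \<in> \<Phi> ` (W \<inter> frontier U)" unfolding fr using WD[OF x] by (simp add: \<rho>_def)
    then obtain x' where "\<Phi> x = \<Phi> x'" "x' \<in> W \<inter> frontier U" by (rule imageE)
    then have x': "x' \<in> W" "x' \<in> frontier U" "\<Phi> x = \<Phi> x'" by auto
    have "x = x'" by (rule trans[OF sym[OF gW[OF x, unfolded x'(3)]] gW[OF x'(1)]])
    with x'(2) show "x \<in> frontier U" by (simp only:)
  qed
  let ?\<rho>' = "frechet_derivative \<rho> (at p)"
  have d\<rho>: "(\<rho> has_derivative ?\<rho>') (at p)"
    using C_on_differentiable[OF C\<rho>[of 1] _ p] frechet_derivative_works by auto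
  have "\<exists>e\<in>Basis. ?\<rho>' e \<noteq> 0"
  proof (rule ccontr)
    assume "\<not> ?thesis"
    then have z: "\<And>e. e \<in> Basis \<Longrightarrow> ?\<rho>' e = 0" by blast
    have r0: "?\<rho>' = (\<lambda>v. 0)"
      by (rule linear_eq_stdbasis[OF has_derivative_linear[OF d\<rho>] linear_zero]) (rule z)
    have d0: "(\<rho> has_derivative (\<lambda>v. 0)) (at (g (\<Phi> p)))" using d\<rho> by (simp only: r0 gW[OF p])
    have "(g has_derivative frechet_derivative g (at (\<Phi> p))) (at (\<Phi> p))"
      using C_on_differentiable[OF Cg _ WD[OF p]] frechet_derivative_works by auto
    from has_derivative_compose[OF this d0]
    have "((\<lambda>y. \<rho> (g y)) has_derivative (\<lambda>v. 0)) (at (\<Phi> p))" .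
    then have "((\<lambda>y. y \<bullet> b) has_derivative (\<lambda>v. 0)) (at (\<Phi> p))"
      by (rule has_derivative_transform_within_open[OF _ oD WD[OF p]]) (simp add: \<rho>_def gD)
    moreover have "((\<lambda>y. y \<bullet> b) has_derivative (\<lambda>v. v \<bullet> b)) (at (\<Phi> p))"
      by (rule bounded_linear_imp_has_derivative[OF bounded_linear_inner_left])
    ultimately have "(\<lambda>v. 0) = (\<lambda>v::'a. v \<bullet> b)" by (rule has_derivative_unique)
    from fun_cong[OF this, of b] show False using b by simp
  qed
  then obtain e where e: "e \<in> Basis" "?\<rho>' e \<noteq> 0" by blast
  \<comment> \<open>The constant factor fixes the sign: the e-derivative of F at p is the square of
    that of \<rho>.\<close>
  define F where "F = (\<lambda>x. ?\<rho>' e * \<rho> x)"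
  have CF: "C_on k W F" for k unfolding F_def by (intro C_on_mult C_on_const oW C\<rho>)
  have "(F has_derivative (\<lambda>v. ?\<rho>' e * ?\<rho>' v)) (at p)"
    unfolding F_def by (rule has_derivative_mult_right[OF d\<rho>])
  from fun_cong[OF frechet_derivative_at[OF this], of e]
  have pos: "0 < frechet_derivative F (at p) e" using e(2) by (metis not_real_square_gt_zero)
  have "continuous_on W (\<lambda>x. frechet_derivative F (at x) e)"
    using CF[of 1] by simp
  then have "open (W \<inter> (\<lambda>x. frechet_derivative F (at x) e) -` {0<..})"
    by (rule continuous_open_preimage[OF _ oW open_greaterThan])
  then obtain r where r: "0 < r" "ball p r \<subseteq> W \<inter> (\<lambda>x. frechet_derivative F (at x) e) -` {0<..}"
    using p pos by (auto elim!: openE)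
  show ?thesis
  proof (rule that[of "ball p r" F e], unfold boundary_chart_def, intro conjI allI ballI e(1))
    show "open (ball p r)" "convex (ball p r)" "p \<in> ball p r" using r(1) by simp_all
    show "C_on k (ball p r) F" for k using C_on_subset[OF CF] r(2) by blast
    show "x \<in> frontier U \<longleftrightarrow> F x = 0" if "x \<in> ball p r" for x
    proof -
      have "x \<in> W" using r(2) that by blast
      from zero[OF this] show ?thesis using e(2) by (simp add: F_def)
    qed
    show "0 < frechet_derivative F (at x) e" if "x \<in> ball p r" for x using r(2) that by blast
  qed
qed

text \<open>Locally the frontier lies in the image of a piece of a coordinate hyperplane under the
  differentiable inverse of \<open>straighten e F\<close>.\<close>

lemma smooth_boundary_negligible:
  fixes U :: "'a::euclidean_space set"
  assumes "smooth_boundary U"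
  shows "negligible (frontier U)"
proof (rule iffD2[OF locally_negligible_alt], rule ballI)
  fix p assume p: "p \<in> frontier U"
  obtain S F e where chart: "boundary_chart U p S F e"
    using smooth_boundary_chart[OF assms p] .
  then have S: "open S" "convex S" "p \<in> S" and CF: "\<And>k. C_on k S F" and e: "e \<in> Basis"
    and zero: "\<And>x. x \<in> S \<Longrightarrow> x \<in> frontier U \<longleftrightarrow> F x = 0"
    and pos: "\<And>x. x \<in> S \<Longrightarrow> 0 < frechet_derivative F (at x) e"
    unfolding boundary_chart_def by auto
  have one: "(1::nat) \<le> 1" by simp
  have inv: "inj_on (straighten e F) S" "open (straighten e F ` S)"
    "C_on 1 (straighten e F ` S) (inv_into S (straighten e F))"
    by (rule straighten_inverse[OF S(1,2) CF one e], erule pos)+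
  let ?T = "straighten e F ` S" and ?H = "{y. y \<bullet> e = 0}"
  have "negligible (inv_into S (straighten e F) ` (?T \<inter> ?H))"
  proof (rule negligible_differentiable_image_negligible)
    show "negligible (?T \<inter> ?H)"
      by (rule negligible_subset[OF negligible_standard_hyperplane[OF e, of 0]]) simp
    have "inv_into S (straighten e F) differentiable (at y)" if "y \<in> ?T" for y
      using C_on_differentiable[OF inv(3) one that] .
    then show "inv_into S (straighten e F) differentiable_on ?T \<inter> ?H"
      unfolding differentiable_on_def by (auto intro: differentiable_at_withinI)
  qed simp
  moreover have "frontier U \<inter> S \<subseteq> inv_into S (straighten e F) ` (?T \<inter> ?H)"
  proof
    fix x assume x: "x \<in> frontier U \<inter> S"
    then have "F x = 0" using zero by blast
    then have "straighten e F x \<in> ?H" using e by (simp add: straighten_def inner_add_left inner_diff_left)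
    moreover have "x = inv_into S (straighten e F) (straighten e F x)"
      using inv_into_f_f[OF inv(1)] x by auto
    ultimately show "x \<in> inv_into S (straighten e F) ` (?T \<inter> ?H)" using x by blast
  qed
  ultimately have "negligible (frontier U \<inter> S)" by (rule negligible_subset)
  then show "\<exists>V. openin (top_of_set (frontier U)) V \<and> p \<in> V \<and> negligible V"
    using p S by (intro exI[of _ "frontier U \<inter> S"]) (auto intro: openin_open_Int)
qed

section \<open>Integrals of directional derivatives over U\<close>

lemma integrable_compact_support:
  fixes w :: "'a::euclidean_space \<Rightarrow> real"
  assumes "w \<in> borel_measurable borel" "\<And>x. \<bar>w x\<bar> \<le> C" "\<And>x. x \<notin> cball 0 B \<Longrightarrow> w x = 0"
  shows "integrable lborel w"
proof (rule Bochner_Integration.integrable_bound)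
  have "emeasure lborel (cball (0::'a) B) < \<infinity>" by (rule emeasure_bounded_finite) simp
  then show "integrable lborel (\<lambda>x::'a. C * indicator (cball 0 B) x)" by simp
  show "AE x in lborel. norm (w x) \<le> norm (C * indicator (cball 0 B) x)"
  proof (rule AE_I2)
    fix x
    show "norm (w x) \<le> norm (C * indicator (cball 0 B) x)"
      using assms(2)[of x] assms(3)[of x] by (cases "x \<in> cball 0 B") auto
  qed
qed (use assms(1) in simp)

text \<open>By translation invariance, the difference quotients along e of m cut off to U have
  integral 0, and almost everywhere they converge to h times the indicator of U. As m vanishes on
  the frontier, the cut-off function is still Lipschitz along e, which dominates the
  quotients.\<close>

lemma directional_integral_zero:
  fixes U :: "'a::euclidean_space set"
  assumes k: "1 \<le> k" and U: "open U" and neg: "negligible (frontier U)" and h: "directional k U h"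
  shows "(LINT y:U|lebesgue. h y) = 0"
proof -
  obtain e m where e: "e \<in> Basis" and m: "C_on k UNIV m" "bounded {x. m x \<noteq> 0}"
      "\<And>x. x \<in> frontier U \<Longrightarrow> m x = 0" "\<And>x. frechet_derivative m (at x) e = h x" and Ch: "C_on k UNIV h"
    using h unfolding directional_def by metis
  have e1: "norm e = 1" using e by simp
  have conth: "continuous_on UNIV h" and contm: "continuous_on UNIV m"
    using C_on_imp_continuous_on Ch m(1) by blast+
  then have hb: "h \<in> borel_measurable borel" and mb: "m \<in> borel_measurable borel"
    by (auto intro: borel_measurable_continuous_onI)
  obtain K where K: "compact K" "\<And>x. x \<notin> K \<Longrightarrow> h x = 0" using directional_support[OF h] by blast
  obtain L where L: "0 \<le> L" "\<And>x. \<bar>h x\<bar> \<le> L" using compact_support_bounded[OF conth K] by blast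
  obtain B where B: "\<And>x. m x \<noteq> 0 \<Longrightarrow> norm x \<le> B" using m(2) unfolding bounded_iff by blast
  have mB: "m x = 0" if "x \<notin> cball 0 B" for x using that B by auto
  obtain M where M: "0 \<le> M" "\<And>x. \<bar>m x\<bar> \<le> M"
    using compact_support_bounded[OF contm compact_cball mB] by blast
  have dm: "((\<lambda>t. m (x + t *\<^sub>R e)) has_real_derivative h (x + s *\<^sub>R e)) (at s)" for x s
    using has_derivative_along_line[of m "frechet_derivative m (at (x + s *\<^sub>R e))" x s e]
      C_on_differentiable[OF m(1) k] frechet_derivative_works m(4) by auto
  have lip0: "\<bar>m (x + t *\<^sub>R e) - m x\<bar> \<le> L * t" if "0 \<le> t" for x t
  proof (cases "t = 0")
    case False
    then obtain z where "m (x + t *\<^sub>R e) - m (x + 0 *\<^sub>R e) = (t - 0) * h (x + z *\<^sub>R e)"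
      using MVT2[of 0 t "\<lambda>t. m (x + t *\<^sub>R e)" "\<lambda>s. h (x + s *\<^sub>R e)"] dm \<open>0 \<le> t\<close> by auto
    then have "\<bar>m (x + t *\<^sub>R e) - m x\<bar> = t * \<bar>h (x + z *\<^sub>R e)\<bar>" using that by (simp add: abs_mult)
    also have "\<dots> \<le> t * L" using L(2) that by (rule mult_left_mono)
    finally show ?thesis by (simp add: mult.commute)
  qed simp
  define w where "w = (\<lambda>x. indicator U x * m x)"
  have lip: "\<bar>w (x + t *\<^sub>R e) - w x\<bar> \<le> L * t" if t: "0 \<le> t" for x t
  proof (cases "x \<in> U \<longleftrightarrow> x + t *\<^sub>R e \<in> U")
    case True then show ?thesis using lip0[OF t, of x] L(1) t by (auto simp: w_def indicator_def)
  next
    case False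
    \<comment> \<open>A segment with exactly one end in U meets the frontier at some z, where m = 0;
      measuring from z bounds |m| at either end by \<open>L * t\<close>.\<close>
    then have "closed_segment x (x + t *\<^sub>R e) \<inter> frontier U \<noteq> {}"
      by (intro connected_Int_frontier) auto
    then obtain z where z: "z \<in> closed_segment x (x + t *\<^sub>R e)" "z \<in> frontier U" by blast
    from z(1) obtain s where s: "0 \<le> s" "s \<le> 1" "z = (1 - s) *\<^sub>R x + s *\<^sub>R (x + t *\<^sub>R e)"
      by (auto simp: in_segment)
    have z1: "z = x + (s * t) *\<^sub>R e" and z2: "x + t *\<^sub>R e = z + (t - s * t) *\<^sub>R e"
      using s(3) by (simp_all add: algebra_simps)
    have st: "s * t \<le> t" "0 \<le> s * t" using s t by (simp_all add: mult_left_le_one_le)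
    have "\<bar>m x\<bar> \<le> L * (s * t)" using lip0[OF st(2), of x] z1 m(3)[OF z(2)] by simp
    moreover have "L * (s * t) \<le> L * t" using st L(1) by (simp add: mult_left_mono)
    moreover have "\<bar>m (x + t *\<^sub>R e)\<bar> \<le> L * (t - s * t)"
      using lip0[of "t - s * t" z] z2 m(3)[OF z(2)] st by simp
    moreover have "L * (t - s * t) \<le> L * t" using st L(1) by (simp add: mult_left_mono)
    ultimately show ?thesis using False by (auto simp: w_def indicator_def)
  qed
  have wb: "w \<in> borel_measurable borel" unfolding w_def using U mb by simp
  have int: "integrable lborel w"
  proof (rule integrable_compact_support[OF wb])
    show "\<bar>w x\<bar> \<le> M" for x using M(1) M(2)[of x] by (auto simp: w_def indicator_def)
    show "w x = 0" if "x \<notin> cball 0 B" for x using mB[OF that] by (simp add: w_def)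
  qed
  have shift: "integrable lborel (\<lambda>x. w (c + x))" "(LINT x|lborel. w (c + x)) = (LINT x|lborel. w x)" for c
  proof -
    have c: "(+) c \<in> measurable lborel borel" by simp
    show "integrable lborel (\<lambda>x. w (c + x))"
      using integrable_distr[OF c, of w] int lborel_distr_plus[of c] by simp
    show "(LINT x|lborel. w (c + x)) = (LINT x|lborel. w x)"
      using integral_distr[OF c wb] lborel_distr_plus[of c] by simp
  qed
  define t where "t = (\<lambda>n. inverse (real (Suc n)))"
  have t0: "0 < t n" "t n \<le> 1" for n unfolding t_def by (auto simp: field_simps)
  have tlim: "t \<longlonglongrightarrow> 0" unfolding t_def by (rule LIMSEQ_inverse_real_of_nat)
  define q where "q = (\<lambda>n x. (w (t n *\<^sub>R e + x) - w x) / t n)"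
  have q0: "(LINT x|lborel. q n x) = 0" for n
    unfolding q_def using shift int by (simp add: Bochner_Integration.integral_diff)
  have "(\<lambda>n. LINT x|lborel. q n x) \<longlonglongrightarrow> (LINT x|lborel. indicator U x * h x)"
  proof (rule integral_dominated_convergence)
    show "(\<lambda>x. indicator U x * h x) \<in> borel_measurable lborel" using U hb by simp
    show "q n \<in> borel_measurable lborel" for n unfolding q_def using wb by measurable
    \<comment> \<open>The shifts have length at most 1, so outside radius |B| + 1 both the point and
      its shift lie outside the support of m.\<close>
    have "emeasure lborel (cball (0::'a) (\<bar>B\<bar> + 1)) < \<infinity>" by (rule emeasure_bounded_finite) simp
    then show "integrable lborel (\<lambda>x::'a. L * indicator (cball 0 (\<bar>B\<bar> + 1)) x)" by simp
    show "AE x in lborel. norm (q n x) \<le> L * indicator (cball 0 (\<bar>B\<bar> + 1)) x" for n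
    proof (rule AE_I2)
      fix x
      show "norm (q n x) \<le> L * indicator (cball 0 (\<bar>B\<bar> + 1)) x"
      proof (cases "x \<in> cball 0 (\<bar>B\<bar> + 1)")
        case True
        have "\<bar>w (t n *\<^sub>R e + x) - w x\<bar> \<le> L * t n"
          using lip[OF less_imp_le[OF t0(1)[of n]], of x] by (simp only: add.commute)
        then have "\<bar>q n x\<bar> \<le> L"
          unfolding q_def abs_divide abs_of_pos[OF t0(1)[of n]] by (simp only: pos_divide_le_eq[OF t0(1)[of n]])
        then show ?thesis using True by simp
      next
        case False
        have "norm x \<le> norm (t n *\<^sub>R e + x) + norm (t n *\<^sub>R e)"
          using norm_triangle_ineq4[of "t n *\<^sub>R e + x" "t n *\<^sub>R e"] by simp
        moreover have "norm (t n *\<^sub>R e) \<le> 1" using t0[of n] e1 by simp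
        ultimately have "m (t n *\<^sub>R e + x) = 0" "m x = 0" using False by (auto intro!: mB)
        then show ?thesis using L(1) by (simp add: q_def w_def)
      qed
    qed
    have "AE x in lborel. x \<notin> frontier U"
    proof -
      have "frontier U \<in> null_sets lborel"
        using neg null_sets_completion_iff[of "frontier U" lborel] by (simp add: negligible_iff_null_sets)
      then show ?thesis by (rule AE_not_in)
    qed
    then show "AE x in lborel. (\<lambda>n. q n x) \<longlonglongrightarrow> indicator U x * h x"
    proof (rule AE_mp, intro AE_I2 impI)
      fix x assume x: "x \<notin> frontier U"
      have dq: "(\<lambda>n. (m (t n *\<^sub>R e + x) - m x) / t n) \<longlonglongrightarrow> h x"
      proof -
        have "((\<lambda>s. (m (x + s *\<^sub>R e) - m x) / s) \<longlongrightarrow> h x) (at 0)"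
          using dm[of x 0] by (simp add: has_field_derivative_iff)
        moreover have "filterlim t (at 0) sequentially"
          using tlim t0(1) by (auto simp: filterlim_at less_imp_neq[symmetric])
        ultimately have "(\<lambda>n. (m (x + t n *\<^sub>R e) - m x) / t n) \<longlonglongrightarrow> h x"
          by (rule filterlim_compose)
        then show ?thesis by (simp add: add.commute)
      qed
      have lim: "(\<lambda>n. t n *\<^sub>R e + x) \<longlonglongrightarrow> x"
        using tendsto_add[OF tendsto_scaleR[OF tlim tendsto_const[of e]] tendsto_const[of x]] by simp
      show "(\<lambda>n. q n x) \<longlonglongrightarrow> indicator U x * h x"
      proof (cases "x \<in> U")
        case True
        then have "\<forall>\<^sub>F n in sequentially. t n *\<^sub>R e + x \<in> U"
          using lim U topological_tendstoD by blast
        then have "\<forall>\<^sub>F n in sequentially. (m (t n *\<^sub>R e + x) - m x) / t n = q n x"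
          by eventually_elim (simp add: q_def w_def True)
        then show ?thesis using Lim_transform_eventually[OF dq] True by simp
      next
        case False
        then have "x \<in> - closure U" using x U by (simp add: frontier_def interior_open)
        then have "\<forall>\<^sub>F n in sequentially. t n *\<^sub>R e + x \<in> - closure U"
          by (rule topological_tendstoD[OF lim open_Compl[OF closed_closure]])
        then have "\<forall>\<^sub>F n in sequentially. 0 = q n x"
          by eventually_elim (use closure_subset[of U] False in \<open>auto simp: q_def w_def indicator_def\<close>)
        from Lim_transform_eventually[OF tendsto_const this] show ?thesis using False by simp
      qed
    qed
  qed
  then have "(LINT x|lborel. indicator U x * h x) = 0" using q0 LIMSEQ_unique[OF _ tendsto_const] by simp
  moreover have "(\<lambda>x. indicator U x * h x) \<in> borel_measurable lborel" using U hb by simp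
  ultimately show ?thesis unfolding set_lebesgue_integral_def by (simp add: integral_completion)
qed

section \<open>Bump functions and partitions of unity\<close>

text \<open>As k is fixed, this function can play the role of exp(-1/x) in cutoffs. With exponent k
  + 1 its k-th derivative is a multiple of max 0 x and still continuous.\<close>

definition pos_power :: "nat \<Rightarrow> real \<Rightarrow> real" where
  "pos_power k x = max 0 x ^ Suc k"

lemma pos_power_nonneg: "0 \<le> pos_power k x"
  by (simp add: pos_power_def)

lemma pos_power_pos_iff: "0 < pos_power k x \<longleftrightarrow> 0 < x"
  unfolding pos_power_def by (cases "x \<le> 0") (auto simp: max_def)

lemma pos_power_eq_0_iff: "pos_power k x = 0 \<longleftrightarrow> x \<le> 0"
  unfolding pos_power_def by (cases "x \<le> 0") (auto simp: max_def)

lemma pos_power_has_derivative: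
  "(pos_power (Suc k) has_real_derivative real (k + 2) * pos_power k x) (at x)"
proof -
  consider "x > 0" | "x < 0" | "x = 0" by linarith
  then show ?thesis
  proof cases
    case 1
    have "((\<lambda>x. x ^ Suc (Suc k)) has_real_derivative real (k + 2) * pos_power k x) (at x)"
      using 1 DERIV_pow[of "Suc (Suc k)" x UNIV] by (simp add: pos_power_def)
    then show ?thesis
      by (rule has_field_derivative_transform_within_open[OF _ open_greaterThan[of 0]])
        (use 1 in \<open>auto simp: pos_power_def\<close>)
  next
    case 2
    have "((\<lambda>x. 0) has_real_derivative real (k + 2) * pos_power k x) (at x)"
      using 2 by (auto simp: pos_power_def)
    then show ?thesis
      by (rule has_field_derivative_transform_within_open[OF _ open_lessThan[of 0]])
        (use 2 in \<open>auto simp: pos_power_def\<close>)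
  next
    case 3
    have "((\<lambda>h. pos_power (Suc k) h / h) \<longlongrightarrow> 0) (at 0)"
    proof (rule Lim_null_comparison)
      show "\<forall>\<^sub>F h in at 0. norm (pos_power (Suc k) h / h) \<le> pos_power k h"
        by (rule always_eventually) (auto simp: pos_power_def max_def)
      have "isCont (pos_power k) 0" unfolding pos_power_def by (intro continuous_intros)
      then show "((pos_power k) \<longlongrightarrow> 0) (at 0)" by (simp add: isCont_def pos_power_def)
    qed
    then show ?thesis using 3 by (simp add: has_field_derivative_iff pos_power_def)
  qed
qed

lemma C_on_pos_power: "C_on k UNIV (pos_power k)"
proof (induction k)
  case 0 then show ?case unfolding pos_power_def by (auto intro!: continuous_intros)
next
  case (Suc k)
  show ?case
  proof (rule C_on_SucI[OF open_UNIV])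
    show "(pos_power (Suc k) has_derivative (\<lambda>v. (real (k + 2) * pos_power k x) * v)) (at x)" for x
      using pos_power_has_derivative[of k x] unfolding has_field_derivative_def .
    show "C_on k UNIV (\<lambda>x. (real (k + 2) * pos_power k x) * v)" for v
      by (intro C_on_mult C_on_const open_UNIV Suc)
  qed
qed

lemma C_on_pos_power_compose:
  assumes "open S" "C_on k S f"
  shows "C_on k S (\<lambda>x. pos_power k (f x))"
  by (rule C_on_compose[OF assms(1) open_UNIV C_on_pos_power assms(2)]) simp

text \<open>Formed from the squared distance, which unlike the distance is smooth at p.\<close>

definition bump :: "nat \<Rightarrow> 'a::euclidean_space \<Rightarrow> real \<Rightarrow> 'a \<Rightarrow> real" where
  "bump k p r x = pos_power k (r\<^sup>2 - (x - p) \<bullet> (x - p))"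

lemma C_on_bump: "C_on k UNIV (bump k p r)"
  unfolding bump_def[abs_def]
  by (intro C_on_pos_power_compose C_on_diff C_on_inner_self C_on_const C_on_id open_UNIV)

lemma bump_nonneg: "0 \<le> bump k p r x"
  by (simp add: bump_def pos_power_nonneg)

lemma bump_pos_iff: "0 < r \<Longrightarrow> 0 < bump k p r x \<longleftrightarrow> x \<in> ball p r"
  using power_strict_mono[of "norm (x - p)" r 2] power2_less_imp_less[of "norm (x - p)" r]
  unfolding bump_def pos_power_pos_iff dot_square_norm
  by (auto simp: dist_norm norm_minus_commute)

lemma bump_eq_0: "0 < r \<Longrightarrow> x \<notin> ball p r \<Longrightarrow> bump k p r x = 0"
  using bump_pos_iff[of r k p x] bump_nonneg[of k p r x] by linarith

text \<open>The weights must add up to exactly 1 on a whole neighbourhood of K and stay C^k where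
  all bumps vanish. Dividing by \<beta> + \<tau> achieves both: \<tau> is 0 where \<beta> >
  \<delta>/2 and positive where \<beta> = 0.\<close>

lemma C_partition_of_unity:
  fixes K :: "'a::euclidean_space set" and r :: "'a \<Rightarrow> real"
  assumes K: "compact K" and r: "\<And>p. p \<in> K \<Longrightarrow> 0 < r p"
  obtains I and \<omega> :: "'a \<Rightarrow> 'a \<Rightarrow> real" and N where "finite I" "I \<subseteq> K" "\<forall>p. C_on k UNIV (\<omega> p)" "\<forall>p x. 0 \<le> \<omega> p x"
    "\<forall>p\<in>I. \<forall>x. x \<notin> ball p (r p) \<longrightarrow> \<omega> p x = 0" "\<forall>x. (\<Sum>p\<in>I. \<omega> p x) \<le> 1"
    "open N" "K \<subseteq> N" "\<forall>x\<in>N. (\<Sum>p\<in>I. \<omega> p x) = 1"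
proof -
  have cover: "K \<subseteq> (\<Union>p\<in>K. ball p (r p))"
    using r by (auto intro!: bexI)
  obtain I where I: "I \<subseteq> K" "finite I" "K \<subseteq> (\<Union>p\<in>I. ball p (r p))"
    using compactE_image[OF K open_ball cover] .
  define \<beta> where "\<beta> = (\<lambda>x. \<Sum>p\<in>I. bump k p (r p) x)"
  have C\<beta>: "C_on k UNIV \<beta>" unfolding \<beta>_def by (intro C_on_sum open_UNIV C_on_bump)
  have \<beta>0: "0 \<le> \<beta> x" for x unfolding \<beta>_def by (intro sum_nonneg bump_nonneg)
  have \<beta>pos: "0 < \<beta> x" if x: "x \<in> K" for x
  proof -
    obtain p where p: "p \<in> I" "x \<in> ball p (r p)" using I(3) x by blast
    then have "0 < bump k p (r p) x" using bump_pos_iff r I(1) by blast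
    then show ?thesis unfolding \<beta>_def using I(2) p(1) by (intro sum_pos2[of _ p]) (auto intro: bump_nonneg)
  qed
  have cont\<beta>: "continuous_on UNIV \<beta>" using C\<beta> C_on_imp_continuous_on by blast
  obtain \<delta> where \<delta>: "0 < \<delta>" "\<And>x. x \<in> K \<Longrightarrow> \<delta> \<le> \<beta> x"
  proof (cases "K = {}")
    case True then show ?thesis using that[of 1] by simp
  next
    case False
    obtain x0 where "x0 \<in> K" "\<forall>x\<in>K. \<beta> x0 \<le> \<beta> x"
      using continuous_attains_inf[OF K False continuous_on_subset[OF cont\<beta> subset_UNIV]] by blast
    then show ?thesis using that[of "\<beta> x0"] \<beta>pos by simp
  qed
  define \<tau> where "\<tau> = (\<lambda>x. pos_power k (\<delta> / 2 - \<beta> x))"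
  have C\<tau>: "C_on k UNIV \<tau>" unfolding \<tau>_def
    by (intro C_on_pos_power_compose C_on_diff C_on_const open_UNIV C\<beta>)
  have \<tau>0: "0 \<le> \<tau> x" for x unfolding \<tau>_def by (rule pos_power_nonneg)
  have denom: "0 < \<beta> x + \<tau> x" for x
  proof (cases "\<beta> x = 0")
    case True
    then have "0 < \<tau> x" unfolding \<tau>_def pos_power_pos_iff using \<delta>(1) by simp
    then show ?thesis using \<beta>0[of x] by simp
  qed (use \<beta>0[of x] \<tau>0[of x] in linarith)
  define \<omega> where "\<omega> = (\<lambda>p x. bump k p (r p) x / (\<beta> x + \<tau> x))"
  have sum: "(\<Sum>p\<in>I. \<omega> p x) = \<beta> x / (\<beta> x + \<tau> x)" for x
    unfolding \<omega>_def \<beta>_def by (simp add: sum_divide_distrib)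
  show ?thesis
  proof (rule that[of I \<omega> "{x. \<delta> / 2 < \<beta> x}"]; (intro allI ballI impI)?)
    show "finite I" "I \<subseteq> K" using I by simp_all
    show "C_on k UNIV (\<omega> p)" for p unfolding \<omega>_def
      using denom by (intro C_on_divide C_on_add open_UNIV C_on_bump C\<beta> C\<tau>) (metis less_irrefl)
    show "0 \<le> \<omega> p x" for p x unfolding \<omega>_def by (rule divide_nonneg_pos[OF bump_nonneg denom])
    show "\<omega> p x = 0" if "p \<in> I" "x \<notin> ball p (r p)" for p x
    proof -
      have "bump k p (r p) x = 0" using bump_eq_0 r I(1) that by blast
      then show ?thesis by (simp add: \<omega>_def)
    qed
    show "(\<Sum>p\<in>I. \<omega> p x) \<le> 1" for x unfolding sum using denom[of x] \<tau>0[of x] by (simp add: divide_le_eq_1)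
    show "open {x. \<delta> / 2 < \<beta> x}" using cont\<beta> by (intro open_Collect_less continuous_on_const)
    show "K \<subseteq> {x. \<delta> / 2 < \<beta> x}" using \<delta> by fastforce
    show "(\<Sum>p\<in>I. \<omega> p x) = 1" if "x \<in> {x. \<delta> / 2 < \<beta> x}" for x
    proof -
      have "\<tau> x = 0" unfolding \<tau>_def pos_power_eq_0_iff using that by simp
      then show ?thesis unfolding sum using denom[of x] by simp
    qed
  qed
qed

lemma norm_orthogonal_part_le:
  fixes e :: "'a::euclidean_space"
  assumes "norm e = 1"
  shows "norm (x - (x \<bullet> e) *\<^sub>R e) \<le> norm x"
proof -
  have ee: "e \<bullet> e = 1" using assms by (simp add: dot_square_norm)
  have "(x - (x \<bullet> e) *\<^sub>R e) \<bullet> (x - (x \<bullet> e) *\<^sub>R e) = x \<bullet> x - (x \<bullet> e)\<^sup>2"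
    by (simp add: inner_diff_left inner_diff_right ee inner_commute power2_eq_square)
  also have "\<dots> \<le> x \<bullet> x" by simp
  finally show ?thesis by (simp add: norm_le)
qed

lemma line_primitive_eq_0:
  assumes "\<And>s. h (x + s *\<^sub>R e) = 0"
  shows "line_primitive e h x = 0"
  unfolding line_primitive_def by (simp add: assms)

text \<open>A quotient a / (a + b), where a vanishes for |F| \<ge> r and b for |F| \<le> r/2. Both
  depend on F through its square, and they have no common zero because (r/2)^2 < r^2.\<close>

lemma C_cutoff:
  fixes F :: "'a::euclidean_space \<Rightarrow> real"
  assumes "open S" "C_on k S F" "0 < r"
  obtains \<tau> :: "'a \<Rightarrow> real" where "C_on k S \<tau>" "\<forall>x. \<bar>F x\<bar> \<le> r / 2 \<longrightarrow> \<tau> x = 1" "\<forall>x. r \<le> \<bar>F x\<bar> \<longrightarrow> \<tau> x = 0"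
proof -
  let ?a = "\<lambda>x. pos_power k (r\<^sup>2 - F x * F x)" and ?b = "\<lambda>x. pos_power k (F x * F x - (r / 2)\<^sup>2)"
  have sq: "F x * F x \<le> c\<^sup>2 \<longleftrightarrow> \<bar>F x\<bar> \<le> c" if "0 \<le> c" for x c
    using that abs_le_square_iff[of "F x" c] by (simp add: power2_eq_square)
  have pos: "?a x + ?b x \<noteq> 0" for x
  proof -
    have "(r / 2)\<^sup>2 < r\<^sup>2" using assms(3) by (intro power_strict_mono) auto
    then have "0 < ?a x \<or> 0 < ?b x" unfolding pos_power_pos_iff by linarith
    then show ?thesis using pos_power_nonneg[of k "r\<^sup>2 - F x * F x"] pos_power_nonneg[of k "F x * F x - (r / 2)\<^sup>2"]
      by linarith
  qed
  have C: "C_on k S (\<lambda>x. ?a x / (?a x + ?b x))"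
    by (intro C_on_divide C_on_add C_on_pos_power_compose C_on_diff C_on_mult C_on_const assms(1,2) pos)
  have one: "?a x / (?a x + ?b x) = 1" if "\<bar>F x\<bar> \<le> r / 2" for x
  proof -
    have "?b x = 0" unfolding pos_power_eq_0_iff using sq[of "r / 2" x] that assms(3) by simp
    then show ?thesis using pos[of x] by simp
  qed
  have zero: "?a x / (?a x + ?b x) = 0" if "r \<le> \<bar>F x\<bar>" for x
  proof -
    have "r\<^sup>2 \<le> F x * F x" using power_mono[OF that, of 2] assms(3) by (simp add: power2_eq_square)
    then have "?a x = 0" unfolding pos_power_eq_0_iff by simp
    then show ?thesis by simp
  qed
  show ?thesis
    by (rule that[OF C]) (intro allI impI, (erule one | erule zero))+
qed

section \<open>Solving near the boundary\<close>

text \<open>The radius depends on the chart only, so a partition of unity can be chosen before h.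
  The agreement holds near the entire frontier, not only near p, so that local solutions can be
  added.\<close>

lemma boundary_directional:
  fixes U :: "'a::euclidean_space set"
  assumes k: "1 \<le> k" and chart: "boundary_chart U p S F e" and p: "p \<in> frontier U"
  shows "\<exists>r0>0. \<forall>h. C_on k UNIV h \<longrightarrow> (\<forall>x. x \<notin> ball p r0 \<longrightarrow> h x = 0) \<longrightarrow>
    (\<exists>h' N. directional k U h' \<and> open N \<and> frontier U \<subseteq> N \<and> (\<forall>x\<in>N. h' x = h x))"
proof -
  have S: "open S" "convex S" "p \<in> S" and CF: "C_on j S F" and e: "e \<in> Basis"
    and zero: "\<And>x. x \<in> S \<Longrightarrow> x \<in> frontier U \<longleftrightarrow> F x = 0"
    and pos: "\<And>x. x \<in> S \<Longrightarrow> 0 < frechet_derivative F (at x) e" for j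
    using chart unfolding boundary_chart_def by auto
  have e1: "norm e = 1" and ee: "e \<bullet> e = 1" using e by simp_all
  define T where "T = straighten e F ` S"
  define I where "I = inv_into S (straighten e F)"
  have inj: "inj_on (straighten e F) S" and oT: "open T" and CI: "C_on k T I"
    unfolding T_def I_def by (rule straighten_inverse[OF S(1,2) CF k e], erule pos)+
  have IS: "I y \<in> S" and SI: "straighten e F (I y) = y" if "y \<in> T" for y
    using that unfolding T_def I_def by (auto intro: inv_into_into f_inv_into_f)
  have I_str: "I (straighten e F x) = x" if "x \<in> S" for x
    unfolding I_def by (rule inv_into_f_f[OF inj that])
  \<comment> \<open>\<open>straighten e F\<close> changes the e-coordinate only and so preserves
    \<open>P\<close>; on S the frontier consists of the points whose straightened image equals
    \<open>P x\<close>.\<close>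
  define P where "P = (\<lambda>x::'a. x - (x \<bullet> e) *\<^sub>R e)"
  have Pe: "P x \<bullet> e = 0" for x by (simp add: P_def inner_diff_left ee)
  have P_line: "P (x + s *\<^sub>R e) = P x" for x s by (simp add: P_def inner_add_left ee algebra_simps)
  have P_app: "P x = x - (x \<bullet> e) *\<^sub>R e" for x by (simp add: P_def)
  have PP: "P (P x) = P x" for x unfolding P_app[of "P x"] by (simp add: Pe)
  have str: "straighten e F x = P x + F x *\<^sub>R e" for x by (simp add: straighten_def P_def algebra_simps)
  have Pstr: "P (straighten e F x) = P x" for x unfolding str P_line PP ..
  have Pdiff: "P x - P y = P (x - y)" for x y by (simp add: P_def inner_diff_left algebra_simps)
  have Pnorm: "norm (P x - P y) \<le> norm (x - y)" for x y
    unfolding Pdiff unfolding P_def by (rule norm_orthogonal_part_le[OF e1])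
  have CP: "C_on j UNIV P" for j unfolding P_def
    by (intro C_on_diff C_on_scaleR C_on_inner C_on_id C_on_const open_UNIV)
  have contP: "continuous_on UNIV P" using C_on_imp_continuous_on[OF CP] .
  have Fp: "F p = 0" using zero[OF S(3)] p by simp
  define y0 where "y0 = straighten e F p"
  have y0: "y0 \<in> T" unfolding y0_def T_def using S(3) by blast
  have y0P: "y0 = P p" unfolding y0_def str Fp by simp
  obtain \<epsilon> where \<epsilon>: "0 < \<epsilon>" "cball y0 \<epsilon> \<subseteq> T" using oT y0 open_contains_cball by metis
  \<comment> \<open>Half of \<epsilon> for the e-direction and, through r0 \<le> r, half for the
    others: the cylinder \<open>Y\<close> then fits into the ball of radius \<epsilon> around
    y0.\<close>
  define r where "r = \<epsilon> / 2"
  have r: "0 < r" unfolding r_def using \<epsilon>(1) by simp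
  have contF: "continuous_on S F" using C_on_imp_continuous_on[OF CF] .
  have "open (S \<inter> F -` {- (r / 2)<..<r / 2})"
    by (rule continuous_open_preimage[OF contF S(1) open_greaterThanLessThan])
  moreover have "p \<in> S \<inter> F -` {- (r / 2)<..<r / 2}" using S(3) Fp r by simp
  ultimately obtain r1 where r1: "0 < r1" "ball p r1 \<subseteq> S \<inter> F -` {- (r / 2)<..<r / 2}"
    using open_contains_ball by metis
  \<comment> \<open>r1 ensures |F| < r/2 on the ball that will carry h, so that the cutoff \<tau> is
    1 there.\<close>
  define r0 where "r0 = min r1 r"
  have r0: "0 < r0" "r0 \<le> r" unfolding r0_def using r1(1) r by simp_all
  have ball: "x \<in> S" "\<bar>F x\<bar> < r / 2" if "x \<in> ball p r0" for x
  proof -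
    have "x \<in> S \<inter> F -` {- (r / 2)<..<r / 2}" using that r1(2) unfolding r0_def by auto
    then show "x \<in> S" "\<bar>F x\<bar> < r / 2" by (auto simp: abs_less_iff)
  qed
  define Y where "Y = {y. norm (P y - P p) \<le> r0 \<and> \<bar>y \<bullet> e\<bar> \<le> r}"
  have YT: "Y \<subseteq> cball y0 \<epsilon>"
  proof
    fix y assume y: "y \<in> Y"
    have "y - y0 = (P y - P p) + (y \<bullet> e) *\<^sub>R e" unfolding y0P P_app[of y] by simp
    then have "norm (y - y0) \<le> norm (P y - P p) + norm ((y \<bullet> e) *\<^sub>R e)" using norm_triangle_ineq by metis
    also have "\<dots> \<le> r0 + r" using y e1 unfolding Y_def by simp
    also have "\<dots> \<le> \<epsilon>" using r0(2) unfolding r_def by simp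
    finally show "y \<in> cball y0 \<epsilon>" by (simp add: dist_norm norm_minus_commute)
  qed
  have "closed Y" unfolding Y_def
    by (intro closed_Collect_conj closed_Collect_le continuous_intros contP)
  then have "compact Y" using YT bounded_subset[OF bounded_cball] compact_eq_bounded_closed by blast
  \<comment> \<open>The compact set outside which m will be 0. It contains every point of S with |F|
    \<le> r whose e-line has distance at most r0 from the e-line through p.\<close>
  define M where "M = I ` Y"
  have "continuous_on Y I"
    using C_on_imp_continuous_on[OF CI] YT \<epsilon>(2) continuous_on_subset by blast
  then have cM: "compact M" unfolding M_def using \<open>compact Y\<close> compact_continuous_image by blast
  \<comment> \<open>For x in V the e-line through x has a frontier point in S, namely
    \<open>I (P x)\<close>: its straightened image \<open>P x\<close> has e-coordinate 0.\<close>
  define V where "V = S \<inter> P -` T"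
  have oV: "open V" unfolding V_def
    by (intro open_Int S(1) open_vimage oT contP)
  have VS: "x \<in> S" and VT: "P x \<in> T" if "x \<in> V" for x using that unfolding V_def by auto
  have MV: "M \<subseteq> V"
  proof
    fix x assume "x \<in> M"
    then obtain y where y: "x = I y" "y \<in> Y" unfolding M_def by blast
    then have yT: "y \<in> T" using YT \<epsilon>(2) by blast
    have "P x = P y" using Pstr[of x] SI[OF yT] y(1) by simp
    moreover have "P y \<in> Y" using y(2) r unfolding Y_def by (simp add: PP Pe)
    ultimately have "P x \<in> T" using YT \<epsilon>(2) by auto
    then show "x \<in> V" unfolding V_def using IS[OF yT] y(1) by simp
  qed
  have M_I: "x \<in> M" if "x \<in> S" "norm (P x - P p) \<le> r0" "\<bar>F x\<bar> \<le> r" for x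
  proof -
    have "straighten e F x \<bullet> e = F x" unfolding str by (simp add: inner_add_left Pe ee)
    then have "straighten e F x \<in> Y" unfolding Y_def using that by (simp add: Pstr)
    then show ?thesis unfolding M_def using I_str[OF that(1)] by (metis imageI)
  qed
  have ballM: "x \<in> M" if "x \<in> ball p r0" for x
  proof (rule M_I)
    show "x \<in> S" "\<bar>F x\<bar> \<le> r" using ball[OF that] r by auto
    show "norm (P x - P p) \<le> r0"
      using Pnorm[of x p] that by (simp add: dist_norm norm_minus_commute)
  qed
  \<comment> \<open>One order more than k, because the e-derivative of \<tau> appears in h', which
    has to be C^k.\<close>
  obtain \<tau> :: "'a \<Rightarrow> real" where \<tau>: "C_on (Suc k) S \<tau>" "\<forall>x. \<bar>F x\<bar> \<le> r / 2 \<longrightarrow> \<tau> x = 1" "\<forall>x. r \<le> \<bar>F x\<bar> \<longrightarrow> \<tau> x = 0"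
    using C_cutoff[OF S(1) CF[of "Suc k"] r] .
  show ?thesis
  proof (rule exI[of _ r0], intro conjI r0(1) allI impI)
    fix h assume h: "C_on k UNIV h" "\<forall>x. x \<notin> ball p r0 \<longrightarrow> h x = (0::real)"
    define H where "H = line_primitive e h"
    have CH: "C_on k UNIV H" unfolding H_def by (rule C_on_line_primitive[OF h(1)])
    define \<pi> where "\<pi> = (\<lambda>x. I (P x))"
    have C\<pi>: "C_on k V \<pi>" unfolding \<pi>_def
      by (rule C_on_compose[OF oV oT CI C_on_subset[OF CP]]) (auto dest: VT)
    have P\<pi>: "P (\<pi> x) = P x" if "x \<in> V" for x
      using Pstr[of "\<pi> x"] SI[OF VT[OF that]] unfolding \<pi>_def by (simp add: PP)
    define m0 where "m0 = (\<lambda>x. H x - H (\<pi> x))"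
    have Cm0: "C_on k V m0" unfolding m0_def
      by (intro C_on_diff oV C_on_subset[OF CH] C_on_compose[OF oV open_UNIV CH C\<pi>]) auto
    have H0: "H x = 0" if "r0 < norm (P x - P p)" for x
      unfolding H_def
    proof (rule line_primitive_eq_0)
      fix s
      have "r0 < norm (x + s *\<^sub>R e - p)" using Pnorm[of "x + s *\<^sub>R e" p] that unfolding P_line by simp
      then have "x + s *\<^sub>R e \<notin> ball p r0" by (simp add: dist_norm norm_minus_commute)
      then show "h (x + s *\<^sub>R e) = 0" using h(2) by blast
    qed
    \<comment> \<open>\<open>\<pi>\<close> projects onto the boundary along \<open>e\<close>, so \<open>m0\<close> is the \<open>e\<close>-primitive of \<open>h\<close> vanishing there;
      cutting off with a function of \<open>F\<close> changes it only away from the boundary.\<close>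
    define m where "m = (\<lambda>x. if x \<in> M then \<tau> x * m0 x else 0)"
    \<comment> \<open>The formula persists on V outside M: there either the e-line misses the ball
      carrying h, so m0 = 0, or \<tau> = 0. Hence m is C^k across the edge of M.\<close>
    have mV: "m x = \<tau> x * m0 x" if "x \<in> V" for x
    proof (cases "x \<in> M")
      case False
      then have "r0 < norm (P x - P p) \<or> r \<le> \<bar>F x\<bar>" using M_I[OF VS[OF that]] by linarith
      then have "\<tau> x * m0 x = 0"
      proof
        assume a: "r0 < norm (P x - P p)"
        then have "H (\<pi> x) = 0" by (intro H0) (simp add: P\<pi>[OF that])
        then show ?thesis using H0[OF a] by (simp add: m0_def)
      qed (simp add: \<tau>(3))
      then show ?thesis using False by (simp add: m_def)
    qed (simp add: m_def)
    have m_out: "m x = 0" if "x \<in> - M" for x using that by (simp add: m_def)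
    have oM: "open (- M)" using cM compact_imp_closed open_Compl by blast
    have cover: "V \<union> - M = UNIV" using MV by blast
    have C\<tau>: "C_on k V \<tau>" by (rule C_on_subset[OF C_on_SucD[OF \<tau>(1)]]) (use VS in blast)
    have "C_on k V m"
      using C_on_cong[OF oV, of m "\<lambda>x. \<tau> x * m0 x" k] mV C_on_mult[OF oV C\<tau> Cm0] by simp
    moreover have "C_on k (- M) m" using C_on_cong[OF oM, of m "\<lambda>x. 0" k] m_out by simp
    ultimately have Cm: "C_on k UNIV m" using C_on_Un[OF oV oM] cover by metis
    define h' where "h' = (\<lambda>x. frechet_derivative m (at x) e)"
    have h'_out: "h' x = 0" if "x \<in> - M" for x
    proof -
      have "(m has_derivative (\<lambda>v. 0)) (at x)"
        by (rule has_derivative_transform_within_open[OF _ oM that]) (simp_all add: m_def)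
      from fun_cong[OF frechet_derivative_at[OF this], of e] show ?thesis by (simp add: h'_def)
    qed
    have h'V: "h' x = frechet_derivative \<tau> (at x) e * m0 x + \<tau> x * h x" if x: "x \<in> V" for x
      unfolding h'_def
    proof (rule frechet_derivative_along_line)
      show "m differentiable (at x)" by (rule C_on_differentiable[OF Cm k UNIV_I])
      have "(\<tau> has_derivative frechet_derivative \<tau> (at x)) (at (x + 0 *\<^sub>R e))"
        using C_on_derivative[OF \<tau>(1) VS[OF x]] by simp
      from has_derivative_along_line[OF this]
      have 1: "((\<lambda>t. \<tau> (x + t *\<^sub>R e)) has_real_derivative frechet_derivative \<tau> (at x) e) (at 0)" .
      have "((\<lambda>s. H (x + s *\<^sub>R e) - H (\<pi> x)) has_real_derivative h x - 0) (at 0)"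
        using line_primitive_has_derivative_line[OF C_on_imp_continuous_on[OF h(1)] e1, of x 0]
        unfolding H_def by (intro DERIV_diff DERIV_const) simp
      \<comment> \<open>The projection is constant along e, so on the line m0 differs from H by a
        constant.\<close>
      moreover have "m0 (x + s *\<^sub>R e) = H (x + s *\<^sub>R e) - H (\<pi> x)" for s
        unfolding m0_def \<pi>_def P_line ..
      ultimately have 2: "((\<lambda>s. m0 (x + s *\<^sub>R e)) has_real_derivative h x) (at 0)" by simp
      have "((\<lambda>t. \<tau> (x + t *\<^sub>R e) * m0 (x + t *\<^sub>R e)) has_real_derivative
          frechet_derivative \<tau> (at x) e * m0 x + \<tau> x * h x) (at 0)"
        using DERIV_mult[OF 1 2] by (simp add: algebra_simps)
      moreover have "open ((\<lambda>t. x + t *\<^sub>R e) -` V)"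
        by (intro open_vimage oV continuous_intros)
      moreover have "0 \<in> (\<lambda>t. x + t *\<^sub>R e) -` V" using x by simp
      ultimately show "((\<lambda>t. m (x + t *\<^sub>R e)) has_real_derivative
          frechet_derivative \<tau> (at x) e * m0 x + \<tau> x * h x) (at 0)"
        by (rule has_field_derivative_transform_within_open) (simp add: mV)
    qed
    have "C_on k V (\<lambda>x. frechet_derivative \<tau> (at x) e * m0 x + \<tau> x * h x)"
    proof (intro C_on_add C_on_mult oV Cm0)
      have "C_on k S (\<lambda>x. frechet_derivative \<tau> (at x) e)" using \<tau>(1) by simp
      then show "C_on k V (\<lambda>x. frechet_derivative \<tau> (at x) e)" using VS C_on_subset by blast
      show "C_on k V \<tau>" by (rule C\<tau>)
      show "C_on k V h" using h(1) C_on_subset by blast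
    qed
    then have "C_on k V h'"
      using C_on_cong[OF oV, of h' "\<lambda>x. frechet_derivative \<tau> (at x) e * m0 x + \<tau> x * h x" k] h'V by simp
    moreover have "C_on k (- M) h'" using C_on_cong[OF oM, of h' "\<lambda>x. 0" k] h'_out by simp
    ultimately have Ch': "C_on k UNIV h'" using C_on_Un[OF oV oM] cover by metis
    have mfr: "m x = 0" if x: "x \<in> frontier U" for x
    proof (cases "x \<in> M")
      case True
      then have xS: "x \<in> S" using MV VS by blast
      then have "straighten e F x = P x" unfolding str using zero x by simp
      then have "\<pi> x = x" unfolding \<pi>_def using I_str[OF xS] by simp
      then show ?thesis by (simp add: m_def m0_def)
    qed (simp add: m_def)
    have bdd: "bounded {x. m x \<noteq> 0}"
      by (rule bounded_subset[OF compact_imp_bounded[OF cM]]) (auto simp: m_def)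
    have dir: "directional k U h'"
      unfolding directional_def using Ch' e Cm bdd mfr by (auto simp: h'_def)
    \<comment> \<open>Here \<tau> = 1 throughout, so its derivative drops out and h' = h. Off M both
      functions vanish, and a frontier point in M has F = 0 and thus lies in V0.\<close>
    define V0 where "V0 = V \<inter> F -` {- (r / 2)<..<r / 2}"
    have oV0: "open V0" unfolding V0_def
      by (rule continuous_open_preimage[OF continuous_on_subset[OF contF] oV open_greaterThanLessThan])
        (use VS in blast)
    have V0: "h' x = h x" if x: "x \<in> V0" for x
    proof -
      have xV: "x \<in> V" using x by (simp add: V0_def)
      have \<tau>1: "\<tau> y = 1" if "y \<in> V0" for y using that by (intro \<tau>(2)[rule_format]) (auto simp: V0_def)
      have "(\<tau> has_derivative (\<lambda>v. 0)) (at x)"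
        by (rule has_derivative_transform_within_open[OF has_derivative_const[of 1] oV0 x]) (simp add: \<tau>1)
      from fun_cong[OF frechet_derivative_at[OF this], of e]
      have "frechet_derivative \<tau> (at x) e = 0" by simp
      then show ?thesis using h'V[OF xV] \<tau>1[OF x] by simp
    qed
    show "\<exists>h' N. directional k U h' \<and> open N \<and> frontier U \<subseteq> N \<and> (\<forall>x\<in>N. h' x = h x)"
    proof (rule exI[of _ h'], rule exI[of _ "V0 \<union> - M"], intro conjI dir open_Un oV0 oM ballI)
      show "frontier U \<subseteq> V0 \<union> - M"
      proof
        fix x assume x: "x \<in> frontier U"
        show "x \<in> V0 \<union> - M"
        proof (cases "x \<in> M")
          case True
          then have "x \<in> V" using MV by blast
          then have "x \<in> V0" using zero[OF VS] x r by (simp add: V0_def)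
          then show ?thesis by simp
        qed simp
      qed
      show "h' x = h x" if "x \<in> V0 \<union> - M" for x
      proof (cases "x \<in> V0")
        case False
        then have "x \<in> - M" using that by blast
        moreover from this have "h x = 0" using h(2) ballM by blast
        ultimately show ?thesis using h'_out by simp
      qed (rule V0)
    qed
  qed
qed

section \<open>Integrating out coordinates\<close>

lemma line_primitive_const:
  assumes "continuous_on UNIV f" "norm e = 1" "s \<le> t"
    and "\<And>u. s < u \<Longrightarrow> u < t \<Longrightarrow> f (x + u *\<^sub>R e) = 0"
  shows "line_primitive e f (x + s *\<^sub>R e) = line_primitive e f (x + t *\<^sub>R e)"
proof (cases "s = t")
  case False
  then have "s < t" using assms(3) by simp
  from MVT2[OF this line_primitive_has_derivative_line[OF assms(1,2)], of x]
  obtain z where "s < z" "z < t"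
    "line_primitive e f (x + t *\<^sub>R e) - line_primitive e f (x + s *\<^sub>R e) = (t - s) * f (x + z *\<^sub>R e)"
    by blast
  then show ?thesis using assms(4) by simp
qed simp

text \<open>The last clause is the integral over [a, c], expressed by the line primitive on the
  reals with unit vector 1.\<close>

definition unit_mass :: "nat \<Rightarrow> real \<Rightarrow> real \<Rightarrow> (real \<Rightarrow> real) \<Rightarrow> bool" where
  "unit_mass k a c \<eta> \<longleftrightarrow> C_on k UNIV \<eta> \<and> (\<forall>t. t \<le> a \<or> c \<le> t \<longrightarrow> \<eta> t = 0) \<and>
     line_primitive 1 \<eta> c - line_primitive 1 \<eta> a = 1"

lemma unit_mass_mono:
  assumes "unit_mass k a c \<eta>" "a' \<le> a" "c \<le> c'"
  shows "unit_mass k a' c' \<eta>"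
proof -
  have \<eta>: "C_on k UNIV \<eta>" "\<And>t. t \<le> a \<or> c \<le> t \<Longrightarrow> \<eta> t = 0"
    "line_primitive 1 \<eta> c - line_primitive 1 \<eta> a = 1"
    using assms(1) unfolding unit_mass_def by auto
  note cont = C_on_imp_continuous_on[OF \<eta>(1)]
  have "line_primitive 1 \<eta> a' = line_primitive 1 \<eta> a" "line_primitive 1 \<eta> c = line_primitive 1 \<eta> c'"
    using line_primitive_const[OF cont, of 1 a' a 0] line_primitive_const[OF cont, of 1 c c' 0] \<eta>(2) assms(2,3)
    by simp_all
  then show ?thesis unfolding unit_mass_def using \<eta> assms(2,3) by auto
qed

lemma unit_mass_bump:
  assumes "0 < r"
  obtains \<eta> where "unit_mass k (q - r) (q + r) \<eta>" "\<forall>t. 0 \<le> \<eta> t" "0 < \<eta> q"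
proof -
  let ?b = "bump k q r"
  have cont: "continuous_on UNIV ?b" using C_on_imp_continuous_on[OF C_on_bump] .
  have der: "(line_primitive 1 ?b has_real_derivative ?b s) (at s)" for s
    using line_primitive_has_derivative_line[OF cont, of 1 0 s] by simp
  define c where "c = line_primitive 1 ?b (q + r) - line_primitive 1 ?b (q - r)"
  have "line_primitive 1 ?b (q - r) < line_primitive 1 ?b (q + r)"
  proof (rule DERIV_pos_imp_increasing_open[where f="line_primitive 1 (bump k q r)"])
    show "q - r < q + r" using assms by simp
    show "\<exists>y. (line_primitive 1 ?b has_real_derivative y) (at x) \<and> 0 < y" if "q - r < x" "x < q + r" for x
      using der[of x] bump_pos_iff[OF assms, of k q x] that by (auto simp: dist_real_def abs_less_iff)
    show "continuous_on {q - r..q + r} (line_primitive 1 ?b)"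
      using der DERIV_isCont continuous_at_imp_continuous_on by blast
  qed
  then have c: "0 < c" by (simp add: c_def)
  have lp: "line_primitive 1 (\<lambda>t. ?b t / c) t = line_primitive 1 ?b t / c" for t
    by (simp add: line_primitive_def)
  show ?thesis
  proof (rule that[of "\<lambda>t. ?b t / c"])
    have "?b t / c = 0" if "t \<le> q - r \<or> q + r \<le> t" for t
      using bump_eq_0[OF assms, of t q k] that by (auto simp: dist_real_def)
    moreover have "line_primitive 1 (\<lambda>t. ?b t / c) (q + r) - line_primitive 1 (\<lambda>t. ?b t / c) (q - r) = 1"
      unfolding lp using c by (simp add: c_def diff_divide_distrib[symmetric])
    moreover have "C_on k UNIV (\<lambda>t. ?b t / c)"
      using c by (intro C_on_divide C_on_bump C_on_const open_UNIV) simp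
    ultimately show "unit_mass k (q - r) (q + r) (\<lambda>t. ?b t / c)" unfolding unit_mass_def by blast
    show "\<forall>t. 0 \<le> ?b t / c" using c by (simp add: bump_nonneg)
    show "0 < ?b q / c" using c bump_pos_iff[OF assms, of k q q] assms by simp
  qed
qed

text \<open>
  Here \<open>A\<close> depends only on the coordinates outside \<open>J\<close>, those in \<open>J\<close> having been integrated out. Both
  terms of the difference have the same integral along every line in direction \<open>l\<close>.
\<close>
lemma box_reduction_step:
  fixes U :: "'a::euclidean_space set"
  assumes k: "1 \<le> k" and box: "cbox a c \<inter> frontier U = {}"
    and \<eta>: "\<And>i. i \<in> Basis \<Longrightarrow> unit_mass k (a \<bullet> i) (c \<bullet> i) (\<eta> i)"
    and J: "finite J" "J \<subseteq> Basis" "l \<in> Basis" "l \<notin> J"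
    and A: "C_on k UNIV A" "\<And>x i. i \<in> Basis - J \<Longrightarrow> x \<bullet> i \<notin> {a \<bullet> i..c \<bullet> i} \<Longrightarrow> A x = 0"
      "\<And>x s j. j \<in> J \<Longrightarrow> A (x + s *\<^sub>R j) = A x"
  shows "\<exists>A'. C_on k UNIV A' \<and> (\<forall>x. \<forall>i\<in>Basis - insert l J. x \<bullet> i \<notin> {a \<bullet> i..c \<bullet> i} \<longrightarrow> A' x = 0) \<and>
    (\<forall>x s. \<forall>j\<in>insert l J. A' (x + s *\<^sub>R j) = A' x) \<and>
    directional k U (\<lambda>x. A x * (\<Prod>j\<in>J. \<eta> j (x \<bullet> j)) - A' x * (\<Prod>j\<in>insert l J. \<eta> j (x \<bullet> j)))"
proof -
  have l1: "norm l = 1" and ll: "l \<bullet> l = 1" using J(3) by simp_all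
  have jl: "l \<bullet> j = 0" "j \<bullet> l = 0" if "j \<in> J" for j
    using inner_not_same_Basis[of l j] inner_not_same_Basis[of j l] J that by auto
  define H where "H = line_primitive l A"
  have CH: "C_on k UNIV H" unfolding H_def by (rule C_on_line_primitive[OF A(1)])
  have contA: "continuous_on UNIV A" using C_on_imp_continuous_on[OF A(1)] .
  \<comment> \<open>Slides x along l to l-coordinate v. Differences of H at two such points are
    integrals over a segment that does not depend on the l-coordinate of x.\<close>
  define \<sigma> where "\<sigma> = (\<lambda>v x. x + (v - x \<bullet> l) *\<^sub>R l)"
  have \<sigma>l: "\<sigma> v x \<bullet> l = v" for v x by (simp add: \<sigma>_def inner_add_left ll)
  have \<sigma>i: "\<sigma> v x \<bullet> i = x \<bullet> i" if "i \<in> Basis" "i \<noteq> l" for v x i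
    using inner_not_same_Basis[of l i] that J(3) by (simp add: \<sigma>_def inner_add_left)
  have \<sigma>_line: "\<sigma> v (x + s *\<^sub>R l) = \<sigma> v x" for v x s
    by (simp add: \<sigma>_def inner_add_left ll algebra_simps)
  have \<sigma>J: "\<sigma> v (x + s *\<^sub>R j) = \<sigma> v x + s *\<^sub>R j" if "j \<in> J" for v x s j
    using jl[OF that] by (simp add: \<sigma>_def inner_add_left algebra_simps)
  have C\<sigma>: "C_on k UNIV (\<sigma> v)" for v unfolding \<sigma>_def
    by (intro C_on_add C_on_scaleR C_on_diff C_on_inner C_on_id C_on_const open_UNIV)
  have HJ: "H (x + s *\<^sub>R j) = H x" if j: "j \<in> J" for x s j
  proof -
    have "A (x + s *\<^sub>R j + v *\<^sub>R l) = A (x + v *\<^sub>R l)" for v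
      using A(3)[OF j, of "x + v *\<^sub>R l" s] by (simp add: add.commute add.left_commute)
    then show ?thesis unfolding H_def line_primitive_def by (simp add: inner_add_left jl[OF j])
  qed
  have Hi: "H x = 0" if i: "i \<in> Basis - insert l J" "x \<bullet> i \<notin> {a \<bullet> i..c \<bullet> i}" for x i
    unfolding H_def
  proof (rule line_primitive_eq_0)
    fix s
    have "l \<bullet> i = 0" using inner_not_same_Basis[of l i] i(1) J(3) by auto
    then show "A (x + s *\<^sub>R l) = 0" using A(2)[of i "x + s *\<^sub>R l"] i by (simp add: inner_add_left)
  qed
  have H_eq: "H (\<sigma> u x) = H (\<sigma> v x)"
    if "u \<le> v" "v \<le> a \<bullet> l \<or> c \<bullet> l \<le> u" for u v x
  proof -
    have "A (x + s *\<^sub>R l) = 0" if s: "u - x \<bullet> l < s" "s < v - x \<bullet> l" for s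
    proof (rule A(2)[of l])
      show "l \<in> Basis - J" using J by simp
      show "(x + s *\<^sub>R l) \<bullet> l \<notin> {a \<bullet> l..c \<bullet> l}"
        using s \<open>v \<le> a \<bullet> l \<or> c \<bullet> l \<le> u\<close> by (auto simp: inner_add_left ll)
    qed
    then show ?thesis unfolding H_def \<sigma>_def using that(1)
      by (intro line_primitive_const[OF contA l1]) auto
  qed
  have \<sigma>_self: "\<sigma> (x \<bullet> l) x = x" for x by (simp add: \<sigma>_def)
  \<comment> \<open>The integral of A over the entire l-line through x, since A vanishes beyond the
    two faces of the box.\<close>
  define A' where "A' = (\<lambda>x. H (\<sigma> (c \<bullet> l) x) - H (\<sigma> (a \<bullet> l) x))"
  have CA': "C_on k UNIV A'" unfolding A'_def
    by (intro C_on_diff open_UNIV C_on_compose[OF open_UNIV open_UNIV CH C\<sigma>]) auto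
  have A'i: "A' x = 0" if "i \<in> Basis - insert l J" "x \<bullet> i \<notin> {a \<bullet> i..c \<bullet> i}" for x i
    unfolding A'_def using Hi[OF that(1)] \<sigma>i that by simp
  have A'J: "A' (x + s *\<^sub>R j) = A' x" if "j \<in> insert l J" for x s j
    unfolding A'_def using \<sigma>_line \<sigma>J HJ that by (cases "j = l") simp_all
  define E where "E = (\<lambda>t. line_primitive 1 (\<eta> l) t - line_primitive 1 (\<eta> l) (a \<bullet> l))"
  have \<eta>l: "C_on k UNIV (\<eta> l)" "\<And>t. t \<le> a \<bullet> l \<or> c \<bullet> l \<le> t \<Longrightarrow> \<eta> l t = 0" and E1: "E (c \<bullet> l) = 1"
    using \<eta>[OF J(3)] unfolding unit_mass_def E_def by auto
  have CE: "C_on k UNIV E" unfolding E_def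
    by (intro C_on_diff C_on_const C_on_line_primitive open_UNIV \<eta>l(1))
  have cont\<eta>l: "continuous_on UNIV (\<eta> l)" using C_on_imp_continuous_on[OF \<eta>l(1)] .
  have E_low: "E t = 0" if "t \<le> a \<bullet> l" for t
    using line_primitive_const[OF cont\<eta>l, of 1 t "a \<bullet> l" 0] \<eta>l(2) that by (simp add: E_def)
  have E_high: "E t = 1" if "c \<bullet> l \<le> t" for t
    using line_primitive_const[OF cont\<eta>l, of 1 "c \<bullet> l" t 0] \<eta>l(2) that E1 by (simp add: E_def)
  have dE: "(E has_real_derivative \<eta> l t) (at t)" for t
    using line_primitive_has_derivative_line[OF cont\<eta>l, of 1 0 t] unfolding E_def
    by (auto intro!: derivative_eq_intros)
  define Q where "Q = (\<lambda>x. \<Prod>j\<in>J. \<eta> j (x \<bullet> j))"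
  have C\<eta>: "C_on k UNIV (\<lambda>x::'a. \<eta> j (x \<bullet> j))" if "j \<in> Basis" for j
    using \<eta>[OF that] unfolding unit_mass_def
    by (intro C_on_compose[OF open_UNIV open_UNIV _ C_on_inner]) auto
  have CQ: "C_on k UNIV Q" unfolding Q_def using J(2) by (intro C_on_prod open_UNIV C\<eta>) auto
  have Q_line: "Q (x + s *\<^sub>R l) = Q x" for x s
    unfolding Q_def by (rule prod.cong) (simp_all add: inner_add_left jl)
  \<comment> \<open>The primitive along l of the difference, started at the lower face. Above the
    upper face E = 1 and the two line integrals cancel, so m is supported in the box.\<close>
  define m where "m = (\<lambda>x. ((H x - H (\<sigma> (a \<bullet> l) x)) - A' x * E (x \<bullet> l)) * Q x)"
  have Cm: "C_on k UNIV m" unfolding m_def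
    by (intro C_on_mult C_on_diff open_UNIV CH CQ CA' C_on_compose[OF open_UNIV open_UNIV CH C\<sigma>]
        C_on_compose[OF open_UNIV open_UNIV CE C_on_inner] C_on_id) auto
  have m0: "m x = 0" if out: "x \<notin> cbox a c" for x
  proof -
    obtain i where i: "i \<in> Basis" "x \<bullet> i \<notin> {a \<bullet> i..c \<bullet> i}" using out by (auto simp: mem_box)
    consider "i \<in> J" | "i = l" | "i \<in> Basis - insert l J" using i(1) by blast
    then show ?thesis
    proof cases
      case 1
      have "\<eta> i (x \<bullet> i) = 0" using \<eta>[OF i(1)] i(2) unfolding unit_mass_def by auto
      then have "Q x = 0" unfolding Q_def using J(1) 1 by (simp add: prod_zero_iff) blast
      then show ?thesis by (simp add: m_def)
    next
      case 2
      show ?thesis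
      proof (cases "x \<bullet> l < a \<bullet> l")
        case True
        then have "H x = H (\<sigma> (a \<bullet> l) x)" using H_eq[of "x \<bullet> l" "a \<bullet> l" x] \<sigma>_self by simp
        then show ?thesis using E_low[of "x \<bullet> l"] True by (simp add: m_def)
      next
        case False
        then have "c \<bullet> l < x \<bullet> l" using i(2) 2 by auto
        then have "H x = H (\<sigma> (c \<bullet> l) x)" "E (x \<bullet> l) = 1"
          using H_eq[of "c \<bullet> l" "x \<bullet> l" x] \<sigma>_self E_high by simp_all
        then show ?thesis by (simp add: m_def A'_def)
      qed
    next
      case 3
      then show ?thesis using Hi[OF 3] A'i[OF 3] \<sigma>i i by (simp add: m_def)
    qed
  qed
  have dm: "frechet_derivative m (at x) l = A x * Q x - A' x * (\<eta> l (x \<bullet> l) * Q x)" for x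
  proof (rule frechet_derivative_along_line)
    show "m differentiable (at x)" by (rule C_on_differentiable[OF Cm k UNIV_I])
    have m_line: "m (x + t *\<^sub>R l) = ((H (x + t *\<^sub>R l) - H (\<sigma> (a \<bullet> l) x)) - A' x * E (x \<bullet> l + t)) * Q x" for t
      unfolding m_def \<sigma>_line Q_line A'J[OF insertI1] by (simp add: inner_add_left ll)
    have 1: "((\<lambda>t. H (x + t *\<^sub>R l)) has_real_derivative A x) (at 0)"
      using line_primitive_has_derivative_line[OF contA l1, of x 0] unfolding H_def by simp
    have 2: "((\<lambda>t. E (x \<bullet> l + t)) has_real_derivative \<eta> l (x \<bullet> l)) (at 0)"
    proof -
      have "((\<lambda>t. x \<bullet> l + t) has_real_derivative 1) (at 0)" by (auto intro!: derivative_eq_intros)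
      from DERIV_chain2[where f=E and g="\<lambda>t. x \<bullet> l + t" and x=0, OF _ this] dE[of "x \<bullet> l"]
      show ?thesis by simp
    qed
    have "((\<lambda>t. ((H (x + t *\<^sub>R l) - H (\<sigma> (a \<bullet> l) x)) - A' x * E (x \<bullet> l + t)) * Q x)
        has_real_derivative ((A x - 0) - A' x * \<eta> l (x \<bullet> l)) * Q x) (at 0)"
      by (intro DERIV_cmult_right DERIV_diff DERIV_cmult DERIV_const 1 2)
    then show "((\<lambda>t. m (x + t *\<^sub>R l)) has_real_derivative A x * Q x - A' x * (\<eta> l (x \<bullet> l) * Q x)) (at 0)"
      unfolding m_line by (simp add: algebra_simps)
  qed
  have Q': "(\<Prod>j\<in>insert l J. \<eta> j (x \<bullet> j)) = \<eta> l (x \<bullet> l) * Q x" for x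
    unfolding Q_def using J by simp
  have "directional k U (\<lambda>x. A x * Q x - A' x * (\<eta> l (x \<bullet> l) * Q x))"
    unfolding directional_def
  proof (intro conjI bexI[of _ l] exI[of _ m] ballI allI)
    show "C_on k UNIV (\<lambda>x. A x * Q x - A' x * (\<eta> l (x \<bullet> l) * Q x))"
      by (intro C_on_diff C_on_mult open_UNIV A(1) CQ CA' C\<eta>[OF J(3)])
    show "bounded {x. m x \<noteq> 0}"
      by (rule bounded_subset[OF bounded_cbox[of a c]]) (use m0 in blast)
    show "m x = 0" if "x \<in> frontier U" for x using m0 box that by blast
  qed (use Cm dm J in auto)
  then have "directional k U (\<lambda>x. A x * (\<Prod>j\<in>J. \<eta> j (x \<bullet> j)) - A' x * (\<Prod>j\<in>insert l J. \<eta> j (x \<bullet> j)))"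
    unfolding Q' unfolding Q_def .
  then show ?thesis using CA' A'i A'J by blast
qed

text \<open>Once all basis coordinates are integrated out, the coefficient is invariant under
  translation in every basis direction, hence constant.\<close>

lemma box_reduction:
  fixes U :: "'a::euclidean_space set"
  assumes k: "1 \<le> k" and box: "cbox a c \<inter> frontier U = {}"
    and \<eta>: "\<And>i. i \<in> Basis \<Longrightarrow> unit_mass k (a \<bullet> i) (c \<bullet> i) (\<eta> i)"
    and h: "C_on k UNIV h" "\<And>x. x \<notin> cbox a c \<Longrightarrow> h x = 0"
  shows "\<exists>C. directional_sum k U (\<lambda>x. h x - C * (\<Prod>i\<in>Basis. \<eta> i (x \<bullet> i)))"
proof -
  have "\<exists>A. C_on k UNIV A \<and> (\<forall>x. \<forall>i\<in>Basis - J. x \<bullet> i \<notin> {a \<bullet> i..c \<bullet> i} \<longrightarrow> A x = 0) \<and>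
      (\<forall>x s. \<forall>j\<in>J. A (x + s *\<^sub>R j) = A x) \<and>
      directional_sum k U (\<lambda>x. h x - A x * (\<Prod>j\<in>J. \<eta> j (x \<bullet> j)))"
    if "finite J" "J \<subseteq> Basis" for J
    using that
  proof induction
    case empty
    have "h x = 0" if "i \<in> Basis" "x \<bullet> i \<notin> {a \<bullet> i..c \<bullet> i}" for x i
      using h(2)[of x] that by (auto simp: mem_box)
    then show ?case using h(1) by (intro exI[of _ h]) (auto simp: directional_sum_zero)
  next
    case (insert l J)
    obtain A where A: "C_on k UNIV A" "\<forall>x. \<forall>i\<in>Basis - J. x \<bullet> i \<notin> {a \<bullet> i..c \<bullet> i} \<longrightarrow> A x = 0"
      "\<forall>x s. \<forall>j\<in>J. A (x + s *\<^sub>R j) = A x"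
      "directional_sum k U (\<lambda>x. h x - A x * (\<Prod>j\<in>J. \<eta> j (x \<bullet> j)))"
      using insert by auto
    have "\<exists>A'. C_on k UNIV A' \<and> (\<forall>x. \<forall>i\<in>Basis - insert l J. x \<bullet> i \<notin> {a \<bullet> i..c \<bullet> i} \<longrightarrow> A' x = 0) \<and>
      (\<forall>x s. \<forall>j\<in>insert l J. A' (x + s *\<^sub>R j) = A' x) \<and>
      directional k U (\<lambda>x. A x * (\<Prod>j\<in>J. \<eta> j (x \<bullet> j)) - A' x * (\<Prod>j\<in>insert l J. \<eta> j (x \<bullet> j)))"
      by (rule box_reduction_step[OF k box \<eta> insert(1) _ _ insert(2) A(1)]) (use insert(4) A(2,3) in auto)
    then obtain A' where A': "C_on k UNIV A'" "\<forall>x. \<forall>i\<in>Basis - insert l J. x \<bullet> i \<notin> {a \<bullet> i..c \<bullet> i} \<longrightarrow> A' x = 0"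
      "\<forall>x s. \<forall>j\<in>insert l J. A' (x + s *\<^sub>R j) = A' x"
      "directional k U (\<lambda>x. A x * (\<Prod>j\<in>J. \<eta> j (x \<bullet> j)) - A' x * (\<Prod>j\<in>insert l J. \<eta> j (x \<bullet> j)))"
      by blast
    have "directional_sum k U (\<lambda>x. h x - A' x * (\<Prod>j\<in>insert l J. \<eta> j (x \<bullet> j)))"
      using directional_sum_add_directional[OF A(4) A'(4)] by simp
    then show ?case using A'(1-3) by blast
  qed
  from this[OF finite_Basis subset_refl] obtain A where A: "\<forall>x s. \<forall>j\<in>Basis. A (x + s *\<^sub>R j) = A x"
    "directional_sum k U (\<lambda>x. h x - A x * (\<Prod>j\<in>Basis. \<eta> j (x \<bullet> j)))"
    by blast
  have A0: "A x = A 0" for x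
  proof -
    have "A (\<Sum>j\<in>J. (x \<bullet> j) *\<^sub>R j) = A 0" if "finite J" "J \<subseteq> Basis" for J
      using that by induction (simp_all add: A(1) add.commute[of "(x \<bullet> _) *\<^sub>R _"])
    from this[OF finite_Basis subset_refl] show ?thesis by (simp only: euclidean_representation)
  qed
  have "(\<lambda>x. h x - A x * (\<Prod>j\<in>Basis. \<eta> j (x \<bullet> j))) = (\<lambda>x. h x - A 0 * (\<Prod>j\<in>Basis. \<eta> j (x \<bullet> j)))"
  proof
    fix x
    show "h x - A x * (\<Prod>j\<in>Basis. \<eta> j (x \<bullet> j)) = h x - A 0 * (\<Prod>j\<in>Basis. \<eta> j (x \<bullet> j))"
      by (simp only: A0[of x])
  qed
  then have "directional_sum k U (\<lambda>x. h x - A 0 * (\<Prod>j\<in>Basis. \<eta> j (x \<bullet> j)))"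
    using A(2) by (simp only:)
  then show ?thesis by blast
qed

section \<open>Solving in the interior\<close>

definition cube :: "'a::euclidean_space \<Rightarrow> real \<Rightarrow> 'a set" where
  "cube x r = cbox (x - r *\<^sub>R One) (x + r *\<^sub>R One)"

lemma mem_cube: "y \<in> cube x r \<longleftrightarrow> (\<forall>i\<in>Basis. \<bar>(y - x) \<bullet> i\<bar> \<le> r)"
  unfolding cube_def mem_box by (auto simp: inner_diff_left inner_add_left abs_le_iff)

lemma ball_subset_cube: "ball x r \<subseteq> cube x r"
proof
  fix y assume "y \<in> ball x r"
  then have "norm (y - x) \<le> r" by (simp add: dist_norm norm_minus_commute)
  then show "y \<in> cube x r" unfolding mem_cube using Basis_le_norm order_trans by blast
qed

lemma open_contains_cube:
  fixes x :: "'a::euclidean_space"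
  assumes "open S" "x \<in> S"
  obtains r where "0 < r" "cube x r \<subseteq> S"
proof -
  obtain \<epsilon> where \<epsilon>: "0 < \<epsilon>" "cball x \<epsilon> \<subseteq> S" using assms open_contains_cball by metis
  show ?thesis
  \<comment> \<open>The norm is at most the sum of the absolute values of the DIM('a)
    coordinates.\<close>
  proof (rule that[of "\<epsilon> / DIM('a)"])
    show "0 < \<epsilon> / DIM('a)" using \<epsilon>(1) by simp
    show "cube x (\<epsilon> / DIM('a)) \<subseteq> S"
    proof
      fix y assume "y \<in> cube x (\<epsilon> / DIM('a))"
      then have "(\<Sum>i\<in>Basis. \<bar>(y - x) \<bullet> i\<bar>) \<le> (\<Sum>i\<in>(Basis::'a set). \<epsilon> / DIM('a))"
        unfolding mem_cube by (intro sum_mono) blast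
      then have "norm (y - x) \<le> \<epsilon>" using norm_le_l1[of "y - x"] by simp
      then show "y \<in> S" using \<epsilon>(2) by (auto simp: dist_norm norm_minus_commute)
    qed
  qed
qed

lemma cube_unit_masses:
  fixes x :: "'a::euclidean_space"
  assumes "0 < r"
  obtains \<eta> where "\<forall>i\<in>Basis. unit_mass k (x \<bullet> i - r) (x \<bullet> i + r) (\<eta> i)"
    "\<forall>y. 0 \<le> (\<Prod>i\<in>Basis. \<eta> i (y \<bullet> i))" "0 < (\<Prod>i\<in>Basis. \<eta> i (x \<bullet> i))"
proof -
  have "\<forall>q. \<exists>\<eta>. unit_mass k (q - r) (q + r) \<eta> \<and> (\<forall>t. 0 \<le> \<eta> t) \<and> 0 < \<eta> q"
    using unit_mass_bump[OF assms] by metis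
  then obtain E where E: "\<And>q. unit_mass k (q - r) (q + r) (E q)" "\<And>q t. 0 \<le> E q t" "\<And>q. 0 < E q q"
    by metis
  show ?thesis
    by (rule that[of "\<lambda>i. E (x \<bullet> i)"]) (auto intro!: prod_nonneg prod_pos E)
qed

lemma unit_masses_product:
  fixes x :: "'a::euclidean_space"
  assumes "\<forall>i\<in>Basis. unit_mass k (x \<bullet> i - r) (x \<bullet> i + r) (\<eta> i)"
  shows "C_on k UNIV (\<lambda>y. \<Prod>i\<in>Basis. \<eta> i (y \<bullet> i))"
    and "y \<notin> cube x r \<Longrightarrow> (\<Prod>i\<in>Basis. \<eta> i (y \<bullet> i)) = 0"
proof -
  have "C_on k UNIV (\<lambda>y::'a. \<eta> i (y \<bullet> i))" if "i \<in> Basis" for i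
    using assms that unfolding unit_mass_def
    by (intro C_on_compose[OF open_UNIV open_UNIV _ C_on_inner]) auto
  then show "C_on k UNIV (\<lambda>y::'a. \<Prod>i\<in>Basis. \<eta> i (y \<bullet> i))" by (intro C_on_prod open_UNIV)
  assume "y \<notin> cube x r"
  then obtain i where i: "i \<in> Basis" "r < \<bar>(y - x) \<bullet> i\<bar>" unfolding mem_cube by force
  then have "y \<bullet> i \<le> x \<bullet> i - r \<or> x \<bullet> i + r \<le> y \<bullet> i" by (auto simp: inner_diff_left)
  then have "\<eta> i (y \<bullet> i) = 0" using assms i(1) unfolding unit_mass_def by blast
  then show "(\<Prod>i\<in>Basis. \<eta> i (y \<bullet> i)) = 0" using i(1) by (intro prod_zero) auto
qed

text \<open>Mass spread over a large cube in U can be concentrated in a smaller one, because unit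
  masses for the sides of the small cube are also unit masses for those of the large one.\<close>

lemma cube_reduction:
  fixes U :: "'a::euclidean_space set"
  assumes k: "1 \<le> k" and U: "open U" "cube a R \<subseteq> U" and sub: "cube x r \<subseteq> cube a R" "0 < r"
    and \<eta>: "\<forall>i\<in>Basis. unit_mass k (x \<bullet> i - r) (x \<bullet> i + r) (\<eta> i)"
    and h: "C_on k UNIV h" "\<And>y. y \<notin> cube a R \<Longrightarrow> h y = 0"
  shows "\<exists>C. directional_sum k U (\<lambda>y. h y - C * (\<Prod>i\<in>Basis. \<eta> i (y \<bullet> i)))"
proof -
  have "x - r *\<^sub>R One \<in> cube x r" "x + r *\<^sub>R One \<in> cube x r"
    unfolding mem_cube using sub(2) by simp_all
  then have "x - r *\<^sub>R One \<in> cube a R" "x + r *\<^sub>R One \<in> cube a R" using sub(1) by blast+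
  then have b: "a \<bullet> i - R \<le> x \<bullet> i - r" "x \<bullet> i + r \<le> a \<bullet> i + R" if "i \<in> Basis" for i
    unfolding cube_def mem_box using that by (auto simp: inner_diff_left inner_add_left)
  show ?thesis
  proof (rule box_reduction[OF k])
    show "cbox (a - R *\<^sub>R One) (a + R *\<^sub>R One) \<inter> frontier U = {}"
      using U unfolding cube_def frontier_def by (auto simp: interior_open)
    fix i :: 'a assume i: "i \<in> Basis"
    have "unit_mass k (a \<bullet> i - R) (a \<bullet> i + R) (\<eta> i)"
      using unit_mass_mono \<eta> b i by blast
    then show "unit_mass k ((a - R *\<^sub>R One) \<bullet> i) ((a + R *\<^sub>R One) \<bullet> i) (\<eta> i)"
      using i by (simp add: inner_diff_left inner_add_left)
  qed (use h in \<open>simp_all add: cube_def\<close>)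
qed

text \<open>Modulo directional terms, mass near any point of U can be moved to the fixed bump
  \<open>w\<close> around x0. The property passes between points of a common ball inside a cube in
  U, and connectedness spreads it from x0 to all of U.\<close>

lemma interior_reduction_local:
  fixes U :: "'a::euclidean_space set"
  assumes k: "1 \<le> k" and U: "open U" "connected U" and x0: "x0 \<in> U"
  obtains w K where "C_on k UNIV w" "\<forall>x. 0 \<le> w x" "0 < w x0" "compact K" "K \<subseteq> U" "\<forall>x. x \<notin> K \<longrightarrow> w x = 0"
    "\<forall>x\<in>U. \<exists>r>0. \<forall>h. C_on k UNIV h \<longrightarrow> (\<forall>y. y \<notin> ball x r \<longrightarrow> h y = 0) \<longrightarrow>
      (\<exists>c. directional_sum k U (\<lambda>y. h y - c * w y))"
proof -
  obtain R0 where R0: "0 < R0" "cube x0 R0 \<subseteq> U" using open_contains_cube[OF U(1) x0] .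
  obtain \<eta>0 where \<eta>0: "\<forall>i\<in>Basis. unit_mass k (x0 \<bullet> i - R0) (x0 \<bullet> i + R0) (\<eta>0 i)"
    "\<forall>y. 0 \<le> (\<Prod>i\<in>Basis. \<eta>0 i (y \<bullet> i))" "0 < (\<Prod>i\<in>Basis. \<eta>0 i (x0 \<bullet> i))"
    using cube_unit_masses[OF R0(1)] .
  define w where "w = (\<lambda>y::'a. \<Prod>i\<in>Basis. \<eta>0 i (y \<bullet> i))"
  define G where "G = (\<lambda>x. \<exists>r>0. \<forall>h. C_on k UNIV h \<longrightarrow> (\<forall>y. y \<notin> ball x r \<longrightarrow> h y = 0) \<longrightarrow>
      (\<exists>c. directional_sum k U (\<lambda>y. h y - c * w y)))"
  have G0: "G x0" unfolding G_def
  proof (rule exI[of _ R0], intro conjI R0(1) allI impI)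
    fix h assume h: "C_on k UNIV h" "\<forall>y. y \<notin> ball x0 R0 \<longrightarrow> h y = (0::real)"
    show "\<exists>c. directional_sum k U (\<lambda>y. h y - c * w y)"
      unfolding w_def
      by (rule cube_reduction[OF k U(1) R0(2) subset_refl R0(1) \<eta>0(1) h(1)])
        (use h(2) ball_subset_cube in blast)
  qed
  have G: "G b" if b: "b \<in> U" for b
  proof (rule connected_induction_simple[where P=G and a=x0 and b=b, OF U(2)])
    fix a assume a: "a \<in> U"
    obtain R where R: "0 < R" "cube a R \<subseteq> U" using open_contains_cube[OF U(1) a] .
    have BU: "ball a R \<subseteq> U" using ball_subset_cube R(2) by blast
    have step: "G y" if x: "x \<in> ball a R" and y: "y \<in> ball a R" and Gx: "G x" for x y
    proof -
      obtain r where r: "0 < r" "\<And>h. C_on k UNIV h \<Longrightarrow> (\<forall>y. y \<notin> ball x r \<longrightarrow> h y = 0) \<Longrightarrow>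
          (\<exists>c. directional_sum k U (\<lambda>y. h y - c * w y))"
        using Gx unfolding G_def by blast
      \<comment> \<open>A transit cube: it lies in \<open>ball a R\<close>, so mass near y can be
        moved into it, and in \<open>ball x r\<close>, so \<open>G x\<close> moves its contents on
        to \<open>w\<close>.\<close>
      obtain \<delta> where \<delta>: "0 < \<delta>" "cube x \<delta> \<subseteq> ball x r \<inter> ball a R"
        using open_contains_cube[of "ball x r \<inter> ball a R" x] x r(1) by auto
      obtain \<eta> where \<eta>: "\<forall>i\<in>Basis. unit_mass k (x \<bullet> i - \<delta>) (x \<bullet> i + \<delta>) (\<eta> i)"
        using cube_unit_masses[OF \<delta>(1)] .
      let ?w = "\<lambda>y::'a. \<Prod>i\<in>Basis. \<eta> i (y \<bullet> i)"
      have "\<exists>c. directional_sum k U (\<lambda>y. ?w y - c * w y)"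
        by (rule r(2)[OF unit_masses_product(1)[OF \<eta>]]) (use unit_masses_product(2)[OF \<eta>] \<delta>(2) in blast)
      then obtain c where c: "directional_sum k U (\<lambda>y. ?w y - c * w y)" by blast
      obtain r' where r': "0 < r'" "ball y r' \<subseteq> ball a R" using y open_contains_ball open_ball by metis
      show "G y" unfolding G_def
      proof (rule exI[of _ r'], intro conjI r'(1) allI impI)
        fix h assume h: "C_on k UNIV h" "\<forall>z. z \<notin> ball y r' \<longrightarrow> h z = (0::real)"
        have "\<exists>C. directional_sum k U (\<lambda>z. h z - C * ?w z)"
          by (rule cube_reduction[OF k U(1) R(2) _ \<delta>(1) \<eta> h(1)])
            (use \<delta>(2) ball_subset_cube[of a R] r'(2) h(2) in blast)+
        then obtain C where C: "directional_sum k U (\<lambda>z. h z - C * ?w z)" by blast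
        have "directional_sum k U (\<lambda>z. (h z - C * ?w z) + C * (?w z - c * w z))"
          by (rule directional_sum_add[OF C directional_sum_scale[OF c k]])
        then have "directional_sum k U (\<lambda>z. h z - (C * c) * w z)" by (simp add: algebra_simps)
        then show "\<exists>c. directional_sum k U (\<lambda>z. h z - c * w z)" by blast
      qed
    qed
    show "\<exists>T. openin (top_of_set U) T \<and> a \<in> T \<and> (\<forall>x\<in>T. \<forall>y\<in>T. G x \<longrightarrow> G y)"
    proof (rule exI[of _ "ball a R"], intro conjI ballI impI)
      show "openin (top_of_set U) (ball a R)" by (rule open_subset[OF BU open_ball])
      show "a \<in> ball a R" using R(1) by simp
      show "G y" if "x \<in> ball a R" "y \<in> ball a R" "G x" for x y by (rule step[OF that])
    qed
  qed (use G0 x0 b in auto)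
  show ?thesis
  proof (rule that[of w "cube x0 R0"])
    show "C_on k UNIV w" unfolding w_def by (rule unit_masses_product(1)[OF \<eta>0(1)])
    show "\<forall>x. 0 \<le> w x" "0 < w x0" using \<eta>0(2,3) by (simp_all add: w_def)
    show "compact (cube x0 R0)" by (simp add: cube_def compact_cbox)
    show "\<forall>x. x \<notin> cube x0 R0 \<longrightarrow> w x = 0" unfolding w_def using unit_masses_product(2)[OF \<eta>0(1)] by blast
  qed (use R0 G in \<open>simp_all add: G_def\<close>)
qed

text \<open>K has to carry f inside U only; for bounded U, taking the closure of U as K covers every
  continuous f.\<close>

lemma set_integrable_continuous:
  fixes f :: "'a::euclidean_space \<Rightarrow> real"
  assumes U: "open U" and f: "continuous_on UNIV f" and K: "compact K" "\<And>x. x \<in> U - K \<Longrightarrow> f x = 0"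
  shows "set_integrable lebesgue U f"
proof -
  let ?w = "\<lambda>x. indicator U x * f x"
  have "compact (f ` K)" using K f continuous_on_subset compact_continuous_image by blast
  then obtain C where C: "\<And>x. x \<in> K \<Longrightarrow> \<bar>f x\<bar> \<le> C"
    using compact_imp_bounded[of "f ` K"] unfolding bounded_iff by auto
  obtain B where "\<forall>x\<in>K. norm x \<le> B" using compact_imp_bounded[OF K(1)] unfolding bounded_iff by blast
  then have B: "K \<subseteq> cball 0 B" by auto
  have wb: "?w \<in> borel_measurable borel"
    using U borel_measurable_continuous_onI[OF f] by simp
  have "integrable lborel ?w"
  proof (rule integrable_compact_support[OF wb])
    show "\<bar>?w x\<bar> \<le> max 0 C" for x
      using C[of x] K(2)[of x] by (cases "x \<in> K"; cases "x \<in> U") auto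
    show "?w x = 0" if "x \<notin> cball 0 B" for x
    proof -
      have "x \<notin> K" using B that by blast
      then show ?thesis using K(2)[of x] by (cases "x \<in> U") auto
    qed
  qed
  then show ?thesis unfolding set_integrable_def using wb by (simp add: integrable_completion)
qed

lemma directional_sum_integral_zero:
  fixes U :: "'a::euclidean_space set"
  assumes k: "1 \<le> k" and U: "open U" and neg: "negligible (frontier U)" and h: "directional_sum k U h"
  shows "set_integrable lebesgue U h \<and> (LINT y:U|lebesgue. h y) = 0"
  using h
proof induction
  case directional_sum_zero
  show ?case by (simp add: set_integrable_def set_lebesgue_integral_def)
next
  case (directional_sum_add_directional h h')
  obtain K where K: "compact K" "\<And>x. x \<notin> K \<Longrightarrow> h' x = 0"
    using directional_support[OF directional_sum_add_directional.hyps(2)] by blast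
  have "C_on k UNIV h'" using directional_sum_add_directional.hyps(2) unfolding directional_def by blast
  then have "set_integrable lebesgue U h'"
    using set_integrable_continuous[OF U C_on_imp_continuous_on K(1)] K(2) by blast
  moreover have "(LINT y:U|lebesgue. h' y) = 0"
    by (rule directional_integral_zero[OF k U neg directional_sum_add_directional.hyps(2)])
  ultimately show ?case using directional_sum_add_directional.IH by (simp add: set_integral_add)
qed

lemma set_integral_pos:
  fixes f :: "'a::euclidean_space \<Rightarrow> real"
  assumes U: "open U" "x0 \<in> U" and f: "continuous_on UNIV f" "set_integrable lebesgue U f"
    and "\<And>x. 0 \<le> f x" "0 < f x0"
  shows "0 < (LINT y:U|lebesgue. f y)"
proof -
  define \<epsilon> where "\<epsilon> = f x0 / 2"
  have \<epsilon>: "0 < \<epsilon>" using assms(6) by (simp add: \<epsilon>_def)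
  have "open (U \<inter> f -` {\<epsilon><..})"
    using continuous_open_preimage[OF continuous_on_subset[OF f(1) subset_UNIV] U(1) open_greaterThan] .
  moreover have "x0 \<in> U \<inter> f -` {\<epsilon><..}" using U(2) assms(6) by (simp add: \<epsilon>_def)
  ultimately obtain r where r: "0 < r" "ball x0 r \<subseteq> U \<inter> f -` {\<epsilon><..}"
    using open_contains_ball by metis
  have fin: "emeasure lborel (ball x0 r) < \<infinity>" by (rule emeasure_bounded_finite) simp
  have mb: "(\<lambda>x. \<epsilon> * indicator (ball x0 r) x) \<in> borel_measurable lborel"
    by (intro borel_measurable_times borel_measurable_const borel_measurable_indicator) simp
  have "0 < \<epsilon> * measure lborel (ball x0 r)" using \<epsilon> content_ball_pos[OF r(1)] by simp
  also have "\<dots> = (LINT x|lebesgue. \<epsilon> * indicator (ball x0 r) x)"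
    unfolding integral_completion[OF mb] by simp
  also have "\<dots> \<le> (LINT x|lebesgue. indicator U x *\<^sub>R f x)"
  proof (rule integral_mono)
    show "integrable lebesgue (\<lambda>x. \<epsilon> * indicator (ball x0 r) x)"
      unfolding integrable_completion[OF mb] using fin by simp
    show "integrable lebesgue (\<lambda>x. indicator U x *\<^sub>R f x)" using f(2) unfolding set_integrable_def .
    show "\<epsilon> * indicator (ball x0 r) x \<le> indicator U x *\<^sub>R f x" for x
    proof (cases "x \<in> ball x0 r")
      case True
      then have "x \<in> U" "\<epsilon> < f x" using r(2) by auto
      then show ?thesis using True by simp
    qed (simp add: assms(5) indicator_def)
  qed
  finally show ?thesis unfolding set_lebesgue_integral_def .
qed

text \<open>A partition of unity reduces h, modulo directional terms, to a multiple C of the fixed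
  bump w. Those terms and h have integral 0 over U while w has positive integral, so C = 0.\<close>

lemma interior_directional_sum:
  fixes U :: "'a::euclidean_space set"
  assumes k: "1 \<le> k" and U: "open U" "connected U" "negligible (frontier U)"
    and h: "C_on k UNIV h" and K: "compact K" "K \<subseteq> U" "\<And>x. x \<notin> K \<Longrightarrow> h x = 0"
    and int: "(LINT y:U|lebesgue. h y) = 0"
  shows "directional_sum k U h"
proof (cases "U = {}")
  case True
  then have "h = (\<lambda>x. 0)" using K(2,3) by auto
  then show ?thesis by (simp add: directional_sum_zero)
next
  case False
  then obtain x0 where x0: "x0 \<in> U" by blast
  obtain w L where w: "C_on k UNIV w" "\<forall>x. 0 \<le> w x" "0 < w x0" "compact L" "L \<subseteq> U" "\<forall>x. x \<notin> L \<longrightarrow> w x = 0"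
    and red: "\<forall>x\<in>U. \<exists>r>0. \<forall>h. C_on k UNIV h \<longrightarrow> (\<forall>y. y \<notin> ball x r \<longrightarrow> h y = 0) \<longrightarrow>
      (\<exists>c. directional_sum k U (\<lambda>y. h y - c * w y))"
    using interior_reduction_local[OF k U(1,2) x0] .
  obtain r where r: "\<forall>x\<in>U. 0 < r x \<and> (\<forall>h. C_on k UNIV h \<longrightarrow> (\<forall>y. y \<notin> ball x (r x) \<longrightarrow> h y = 0) \<longrightarrow>
      (\<exists>c. directional_sum k U (\<lambda>y. h y - c * w y)))"
    using bchoice[OF red] by blast
  have rpos: "\<And>p. p \<in> K \<Longrightarrow> 0 < r p" using r K(2) by blast
  obtain I and \<omega> :: "'a \<Rightarrow> 'a \<Rightarrow> real" and N where I: "finite I" "I \<subseteq> K" "\<forall>p. C_on k UNIV (\<omega> p)" "\<forall>p x. 0 \<le> \<omega> p x"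
    "\<forall>p\<in>I. \<forall>x. x \<notin> ball p (r p) \<longrightarrow> \<omega> p x = 0" "\<forall>x. (\<Sum>p\<in>I. \<omega> p x) \<le> 1"
    "open N" "K \<subseteq> N" "\<forall>x\<in>N. (\<Sum>p\<in>I. \<omega> p x) = 1"
    using C_partition_of_unity[where k=k, OF K(1) rpos] .
  have "\<exists>c. directional_sum k U (\<lambda>y. \<omega> p y * h y - c * w y)" if p: "p \<in> I" for p
  proof -
    have "C_on k UNIV (\<lambda>y. \<omega> p y * h y)" using I(3) by (intro C_on_mult open_UNIV h) blast
    moreover have "\<forall>y. y \<notin> ball p (r p) \<longrightarrow> \<omega> p y * h y = 0" using I(5) p by simp
    ultimately show ?thesis using r I(2) K(2) p by blast
  qed
  then obtain c where c: "\<And>p. p \<in> I \<Longrightarrow> directional_sum k U (\<lambda>y. \<omega> p y * h y - c p * w y)" by metis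
  define C where "C = sum c I"
  have hs: "h y = (\<Sum>p\<in>I. \<omega> p y * h y)" for y
  proof (cases "y \<in> K")
    case True
    then have "(\<Sum>p\<in>I. \<omega> p y) = 1" using I(8,9) by blast
    then show ?thesis by (simp add: sum_distrib_right[symmetric])
  qed (simp add: K(3))
  have "directional_sum k U (\<lambda>y. \<Sum>p\<in>I. (\<omega> p y * h y - c p * w y))"
    by (rule directional_sum_sum[OF c])
  moreover have "(\<Sum>p\<in>I. (\<omega> p y * h y - c p * w y)) = h y - C * w y" for y
    unfolding sum_subtractf C_def hs[of y, symmetric] by (simp add: sum_distrib_right)
  ultimately have hC: "directional_sum k U (\<lambda>y. h y - C * w y)" by simp
  note cw = C_on_imp_continuous_on[OF w(1)] and ch = C_on_imp_continuous_on[OF h]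
  have iw: "set_integrable lebesgue U w" by (rule set_integrable_continuous[OF U(1) cw w(4)]) (use w(6) in blast)
  have ih: "set_integrable lebesgue U h" by (rule set_integrable_continuous[OF U(1) ch K(1)]) (use K(3) in blast)
  have "(LINT y:U|lebesgue. h y - C * w y) = 0" using directional_sum_integral_zero[OF k U(1,3) hC] by blast
  moreover have "(LINT y:U|lebesgue. h y - C * w y) = 0 - C * (LINT y:U|lebesgue. w y)"
    using ih iw int by (subst set_integral_diff) auto
  moreover have "0 < (LINT y:U|lebesgue. w y)"
    by (rule set_integral_pos[OF U(1) x0 cw iw]) (use w(2,3) in auto)
  ultimately have "C = 0" by simp
  then show ?thesis using hC by simp
qed

section \<open>Conclusion\<close>

text \<open>Each local solution is correct near the entire frontier, so their sum is correct on the
  intersection of finitely many neighbourhoods with the set where the weights add up to 1.\<close>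

lemma boundary_directional_sum:
  fixes U :: "'a::euclidean_space set"
  assumes k: "1 \<le> k" and U: "bounded U" "smooth_boundary U" and d: "C_on k UNIV d"
  obtains b N where "directional_sum k U b" "open N" "frontier U \<subseteq> N" "\<forall>x\<in>N. b x = d x"
proof -
  have comp: "compact (frontier U)" using U(1) by (rule compact_frontier_bounded)
  have "\<forall>p\<in>frontier U. \<exists>r0>0. \<forall>h. C_on k UNIV h \<longrightarrow> (\<forall>x. x \<notin> ball p r0 \<longrightarrow> h x = 0) \<longrightarrow>
    (\<exists>h' N. directional k U h' \<and> open N \<and> frontier U \<subseteq> N \<and> (\<forall>x\<in>N. h' x = h x))"
  proof
    fix p assume p: "p \<in> frontier U"
    obtain S F e where "boundary_chart U p S F e" using smooth_boundary_chart[OF U(2) p] .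
    then show "\<exists>r0>0. \<forall>h. C_on k UNIV h \<longrightarrow> (\<forall>x. x \<notin> ball p r0 \<longrightarrow> h x = 0) \<longrightarrow>
      (\<exists>h' N. directional k U h' \<and> open N \<and> frontier U \<subseteq> N \<and> (\<forall>x\<in>N. h' x = h x))"
      by (rule boundary_directional[OF k _ p])
  qed
  from bchoice[OF this] obtain r where
    r: "\<forall>p\<in>frontier U. 0 < r p \<and> (\<forall>h. C_on k UNIV h \<longrightarrow> (\<forall>x. x \<notin> ball p (r p) \<longrightarrow> h x = 0) \<longrightarrow>
      (\<exists>h' N. directional k U h' \<and> open N \<and> frontier U \<subseteq> N \<and> (\<forall>x\<in>N. h' x = h x)))"
    by blast
  have rpos: "\<And>p. p \<in> frontier U \<Longrightarrow> 0 < r p" using r by blast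
  obtain I and \<omega> :: "'a \<Rightarrow> 'a \<Rightarrow> real" and N1 where I: "finite I" "I \<subseteq> frontier U"
    "\<forall>p. C_on k UNIV (\<omega> p)" "\<forall>p x. 0 \<le> \<omega> p x"
    "\<forall>p\<in>I. \<forall>x. x \<notin> ball p (r p) \<longrightarrow> \<omega> p x = 0" "\<forall>x. (\<Sum>p\<in>I. \<omega> p x) \<le> 1"
    "open N1" "frontier U \<subseteq> N1" "\<forall>x\<in>N1. (\<Sum>p\<in>I. \<omega> p x) = 1"
    using C_partition_of_unity[where k=k, OF comp rpos] .
  have "\<forall>p\<in>I. \<exists>hN. directional k U (fst hN) \<and> open (snd hN) \<and> frontier U \<subseteq> snd hN \<and>
      (\<forall>x\<in>snd hN. fst hN x = \<omega> p x * d x)"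
  proof
    fix p assume p: "p \<in> I"
    have "C_on k UNIV (\<lambda>x. \<omega> p x * d x)" using I(3) by (intro C_on_mult open_UNIV d) blast
    moreover have "\<forall>x. x \<notin> ball p (r p) \<longrightarrow> \<omega> p x * d x = 0" using I(5) p by simp
    ultimately have "\<exists>h' N. directional k U h' \<and> open N \<and> frontier U \<subseteq> N \<and> (\<forall>x\<in>N. h' x = \<omega> p x * d x)"
      using r I(2) p by blast
    then show "\<exists>hN. directional k U (fst hN) \<and> open (snd hN) \<and> frontier U \<subseteq> snd hN \<and>
      (\<forall>x\<in>snd hN. fst hN x = \<omega> p x * d x)" by auto
  qed
  from bchoice[OF this] obtain q where
    q: "\<forall>p\<in>I. directional k U (fst (q p)) \<and> open (snd (q p)) \<and> frontier U \<subseteq> snd (q p) \<and>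
      (\<forall>x\<in>snd (q p). fst (q p) x = \<omega> p x * d x)"
    by blast
  show ?thesis
  proof (rule that[of "\<lambda>x. \<Sum>p\<in>I. fst (q p) x" "N1 \<inter> (\<Inter>p\<in>I. snd (q p))"])
    show "directional_sum k U (\<lambda>x. \<Sum>p\<in>I. fst (q p) x)"
      using q by (intro directional_sum_sum directional_imp_sum) blast
    show "open (N1 \<inter> (\<Inter>p\<in>I. snd (q p)))" using I(1,7) q by (intro open_Int open_INT) blast+
    show "frontier U \<subseteq> N1 \<inter> (\<Inter>p\<in>I. snd (q p))" using I(8) q by blast
    show "\<forall>x\<in>N1 \<inter> (\<Inter>p\<in>I. snd (q p)). (\<Sum>p\<in>I. fst (q p) x) = d x"
    proof
      fix x assume x: "x \<in> N1 \<inter> (\<Inter>p\<in>I. snd (q p))"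
      then have "(\<Sum>p\<in>I. fst (q p) x) = (\<Sum>p\<in>I. \<omega> p x * d x)" using q by (intro sum.cong) auto
      also have "\<dots> = (\<Sum>p\<in>I. \<omega> p x) * d x" by (rule sum_distrib_right[symmetric])
      finally show "(\<Sum>p\<in>I. fst (q p) x) = d x" using I(9) x by simp
    qed
  qed
qed

lemma directional_sum_near_closure:
  fixes U :: "'a::euclidean_space set"
  assumes k: "1 \<le> k" and U: "open U" "connected U" "bounded U" "smooth_boundary U"
    and d: "C_on k UNIV d" and int: "(LINT y:U|lebesgue. d y) = 0"
  obtains h V where "directional_sum k U h" "open V" "closure U \<subseteq> V" "\<forall>x\<in>V. h x = d x"
proof -
  have neg: "negligible (frontier U)" by (rule smooth_boundary_negligible[OF U(4)])
  obtain b N where b: "directional_sum k U b" "open N" "frontier U \<subseteq> N" "\<forall>x\<in>N. b x = d x"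
    using boundary_directional_sum[OF k U(3,4) d] .
  \<comment> \<open>Extension by 0 across the frontier is C^k because b = d near it; for the same
    reason d2 is carried by a compact subset of U.\<close>
  define d2 where "d2 = (\<lambda>x. if x \<in> U then d x - b x else 0)"
  have Cb: "C_on k UNIV b" by (rule directional_sum_C_on[OF b(1)])
  have clU: "closure U = U \<union> frontier U" using U(1) by (auto simp: frontier_def interior_open closure_subset[THEN subsetD])
  have oN': "open (N \<union> - closure U)" using b(2) by blast
  have d2_out: "d2 x = 0" if "x \<in> N \<union> - closure U" for x
    using that b(4) closure_subset[of U] by (auto simp: d2_def)
  have "C_on k U d2"
    using C_on_cong[OF U(1), of d2 "\<lambda>x. d x - b x" k] C_on_subset[OF C_on_diff[OF open_UNIV d Cb]]
    by (simp add: d2_def)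
  moreover have "C_on k (N \<union> - closure U) d2"
    using C_on_cong[OF oN', of d2 "\<lambda>x. 0" k] d2_out by simp
  moreover have "U \<union> (N \<union> - closure U) = UNIV" using clU b(3) by blast
  ultimately have Cd2: "C_on k UNIV d2" using C_on_Un[OF U(1) oN', of k d2] by simp
  have "directional_sum k U d2"
  proof (rule interior_directional_sum[OF k U(1,2) neg Cd2])
    show "compact (closure U - N)" using U(3) b(2) by (intro compact_diff) (simp add: compact_closure)
    show "closure U - N \<subseteq> U" using clU b(3) by blast
    show "d2 x = 0" if "x \<notin> closure U - N" for x using d2_out that by blast
    have cl: "compact (closure U)" using U(3) by (simp add: compact_closure)
    have id: "set_integrable lebesgue U d"
      by (rule set_integrable_continuous[OF U(1) C_on_imp_continuous_on[OF d] cl]) (use closure_subset in blast)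
    have ib: "set_integrable lebesgue U b" "(LINT y:U|lebesgue. b y) = 0"
      using directional_sum_integral_zero[OF k U(1) neg b(1)] by auto
    have "(LINT y:U|lebesgue. d2 y) = (LINT y:U|lebesgue. d y - b y)"
      unfolding set_lebesgue_integral_def d2_def by (rule Bochner_Integration.integral_cong) (auto simp: indicator_def)
    also have "\<dots> = 0" using set_integral_diff(2)[OF id ib(1)] int ib(2) by simp
    finally show "(LINT y:U|lebesgue. d2 y) = 0" .
  qed
  then have "directional_sum k U (\<lambda>x. b x + d2 x)" by (rule directional_sum_add[OF b(1)])
  moreover have "b x + d2 x = d x" if "x \<in> U \<union> N" for x
    using that b(4) by (cases "x \<in> U") (auto simp: d2_def)
  moreover have "open (U \<union> N)" "closure U \<subseteq> U \<union> N" using U(1) b(2,3) clU by auto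
  ultimately show ?thesis using that[of "\<lambda>x. b x + d2 x" "U \<union> N"] by blast
qed

lemma C_cutoff_near_compact:
  fixes K :: "'a::euclidean_space set"
  assumes "compact K" "open V" "K \<subseteq> V"
  obtains \<Omega> :: "'a \<Rightarrow> real" and N where "C_on k UNIV \<Omega>" "\<forall>x. \<Omega> x \<le> 1" "\<forall>x. x \<notin> V \<longrightarrow> \<Omega> x = 0"
    "open N" "K \<subseteq> N" "\<forall>x\<in>N. \<Omega> x = 1"
proof -
  have "\<forall>p\<in>K. \<exists>r>0. ball p r \<subseteq> V" using assms(2,3) open_contains_ball by blast
  from bchoice[OF this] obtain r where r: "\<forall>p\<in>K. 0 < r p \<and> ball p (r p) \<subseteq> V" by blast
  have rpos: "\<And>p. p \<in> K \<Longrightarrow> 0 < r p" using r by blast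
  obtain I and \<omega> :: "'a \<Rightarrow> 'a \<Rightarrow> real" and N where I: "finite I" "I \<subseteq> K"
    "\<forall>p. C_on k UNIV (\<omega> p)" "\<forall>p x. 0 \<le> \<omega> p x"
    "\<forall>p\<in>I. \<forall>x. x \<notin> ball p (r p) \<longrightarrow> \<omega> p x = 0" "\<forall>x. (\<Sum>p\<in>I. \<omega> p x) \<le> 1"
    "open N" "K \<subseteq> N" "\<forall>x\<in>N. (\<Sum>p\<in>I. \<omega> p x) = 1"
    using C_partition_of_unity[where k=k, OF assms(1) rpos] .
  show ?thesis
  proof (rule that[of "\<lambda>x. \<Sum>p\<in>I. \<omega> p x" N])
    show "C_on k UNIV (\<lambda>x. \<Sum>p\<in>I. \<omega> p x)" using I(3) by (intro C_on_sum open_UNIV) blast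
    show "\<forall>x. x \<notin> V \<longrightarrow> (\<Sum>p\<in>I. \<omega> p x) = 0"
    proof (intro allI impI sum.neutral ballI)
      fix x p assume "x \<notin> V" "p \<in> I"
      then show "\<omega> p x = 0" using I(2,5) r by blast
    qed
  qed (use I in auto)
qed

text \<open>\<open>k \<ge> 1\<close> gives meaning to the derivative in the determinant. The
  correction h is tied to c g - f near the closure of U only, so an auxiliary density
  \<open>F\<close> agreeing with f near the closure is transported in place of f.\<close>

theorem theorem6:
  fixes U :: "(real ^ 'n) set" and f g :: "real ^ 'n \<Rightarrow> real" and k :: nat
  assumes "k \<ge> 1"
    and "bounded U" and "connected U" and "open U"
    and "connected (frontier U)" and "smooth_boundary U"
    and "C_on k UNIV f" and "\<forall>x. f x > 0"
    and "C_on k UNIV g" and "\<forall>x. g x > 0"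
  shows "\<exists>\<phi> :: real ^ 'n \<Rightarrow> real ^ 'n.
           C_diffeomorphism k UNIV UNIV \<phi> \<and>
           (\<exists>V. open V \<and> closure U \<subseteq> V \<and>
             (\<forall>x\<in>V. det (matrix (frechet_derivative \<phi> (at x))) * f (\<phi> x) =
               ((LINT y:U|lebesgue. f y) / (LINT y:U|lebesgue. g y)) * g x)) \<and>
           (\<forall>x\<in>frontier U. \<phi> x = x)"
proof (cases "U = {}")
  case True
  \<comment> \<open>For empty U the quotient of integrals is 0 / 0 = 0, so with the identity map the
    neighbourhood of the empty closure has to be empty.\<close>
  have "C_diffeomorphism k UNIV UNIV (\<lambda>x::real^'n. x)"
    unfolding C_diffeomorphism_def
    by (intro conjI open_UNIV exI[of _ "\<lambda>x. x"] C_on_id) (simp add: homeomorphism_def)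
  then show ?thesis using True by (intro exI[of _ "\<lambda>x. x"]) auto
next
  case False
  then obtain x0 where x0: "x0 \<in> U" by blast
  note k = assms(1)
  have contf: "continuous_on UNIV f" and contg: "continuous_on UNIV g"
    using C_on_imp_continuous_on assms(7,9) by blast+
  have cl: "compact (closure U)" using assms(2) by (simp add: compact_closure)
  have intf: "set_integrable lebesgue U f" and intg: "set_integrable lebesgue U g"
    using set_integrable_continuous[OF assms(4) _ cl] contf contg closure_subset by blast+
  have pf: "0 < (LINT y:U|lebesgue. f y)" and pg: "0 < (LINT y:U|lebesgue. g y)"
    using set_integral_pos[OF assms(4) x0] contf contg intf intg assms(8,10) less_imp_le by metis+
  define c where "c = (LINT y:U|lebesgue. f y) / (LINT y:U|lebesgue. g y)"
  have c: "0 < c" using pf pg by (simp add: c_def)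
  define d where "d = (\<lambda>x. c * g x - f x)"
  have Cd: "C_on k UNIV d" unfolding d_def by (intro C_on_diff C_on_mult C_on_const open_UNIV assms(7,9))
  have "(LINT y:U|lebesgue. d y) = c * (LINT y:U|lebesgue. g y) - (LINT y:U|lebesgue. f y)"
    unfolding d_def using intf intg by (subst set_integral_diff) auto
  then have "(LINT y:U|lebesgue. d y) = 0" using pg by (simp add: c_def)
  from directional_sum_near_closure[OF k assms(4,3,2,6) Cd this]
  obtain h V0 where h: "directional_sum k U h" "open V0" "closure U \<subseteq> V0" "\<forall>x\<in>V0. h x = d x" .
  obtain C where C: "0 \<le> C" "\<And>x. \<bar>h x\<bar> \<le> C" using transports_small[OF h(1) k] by blast
  obtain \<Omega> :: "real^'n \<Rightarrow> real" and N where \<Omega>: "C_on k UNIV \<Omega>" "\<forall>x. \<Omega> x \<le> 1" "\<forall>x. x \<notin> V0 \<longrightarrow> \<Omega> x = 0"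
    "open N" "closure U \<subseteq> N" "\<forall>x\<in>N. \<Omega> x = 1"
    using C_cutoff_near_compact[where k=k, OF cl h(2,3)] .
  \<comment> \<open>C bounds |h|. F is f near the closure of U and f + C outside V0, so F + h is at
    least c g on V0 and at least f elsewhere, hence positive.\<close>
  define F where "F = (\<lambda>x. f x + C * (1 - \<Omega> x))"
  have CF: "C_on k UNIV F" unfolding F_def
    by (intro C_on_add C_on_mult C_on_diff C_on_const open_UNIV assms(7) \<Omega>(1))
  have Fpos: "0 < F x" and Ff: "f x \<le> F x" for x
    unfolding F_def using assms(8)[rule_format, of x] C(1) \<Omega>(2)[rule_format, of x] by (simp_all add: add_pos_nonneg)
  have Fh: "0 < F x + h x" for x
  proof (cases "x \<in> V0")
    case True
    then have "h x = c * g x - f x" using h(4) by (simp add: d_def)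
    moreover have "0 < c * g x" using c assms(10) by simp
    ultimately show ?thesis using Ff[of x] by linarith
  next
    case False
    then have "F x = f x + C" unfolding F_def using \<Omega>(3) by simp
    moreover have "- C \<le> h x" using C(2)[of x] by linarith
    ultimately show ?thesis using assms(8)[rule_format, of x] by linarith
  qed
  have "transports k U F (\<lambda>x. F x + h x)"
    by (rule transports_directional_sum[OF k h(1) CF Fpos Fh])
  then obtain \<phi> \<psi> where \<phi>: "C_on k UNIV \<phi>" "C_on k UNIV \<psi>" "\<forall>x. \<psi> (\<phi> x) = x" "\<forall>x. \<phi> (\<psi> x) = x"
    "\<forall>x\<in>frontier U. \<phi> x = x" "\<forall>x. \<phi> x \<in> U \<longleftrightarrow> x \<in> U"
    "\<forall>x. det (matrix (frechet_derivative \<phi> (at x))) * F (\<phi> x) = F x + h x"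
    unfolding transports_def by blast
  have cont: "continuous_on UNIV \<phi>" "continuous_on UNIV \<psi>"
    using C_on_imp_continuous_on \<phi>(1,2) by blast+
  have "surj \<phi>" "surj \<psi>" using \<phi>(3,4) by (metis surjI)+
  then have "homeomorphism UNIV UNIV \<phi> \<psi>"
    unfolding homeomorphism_def using cont \<phi>(3,4) by blast
  then have diff: "C_diffeomorphism k UNIV UNIV \<phi>"
    unfolding C_diffeomorphism_def using \<phi>(1,2) by blast
  \<comment> \<open>The preimage of N is included because F = f is needed at \<phi> x as well as at
    x.\<close>
  define V where "V = V0 \<inter> N \<inter> \<phi> -` N"
  have "open V" unfolding V_def using h(2) \<Omega>(4) cont(1) by (intro open_Int open_vimage)
  moreover have "closure U \<subseteq> V"
  proof
    fix x assume x: "x \<in> closure U"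
    have "\<phi> x \<in> closure U"
    proof (cases "x \<in> U")
      case True then show ?thesis using \<phi>(6) closure_subset by blast
    next
      case False
      then have "x \<in> frontier U" using x assms(4) by (simp add: frontier_def interior_open)
      then show ?thesis using \<phi>(5) x by simp
    qed
    then show "x \<in> V" unfolding V_def using x h(3) \<Omega>(5) by blast
  qed
  moreover have "det (matrix (frechet_derivative \<phi> (at x))) * f (\<phi> x) = c * g x" if "x \<in> V" for x
  proof -
    have "\<Omega> x = 1" "\<Omega> (\<phi> x) = 1" "h x = d x" using that \<Omega>(6) h(4) unfolding V_def by blast+
    then have "F x = f x" "F (\<phi> x) = f (\<phi> x)" "h x = c * g x - f x" by (simp_all add: F_def d_def)
    then show ?thesis using \<phi>(7)[rule_format, of x] by simp
  qed
  ultimately show ?thesis using diff \<phi>(5) unfolding c_def by blast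
qed

end
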